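(* For every $\epsilon>0$ there exists a distributed algorithm in the LOCAL model that, for every triangle-free planar graph $G$, computes in a constant number of rounds (the constant depending only on $\epsilon$) a dominating set of $G$ of size at most $(8+\epsilon)\gamma(G)$.
   Context: All graphs are finite, undirected and simple. A graph is triangle-free if it contains no cycle of length $3$. In the LOCAL model the input graph is the communication network: each vertex is a processor with a unique identifier; in each synchronous round every vertex may send arbitrary messages to its neighbours and perform arbitrary local computation; at the end each vertex decides whether it belongs to the output set. A dominating set of $G$ is a set $D\subseteq V(G)$ such that every vertex is in $D$ or has a neighbour in $D$; $\gamma(G)$ is the minimum size of a dominating set. *)

theory Defs
  imports "HOL-Analysis.Analysis"
begin

text \<open>Finite simple undirected graphs whose vertices are natural numbers; the vertex
  itself serves as its unique identifier in the LOCAL model.\<close>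

definition simple_graph :: "nat set \<Rightarrow> (nat \<Rightarrow> nat \<Rightarrow> bool) \<Rightarrow> bool" where
  "simple_graph V E \<longleftrightarrow> finite V \<and> (\<forall>u v. E u v \<longrightarrow> u \<in> V \<and> v \<in> V)
     \<and> (\<forall>u v. E u v \<longrightarrow> E v u) \<and> (\<forall>v. \<not> E v v)"

definition triangle_free :: "nat set \<Rightarrow> (nat \<Rightarrow> nat \<Rightarrow> bool) \<Rightarrow> bool" where
  "triangle_free V E \<longleftrightarrow> \<not> (\<exists>a\<in>V. \<exists>b\<in>V. \<exists>c\<in>V. E a b \<and> E b c \<and> E c a)"

definition planar :: "nat set \<Rightarrow> (nat \<Rightarrow> nat \<Rightarrow> bool) \<Rightarrow> bool" where
  "planar V E \<longleftrightarrow> (\<exists>(p :: nat \<Rightarrow> complex) (g :: nat \<Rightarrow> nat \<Rightarrow> real \<Rightarrow> complex).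
     inj_on p V \<and>
     (\<forall>u v. E u v \<longrightarrow> arc (g u v) \<and> pathstart (g u v) = p u \<and> pathfinish (g u v) = p v) \<and>
     (\<forall>u v. E u v \<longrightarrow> path_image (g u v) \<inter> p ` V \<subseteq> {p u, p v}) \<and>
     (\<forall>u v x y. E u v \<longrightarrow> E x y \<longrightarrow> {u, v} \<noteq> {x, y} \<longrightarrow>
        path_image (g u v) \<inter> path_image (g x y) \<subseteq> {p u, p v} \<inter> {p x, p y}))"

definition dominating_set :: "nat set \<Rightarrow> (nat \<Rightarrow> nat \<Rightarrow> bool) \<Rightarrow> nat set \<Rightarrow> bool" where
  "dominating_set V E D \<longleftrightarrow> D \<subseteq> V \<and> (\<forall>v\<in>V. v \<in> D \<or> (\<exists>u\<in>D. E v u))"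

definition domination_number :: "nat set \<Rightarrow> (nat \<Rightarrow> nat \<Rightarrow> bool) \<Rightarrow> nat" where
  "domination_number V E = Min {card D | D. dominating_set V E D}"

fun nbhd :: "(nat \<Rightarrow> nat \<Rightarrow> bool) \<Rightarrow> nat \<Rightarrow> nat \<Rightarrow> nat set" where
  "nbhd E 0 v = {v}"
| "nbhd E (Suc r) v = nbhd E r v \<union> {u. \<exists>w\<in>nbhd E r v. E w u}"

text \<open>An \<open>r\<close>-round deterministic LOCAL algorithm is modelled as a decision rule
  \<open>A\<close> applied to the view of a vertex: the subgraph induced by its radius-\<open>r\<close> ball
  (with identifiers) and the vertex itself.  The output set of the algorithm:\<close>

definition local_output ::
  "(nat set \<Rightarrow> (nat \<Rightarrow> nat \<Rightarrow> bool) \<Rightarrow> nat \<Rightarrow> bool) \<Rightarrow> nat \<Rightarrow>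
   nat set \<Rightarrow> (nat \<Rightarrow> nat \<Rightarrow> bool) \<Rightarrow> nat set" where
  "local_output A r V E =
     {v \<in> V. A (nbhd E r v) (\<lambda>x y. x \<in> nbhd E r v \<and> y \<in> nbhd E r v \<and> E x y) v}"

end

theory Submission
  imports Defs
begin

text \<open>
  Let \<open>D\<close> be a minimum dominating set, with \<open>\<gamma>\<close> vertices.  Only linear edge bounds for
  triangle-free planar graphs and for planar graphs obtained by replacing paths of length two by
  edges are used.  They bound the hubs (vertices whose neighbourhood is not dominated by few other
  vertices) outside \<open>D\<close>, and all hubs are chosen.  Around a non-hub, vertices of large
  residual degree come in fat pairs with many common neighbours, and up to few exceptions \<open>D\<close>
  meets every fat pair.  Hence the linear program that asks for total weight \<open>1\<close> on every fat pair
  and on the closed neighbourhood of every vertex that is neither adjacent to a hub nor a common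
  neighbour of a fat pair has value at most about the number of non-hubs in \<open>D\<close>, while every
  variable occurs in a bounded number of constraints.  After identifying variables with equal
  columns there are only \<open>O(\<gamma>)\<close> of them, so a constant number of subgradient steps on the
  exact penalty function solves the program up to an additive error of \<open>\<gamma>/5\<close>.  Rounding at
  the threshold \<open>1/5\<close> costs a factor \<open>5\<close>, because every subgraph has at most twice as
  many edges as vertices.

  The edge bound is proved without Euler's formula.  In a minimal counterexample every proper part has
  two attachment vertices, so anything inside a cycle yields a path through its inside between two of
  its vertices, and the theta-curve theorem splits the cycle; this gives a bound for the inside of
  every cycle by induction.  An inversion exchanges the inside and the outside of a cycle.
\<close>

section \<open>Triangle-free plane graphs have at most twice as many edges as vertices\<close>

text \<open>The obstacle is that a constant number of rounds forces a step size and a number of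
  steps independent of the graph. The error of the descent grows with the number of variables and
  with the square of the number of rows through a variable, so the former must be
  \<open>O(\<gamma>)\<close> and the latter bounded. Neither holds for the plain domination program.
  Long columns have two sources: hubs, which are bought outright, and pairs with many common
  neighbours, whose unboundedly many rows are traded for the single row of the pair. That row
  suffices: one of its two weights is at least 1/2, hence survives the threshold and dominates all
  the common neighbours. There may still be too many columns, as for the middle vertices of a
  complete bipartite graph with two vertices on one side, but planarity leaves only linearly many
  different ones. In the factor 8, hubs outside \<open>D\<close> cost 1 and rounding costs 5; the
  remaining 2 pays for the fat pairs missed by \<open>D\<close> and for the two error terms of the
  descent.\<close>

definition edges :: "(nat \<Rightarrow> nat \<Rightarrow> bool) \<Rightarrow> nat set set" where
  "edges E = {{u, v} |u v. E u v}"

fun ledges :: "'a list \<Rightarrow> 'a set set" where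
  "ledges [] = {}"
| "ledges [x] = {}"
| "ledges (x # y # zs) = insert {x, y} (ledges (y # zs))"

lemma ledges_subset: "e \<in> ledges xs \<Longrightarrow> e \<subseteq> set xs"
  by (induction xs rule: ledges.induct) auto

lemma finite_ledges [simp]: "finite (ledges xs)"
  by (induction xs rule: ledges.induct) auto

lemma ledges_append: "ledges (xs @ y # zs) = ledges (xs @ [y]) \<union> ledges (y # zs)"
  by (induction xs rule: ledges.induct) auto

lemma ledges_snoc: "xs \<noteq> [] \<Longrightarrow> ledges (xs @ [y]) = insert {last xs, y} (ledges xs)"
  by (induction xs rule: ledges.induct) auto

lemma ledges_rev [simp]: "ledges (rev xs) = ledges xs"
proof (induction xs rule: ledges.induct)
  case (3 x y zs)
  have "ledges (rev (x # y # zs)) = ledges (rev zs @ [y]) \<union> ledges [y, x]"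
    using ledges_append[of "rev zs" y "[x]"] by simp
  then show ?case using 3 by (auto simp: insert_commute)
qed auto

lemma card_ledges: "distinct xs \<Longrightarrow> card (ledges xs) = length xs - 1"
proof (induction xs rule: ledges.induct)
  case (3 x y zs)
  have "{x, y} \<notin> ledges (y # zs)" using 3(2) ledges_subset by fastforce
  then show ?case using 3 by simp
qed auto

lemma Union_ledges: "length xs \<ge> 2 \<Longrightarrow> \<Union> (ledges xs) = set xs"
proof (induction xs rule: ledges.induct)
  case (3 x y zs)
  show ?case
  proof (cases zs)
    case (Cons z zs')
    then show ?thesis using 3 by auto
  qed auto
qed auto

text \<open>A simple path never returns to its first vertex, so only its first edge can contain
  \<open>x\<close>. This is what keeps two paths with common ends edge disjoint.\<close>

lemma ends_in_ledges:
  assumes "distinct (x # us @ [y])" "{x, y} \<in> ledges (x # us @ [y])"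
  shows "us = []"
proof (cases us)
  case (Cons u us')
  have "{x, y} \<notin> ledges (u # us' @ [y])"
    using assms(1) ledges_subset[of "{x,y}" "u # us' @ [y]"] Cons by auto
  then show ?thesis using assms Cons by (auto simp: doubleton_eq_iff)
qed auto

lemma successively_ledges:
  assumes "successively E xs" "e \<in> ledges xs"
  shows "e \<in> edges E"
  using assms by (induction xs rule: ledges.induct) (auto simp: edges_def)

lemma finite_edges: "simple_graph V E \<Longrightarrow> finite (edges E)"
  by (rule finite_subset[of _ "Pow V"]) (auto simp: edges_def simple_graph_def)

text \<open>Loop erasure: when the new first vertex already lies on the path found so far, the part
  before it is dropped, which keeps the list distinct.\<close>

lemma path_of_rtrancl:
  assumes "(a, b) \<in> {(x, y). E x y \<and> x \<in> W \<and> y \<in> W}\<^sup>*" "b \<in> W"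
  shows "\<exists>xs. distinct xs \<and> xs \<noteq> [] \<and> successively E xs \<and> hd xs = a \<and> last xs = b \<and> set xs \<subseteq> W"
  using assms(1)
proof (induction rule: converse_rtrancl_induct)
  case base
  show ?case using assms(2) by (intro exI[of _ "[b]"]) auto
next
  case (step a c)
  then obtain xs where xs: "distinct xs" "xs \<noteq> []" "successively E xs" "hd xs = c" "last xs = b"
      "set xs \<subseteq> W" by blast
  show ?case
  proof (cases "a \<in> set xs")
    case True
    then obtain us vs where *: "xs = us @ a # vs" by (meson split_list)
    show ?thesis
      by (rule exI[of _ "a # vs"]) (use xs * in \<open>auto simp: successively_append_iff\<close>)
  next
    case False
    show ?thesis
      by (rule exI[of _ "a # xs"]) (use xs step False in \<open>auto simp: successively_Cons\<close>)
  qed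
qed

lemma connected_inside:
  fixes S T :: "complex set"
  assumes "connected T" "T \<inter> S = {}" "T \<inter> inside S \<noteq> {}"
  shows "T \<subseteq> inside S"
proof -
  obtain x where x: "x \<in> T" "x \<in> inside S" using assms by auto
  have "T \<subseteq> connected_component_set (- S) x"
    using assms x by (intro connected_component_maximal) auto
  then show ?thesis using x inside_same_component[of S x] by (auto simp: connected_component_eq_eq)
qed

section \<open>Plane drawings, and the curves carried by paths and cycles\<close>

locale plane_graph =
  fixes V :: "nat set" and E :: "nat \<Rightarrow> nat \<Rightarrow> bool"
    and p :: "nat \<Rightarrow> complex" and g :: "nat \<Rightarrow> nat \<Rightarrow> real \<Rightarrow> complex"
  assumes simple: "simple_graph V E"
    and inj: "inj_on p V"
    and arcs: "E u v \<Longrightarrow> arc (g u v) \<and> pathstart (g u v) = p u \<and> pathfinish (g u v) = p v"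
    and image_sym: "E u v \<Longrightarrow> path_image (g v u) = path_image (g u v)"
    and image_vertex: "E u v \<Longrightarrow> w \<in> V \<Longrightarrow> p w \<in> path_image (g u v) \<Longrightarrow> w \<in> {u, v}"
    and image_cross: "E u v \<Longrightarrow> E x y \<Longrightarrow> {u, v} \<noteq> {x, y} \<Longrightarrow>
      path_image (g u v) \<inter> path_image (g x y) \<subseteq> p ` ({u, v} \<inter> {x, y})"
begin

lemma finite_V: "finite V" and E_V: "E u v \<Longrightarrow> u \<in> V \<and> v \<in> V"
  and E_sym: "E u v \<Longrightarrow> E v u" and E_irrefl: "\<not> E v v"
  using simple by (auto simp: simple_graph_def)

definition img :: "nat set \<Rightarrow> complex set" where
  "img e = \<Union> {path_image (g u v) |u v. e = {u, v} \<and> E u v}"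

text \<open>Without its ends an edge is still connected, and it misses all vertices and all other
  edges; so it stays on one side of every cycle that does not use it.\<close>

definition open_img :: "nat set \<Rightarrow> complex set" where
  "open_img e = img e - p ` e"

lemma img_eq: "E u v \<Longrightarrow> img {u, v} = path_image (g u v)"
  unfolding img_def using image_sym[of u v] E_sym
  by (auto simp: doubleton_eq_iff)

lemma edgesE:
  assumes "e \<in> edges E"
  obtains u v where "e = {u, v}" "E u v" "u \<noteq> v" "u \<in> V" "v \<in> V"
  using assms E_V E_irrefl unfolding edges_def by blast

lemma img_cross: "e \<in> edges E \<Longrightarrow> f \<in> edges E \<Longrightarrow> e \<noteq> f \<Longrightarrow> img e \<inter> img f \<subseteq> p ` (e \<inter> f)"
  by (metis edgesE image_cross img_eq)

lemma img_vertex: "e \<in> edges E \<Longrightarrow> w \<in> V \<Longrightarrow> p w \<in> img e \<longleftrightarrow> w \<in> e"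
proof (elim edgesE)
  fix u v assume *: "e = {u, v}" "E u v" and w: "w \<in> V"
  have "p u \<in> img e" "p v \<in> img e"
    using * arcs[of u v] pathstart_in_path_image[of "g u v"] pathfinish_in_path_image[of "g u v"]
    by (auto simp: img_eq)
  then show "p w \<in> img e \<longleftrightarrow> w \<in> e" using * w image_vertex[of u v w] by (auto simp: img_eq)
qed

lemma edges_V: "e \<in> edges E \<Longrightarrow> e \<subseteq> V"
  by (auto simp: edges_def dest: E_V)

lemma open_img_disjoint:
  "e \<in> edges E \<Longrightarrow> f \<in> edges E \<Longrightarrow> e \<noteq> f \<Longrightarrow> open_img e \<inter> img f = {}"
  using img_cross[of e f] by (auto simp: open_img_def)

lemma open_img_no_vertex: "e \<in> edges E \<Longrightarrow> w \<in> V \<Longrightarrow> p w \<notin> open_img e"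
  using img_vertex by (auto simp: open_img_def)

lemma open_img_props:
  assumes "e \<in> edges E"
  shows "connected (open_img e)" "open_img e \<noteq> {}" "img e \<subseteq> closure (open_img e)"
proof -
  obtain u v where uv: "e = {u, v}" "E u v" using assms by (auto elim: edgesE)
  have a: "simple_path (g u v)" "arc (g u v)" "pathstart (g u v) = p u" "pathfinish (g u v) = p v"
    using arcs[OF uv(2)] arc_imp_simple_path by auto
  have eq: "open_img e = path_image (g u v) - {pathstart (g u v), pathfinish (g u v)}"
    using uv a by (simp add: open_img_def img_eq)
  show "connected (open_img e)" unfolding eq by (rule connected_simple_path_endless[OF a(1)])
  have eq': "open_img e = g u v ` {0<..<1}"
    unfolding eq using simple_path_endless[OF a(1)] by simp
  show "open_img e \<noteq> {}" unfolding eq' by simp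
  have "path_image (g u v) = g u v ` closure {0<..<1}"
    by (simp add: path_image_def)
  also have "\<dots> \<subseteq> closure (g u v ` {0<..<1})"
    by (rule image_closure_subset)
      (use a in \<open>auto simp: arc_def path_def intro: closure_subset[THEN subsetD]\<close>)
  finally show "img e \<subseteq> closure (open_img e)" using uv eq' by (simp add: img_eq)
qed

definition limg :: "nat set set \<Rightarrow> complex set" where
  "limg F = \<Union> (img ` F)"

lemma limg_Un: "limg (F \<union> F') = limg F \<union> limg F'"
  by (auto simp: limg_def)

lemma limg_insert: "limg (insert e F') = img e \<union> limg F'"
  by (auto simp: limg_def)

lemma limg_cross:
  assumes "F \<subseteq> edges E" "F' \<subseteq> edges E" "F \<inter> F' = {}"
  shows "limg F \<inter> limg F' \<subseteq> p ` (\<Union>F \<inter> \<Union>F')"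
proof
  fix z assume "z \<in> limg F \<inter> limg F'"
  then obtain e f where ef: "e \<in> F" "f \<in> F'" "z \<in> img e" "z \<in> img f" by (auto simp: limg_def)
  then have "z \<in> p ` (e \<inter> f)" using img_cross[of e f] assms by blast
  then show "z \<in> p ` (\<Union>F \<inter> \<Union>F')" using ef by auto
qed

lemma limg_vertex: "F \<subseteq> edges E \<Longrightarrow> w \<in> V \<Longrightarrow> p w \<in> limg F \<longleftrightarrow> w \<in> \<Union>F"
  unfolding limg_def using img_vertex by blast

lemma open_img_limg_disjoint:
  "F \<subseteq> edges E \<Longrightarrow> e \<in> edges E \<Longrightarrow> e \<notin> F \<Longrightarrow> open_img e \<inter> limg F = {}"
  unfolding limg_def using open_img_disjoint[of e] by fastforce

lemma open_img_subset_limg: "e \<in> F \<Longrightarrow> open_img e \<subseteq> limg F"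
  by (auto simp: limg_def open_img_def)

definition vpath :: "nat list \<Rightarrow> bool" where
  "vpath xs \<longleftrightarrow> distinct xs \<and> successively E xs \<and> length xs \<ge> 2"

lemma vpath_edges: "vpath xs \<Longrightarrow> ledges xs \<subseteq> edges E"
  using successively_ledges by (auto simp: vpath_def)

lemma vpath_V: "vpath xs \<Longrightarrow> set xs \<subseteq> V"
  using vpath_edges[of xs] Union_ledges[of xs] edges_V by (fastforce simp: vpath_def)

lemma vpath_rev: "vpath xs \<Longrightarrow> vpath (rev xs)"
  unfolding vpath_def using E_sym by (auto elim!: successively_mono)

lemma vpath_arc:
  "vpath xs \<Longrightarrow> \<exists>\<gamma>. arc \<gamma> \<and> pathstart \<gamma> = p (hd xs) \<and> pathfinish \<gamma> = p (last xs)
     \<and> path_image \<gamma> = limg (ledges xs)"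
proof (induction xs rule: ledges.induct)
  case (3 x y zs)
  have E: "E x y" using 3(2) by (simp add: vpath_def)
  show ?case
  proof (cases zs)
    case Nil
    then show ?thesis using arcs[OF E] E
      by (intro exI[of _ "g x y"]) (auto simp: limg_def img_eq)
  next
    case (Cons z zs')
    have p: "vpath (y # zs)" using 3(2) Cons by (auto simp: vpath_def)
    obtain \<gamma> where \<gamma>: "arc \<gamma>" "pathstart \<gamma> = p y" "pathfinish \<gamma> = p (last zs)"
      "path_image \<gamma> = limg (ledges (y # zs))"
      using 3(1)[OF p] Cons by auto
    have dj: "{{x, y}} \<inter> ledges (y # zs) = {}"
      using 3(2) ledges_subset[of "{x,y}" "y # zs"] by (auto simp: vpath_def)
    have "{{x, y}} \<subseteq> edges E" using E by (auto simp: edges_def)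
    moreover have "\<Union> (ledges (y # zs)) = set (y # zs)"
      by (rule Union_ledges) (simp add: Cons)
    ultimately have "limg {{x, y}} \<inter> limg (ledges (y # zs)) \<subseteq> p ` ({x, y} \<inter> set (y # zs))"
      using limg_cross[OF _ vpath_edges[OF p] dj] by simp
    also have "\<dots> = {p y}" using 3(2) by (auto simp: vpath_def)
    finally have "path_image (g x y) \<inter> path_image \<gamma> \<subseteq> {p y}"
      using E \<gamma> by (simp add: limg_def img_eq)
    then have "arc (g x y +++ \<gamma>)" using arcs[OF E] \<gamma> by (intro arc_join) auto
    then show ?thesis using arcs[OF E] \<gamma> E Cons
      by (intro exI[of _ "g x y +++ \<gamma>"]) (auto simp: path_image_join limg_insert img_eq)
  qed
qed (auto simp: vpath_def)

definition cyc :: "nat list \<Rightarrow> bool" where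
  "cyc cs \<longleftrightarrow> distinct cs \<and> length cs \<ge> 3 \<and> successively E (cs @ [hd cs])"

definition cedges :: "nat list \<Rightarrow> nat set set" where
  "cedges cs = ledges (cs @ [hd cs])"

lemma cyc_rotate:
  assumes "cyc (us @ x # vs)"
  shows "cyc (x # vs @ us)" "cedges (x # vs @ us) = cedges (us @ x # vs)"
proof -
  show "cyc (x # vs @ us)"
    using assms
    by (cases us) (auto simp: cyc_def successively_append_iff successively_Cons hd_append split: if_splits)
  show "cedges (x # vs @ us) = cedges (us @ x # vs)"
  proof (cases us)
    case (Cons h us')
    then show ?thesis
      using ledges_append[of "h # us'" x "vs @ [h]"] ledges_append[of "x # vs" h "us' @ [x]"]
      by (auto simp: cedges_def)
  qed auto
qed

lemma cyc_split:
  assumes "cyc cs" "x \<in> set cs" "y \<in> set cs" "x \<noteq> y"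
  obtains us vs where "cyc (x # us @ y # vs)" "cedges (x # us @ y # vs) = cedges cs"
    "set (x # us @ y # vs) = set cs" "length (x # us @ y # vs) = length cs"
proof -
  obtain as bs where 1: "cs = as @ x # bs" using assms(2) by (meson split_list)
  have "y \<in> set (bs @ as)" using 1 assms by auto
  then obtain us vs where 2: "bs @ as = us @ y # vs" by (meson split_list)
  have 3: "set (bs @ as) = set (us @ y # vs)" "length (bs @ as) = length (us @ y # vs)"
    using 2 by auto
  have 4: "set (x # us @ y # vs) = set cs" "length (x # us @ y # vs) = length cs"
    using 1 3 by auto
  show ?thesis
    by (rule that[OF _ _ 4]) (use cyc_rotate[of as x bs] assms(1) 1 2 in auto)
qed

text \<open>The two arcs share only the vertices \<open>x\<close> and \<open>y\<close>, so a common
  edge would have to join these; then both arcs would be that single edge and the cycle would have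
  length 2.\<close>

lemma cyc_vpaths:
  assumes "cyc (x # us @ y # vs)"
  shows "vpath (x # us @ [y])" "vpath (y # vs @ [x])"
    "cedges (x # us @ y # vs) = ledges (x # us @ [y]) \<union> ledges (y # vs @ [x])"
    "ledges (x # us @ [y]) \<inter> ledges (y # vs @ [x]) = {}"
proof -
  show *: "vpath (x # us @ [y])" "vpath (y # vs @ [x])"
    using assms
    by (auto simp: cyc_def vpath_def successively_append_iff successively_Cons hd_append split: if_splits)
  show "cedges (x # us @ y # vs) = ledges (x # us @ [y]) \<union> ledges (y # vs @ [x])"
    using ledges_append[of "x # us" y "vs @ [x]"] by (simp add: cedges_def)
  show "ledges (x # us @ [y]) \<inter> ledges (y # vs @ [x]) = {}"
  proof (rule ccontr)
    assume "\<not> ?thesis"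
    then obtain e where e: "e \<in> ledges (x # us @ [y])" "e \<in> ledges (y # vs @ [x])" by auto
    have "set (x # us @ [y]) \<inter> set (y # vs @ [x]) = {x, y}" using assms by (auto simp: cyc_def)
    then have "e \<subseteq> {x, y}" using ledges_subset[OF e(1)] ledges_subset[OF e(2)] by auto
    moreover have "e \<in> edges E" using e(1) vpath_edges[OF *(1)] by auto
    ultimately have "e = {x, y}" by (auto elim!: edgesE)
    then have "us = []" "vs = []"
      using ends_in_ledges[of x us y] ends_in_ledges[of y vs x] e * by (auto simp: vpath_def insert_commute)
    then show False using assms by (simp add: cyc_def)
  qed
qed

lemma cyc_edges: assumes "cyc cs"
  shows "cedges cs \<subseteq> edges E" "\<Union>(cedges cs) = set cs" "card (cedges cs) = length cs" "set cs \<subseteq> V"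
proof -
  show 1: "cedges cs \<subseteq> edges E" using assms successively_ledges by (auto simp: cedges_def cyc_def)
  have ne: "cs \<noteq> []" using assms by (auto simp: cyc_def)
  show 2: "\<Union>(cedges cs) = set cs"
    using Union_ledges[of "cs @ [hd cs]"] assms ne by (auto simp: cedges_def cyc_def)
  then show "set cs \<subseteq> V" using 1 edges_V by auto
  obtain x us y where cs: "cs = x # us @ [y]"
    using assms by (cases cs; cases "tl cs" rule: rev_cases) (auto simp: cyc_def)
  have "{y, x} \<notin> ledges cs"
    using assms ends_in_ledges[of x us y] cs by (auto simp: cyc_def insert_commute)
  moreover have "cedges cs = insert {y, x} (ledges cs)"
    using ledges_snoc[of cs x] cs by (simp add: cedges_def)
  moreover have "distinct cs" "length cs \<ge> 1" using assms by (auto simp: cyc_def)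
  ultimately show "card (cedges cs) = length cs" using card_ledges[of cs] by simp
qed

lemma limg_paths_Int:
  assumes "vpath (x # us @ [y])" "vpath (x # vs @ [y])" "set us \<inter> set vs = {}"
    "ledges (x # us @ [y]) \<inter> ledges (x # vs @ [y]) = {}"
  shows "limg (ledges (x # us @ [y])) \<inter> limg (ledges (x # vs @ [y])) = {p x, p y}"
proof
  have 1: "\<Union> (ledges (x # us @ [y])) = set (x # us @ [y])" "\<Union> (ledges (x # vs @ [y])) = set (x # vs @ [y])"
    by (rule Union_ledges, simp)+
  have "set (x # us @ [y]) \<inter> set (x # vs @ [y]) = {x, y}"
    using assms by (auto simp: vpath_def)
  then show "limg (ledges (x # us @ [y])) \<inter> limg (ledges (x # vs @ [y])) \<subseteq> {p x, p y}"
    using limg_cross[OF vpath_edges[OF assms(1)] vpath_edges[OF assms(2)] assms(4)] 1 by simp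
  have "x \<in> V" "y \<in> V" using vpath_V[OF assms(1)] by auto
  then show "{p x, p y} \<subseteq> limg (ledges (x # us @ [y])) \<inter> limg (ledges (x # vs @ [y]))"
    using limg_vertex[OF vpath_edges[OF assms(1)]] limg_vertex[OF vpath_edges[OF assms(2)]] 1 by auto
qed

lemma cyc_loop:
  assumes "cyc cs"
  obtains c where "simple_path c" "pathfinish c = pathstart c" "path_image c = limg (cedges cs)"
proof -
  obtain x us y where cs: "cs = x # us @ [y]"
    using assms by (cases cs; cases "tl cs" rule: rev_cases) (auto simp: cyc_def)
  note * = cyc_vpaths[of x us y "[]", OF assms[unfolded cs]]
  have r: "vpath (x # [] @ [y])" "ledges (x # [] @ [y]) = ledges (y # [] @ [x])"
    using vpath_rev[OF *(2)] by (auto simp: insert_commute)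
  obtain c1 where c1: "arc c1" "pathstart c1 = p x" "pathfinish c1 = p y"
     "path_image c1 = limg (ledges (x # us @ [y]))"
    using vpath_arc[OF *(1)] cs by auto
  obtain c2 where c2: "arc c2" "pathstart c2 = p y" "pathfinish c2 = p x"
     "path_image c2 = limg (ledges (y # [] @ [x]))"
    using vpath_arc[OF *(2)] by auto
  have "path_image c1 \<inter> path_image c2 \<subseteq> {p x, p y}"
    using limg_paths_Int[OF *(1) r(1)] *(4) r(2) c1 c2 by simp
  then have "simple_path (c1 +++ c2)" using c1 c2 by (intro simple_path_join_loop) auto
  then show ?thesis
    using that[of "c1 +++ c2"] c1 c2 *(3) cs
    by (simp add: path_image_join limg_insert limg_def Un_commute)
qed

section \<open>What lies inside a cycle\<close>

definition vin :: "nat list \<Rightarrow> nat set" where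
  "vin cs = {v \<in> V. p v \<in> inside (limg (cedges cs))}"

text \<open>Asking only that the open edge meets the inside is enough: such an edge is not on the
  cycle, so its open part is connected and misses the cycle, and \<open>ein_props\<close> turns
  meeting into containment.\<close>

definition ein :: "nat list \<Rightarrow> nat set set" where
  "ein cs = {e \<in> edges E. open_img e \<inter> inside (limg (cedges cs)) \<noteq> {}}"

lemma finite_ein: "finite (ein cs)" and finite_vin: "finite (vin cs)"
  using finite_edges[OF simple] finite_V by (auto simp: ein_def vin_def)

lemma ein_props:
  assumes "cyc cs" "e \<in> ein cs"
  shows "e \<notin> cedges cs" "open_img e \<subseteq> inside (limg (cedges cs))" "e \<subseteq> vin cs \<union> set cs"
proof -
  let ?C = "limg (cedges cs)"
  have e: "e \<in> edges E" "open_img e \<inter> inside ?C \<noteq> {}" using assms by (auto simp: ein_def)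
  show 1: "e \<notin> cedges cs" using e open_img_subset_limg inside_no_overlap[of ?C] by blast
  show 2: "open_img e \<subseteq> inside ?C"
    using open_img_limg_disjoint[OF cyc_edges(1)[OF assms(1)] e(1) 1] open_img_props[OF e(1)] e(2)
    by (intro connected_inside) auto
  obtain c where "simple_path c" "pathfinish c = pathstart c" "path_image c = ?C"
    using cyc_loop[OF assms(1)] .
  then have "closed ?C" using closed_simple_path_image by metis
  then have "closure (inside ?C) \<subseteq> ?C \<union> inside ?C" by (rule closure_inside_subset)
  then have 3: "img e \<subseteq> ?C \<union> inside ?C"
    using open_img_props(3)[OF e(1)] closure_mono[OF 2] by blast
  show "e \<subseteq> vin cs \<union> set cs"
  proof
    fix v assume v: "v \<in> e"
    then have "v \<in> V" using e edges_V by auto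
    moreover have "p v \<in> ?C \<union> inside ?C" using img_vertex[OF e(1) \<open>v \<in> V\<close>] v 3 by auto
    ultimately show "v \<in> vin cs \<union> set cs"
      using limg_vertex[OF cyc_edges(1)[OF assms(1)] \<open>v \<in> V\<close>] cyc_edges(2)[OF assms(1)] 
      by (auto simp: vin_def)
  qed
qed

lemma ein_of_vin:
  assumes "cyc cs" "e \<in> edges E" "v \<in> e" "v \<in> vin cs"
  shows "e \<in> ein cs"
proof -
  obtain c where "simple_path c" "pathfinish c = pathstart c" "path_image c = limg (cedges cs)"
    using cyc_loop[OF assms(1)] .
  then have o: "open (inside (limg (cedges cs)))" using Jordan_inside_outside[of c] by auto
  have v: "v \<in> V" "p v \<in> inside (limg (cedges cs))" using assms by (auto simp: vin_def)
  then have "p v \<in> closure (open_img e)"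
    using img_vertex[OF assms(2) v(1)] assms(3) open_img_props(3)[OF assms(2)] by auto
  then have "inside (limg (cedges cs)) \<inter> open_img e \<noteq> {}"
    using o v(2) by (metis IntI closure_iff_nhds_not_empty empty_iff inf_commute open_Int_closure_eq_empty)
  then show ?thesis using assms by (auto simp: ein_def)
qed

text \<open>A path across the inside. Inner vertices inside the cycle force the edges of the path to
  run inside as well; a single edge could instead belong to the cycle or run outside it, which the
  last clause excludes.\<close>

definition chord :: "nat list \<Rightarrow> nat \<Rightarrow> nat list \<Rightarrow> nat \<Rightarrow> bool" where
  "chord cs x ms y \<longleftrightarrow> x \<in> set cs \<and> y \<in> set cs \<and> vpath (x # ms @ [y]) \<and> set ms \<subseteq> vin cs \<and>
     (ms = [] \<longrightarrow> {x, y} \<in> ein cs)"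

lemma cyc_vin_disjoint:
  assumes cs: "cyc cs"
  shows "set cs \<inter> vin cs = {}"
  using limg_vertex[OF cyc_edges(1)[OF cs]] cyc_edges(2)[OF cs] inside_no_overlap
  by (fastforce simp: vin_def)

text \<open>\<open>conn\<close> is the connectivity of a minimal counterexample. Applied to a
  component of the vertices inside the cycle, whose outer neighbours all lie on the cycle, it yields
  two attachment vertices, which are joined through the component. If no vertex lies inside, any
  edge inside is a chord.\<close>

lemma chord_exists:
  assumes conn: "\<And>Q. Q \<subseteq> V \<Longrightarrow> Q \<noteq> {} \<Longrightarrow> card (V - Q) \<ge> 2 \<Longrightarrow>
      \<exists>x\<in>V - Q. \<exists>y\<in>V - Q. x \<noteq> y \<and> (\<exists>q\<in>Q. E x q) \<and> (\<exists>q\<in>Q. E q y)"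
    and cs: "cyc cs" and ne: "vin cs \<noteq> {} \<or> ein cs \<noteq> {}"
  shows "\<exists>x ms y. chord cs x ms y"
proof (cases "vin cs = {}")
  case True
  then obtain e where e: "e \<in> ein cs" using ne by auto
  then have "e \<in> edges E" by (auto simp: ein_def)
  then obtain u v where uv: "e = {u, v}" "E u v" "u \<noteq> v" by (auto elim: edgesE)
  have "{u, v} \<subseteq> set cs" using ein_props(3)[OF cs e] True uv by auto
  then have "chord cs u [] v" using uv e by (auto simp: chord_def vpath_def)
  then show ?thesis by blast
next
  case False
  then obtain w where w: "w \<in> vin cs" by auto
  define r where "r = {(x, y). E x y \<and> x \<in> vin cs \<and> y \<in> vin cs}"
  define Q where "Q = {x. (w, x) \<in> r\<^sup>*}"
  have Qv: "Q \<subseteq> vin cs"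
  proof
    fix x assume "x \<in> Q"
    then have "(w, x) \<in> r\<^sup>*" by (simp add: Q_def)
    then show "x \<in> vin cs" by (induction rule: rtrancl_induct) (auto simp: w r_def)
  qed
  have Qcs: "set cs \<inter> Q = {}"
    using cyc_vin_disjoint[OF cs] Qv by auto
  have nb: "y \<in> set cs" if "E q y" "q \<in> Q" "y \<notin> Q" for q y
  proof -
    have "{q, y} \<in> ein cs"
      using that Qv by (intro ein_of_vin[OF cs, of _ q]) (auto simp: edges_def)
    then have "y \<in> vin cs \<union> set cs" using ein_props(3)[OF cs] by auto
    moreover have "y \<notin> vin cs"
    proof
      assume "y \<in> vin cs"
      then have "(q, y) \<in> r" using that Qv by (auto simp: r_def)
      then show False using that by (auto simp: Q_def intro: rtrancl_into_rtrancl)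
    qed
    ultimately show ?thesis by auto
  qed
  have "card (set cs) \<ge> 3" using cs distinct_card[of cs] by (auto simp: cyc_def)
  moreover have "card (set cs) \<le> card (V - Q)"
    using cyc_edges(4)[OF cs] Qcs finite_V by (intro card_mono) auto
  ultimately have "card (V - Q) \<ge> 2" by simp
  moreover have "Q \<noteq> {}" "Q \<subseteq> V" using Qv by (auto simp: Q_def vin_def)
  ultimately obtain x y q q' where xy: "x \<in> V - Q" "y \<in> V - Q" "x \<noteq> y" "q \<in> Q" "E x q" "q' \<in> Q" "E q' y"
    using conn[of Q] by blast
  have "sym r" by (auto simp: r_def sym_def intro: E_sym)
  then have "(q, w) \<in> r\<^sup>*" using xy(4) sym_rtrancl[of r] by (auto simp: Q_def sym_def)
  then have "(q, q') \<in> r\<^sup>*" using xy(6) by (auto simp: Q_def)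
  then obtain ms where ms: "distinct ms" "ms \<noteq> []" "successively E ms" "hd ms = q" "last ms = q'"
      "set ms \<subseteq> vin cs"
    using path_of_rtrancl[of q q' E "vin cs"] xy(6) Qv unfolding r_def by blast
  have xy': "x \<in> set cs" "y \<in> set cs" using nb xy E_sym by blast+
  have "set cs \<inter> vin cs = {}"
    by (rule cyc_vin_disjoint[OF cs])
  then have "vpath (x # ms @ [y])"
    using ms xy xy' by (auto simp: vpath_def successively_append_iff successively_Cons)
  then show ?thesis using xy' ms unfolding chord_def by blast
qed

text \<open>Theta curve: the chord forms a cycle with either arc, and the two new insides partition
  the old one without the chord. Both new cycles run along the chord, so its inner vertices and its
  two ends are counted twice in the lengths, while its inner vertices and its edges disappear from
  the insides.\<close>

lemma chord_split:
  assumes cs: "cyc cs" and ch: "chord cs x ms y"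
  obtains cs1 cs2 where "cyc cs1" "cyc cs2"
    "length cs1 + length cs2 = length cs + 2 * length ms + 2"
    "card (vin cs) = card (vin cs1) + card (vin cs2) + length ms"
    "card (ein cs) = card (ein cs1) + card (ein cs2) + length ms + 1"
proof -
  let ?zs = "x # ms @ [y]"
  have zs: "vpath ?zs" and msv: "set ms \<subseteq> vin cs" and xy: "x \<in> set cs" "y \<in> set cs"
    using ch by (auto simp: chord_def)
  then have "x \<noteq> y" by (auto simp: vpath_def)
  then obtain us vs where r: "cyc (x # us @ y # vs)" "cedges (x # us @ y # vs) = cedges cs"
      "set (x # us @ y # vs) = set cs" "length (x # us @ y # vs) = length cs"
    using cyc_split[OF cs xy] by metis
  note q = cyc_vpaths[OF r(1)]
  define C where "C = limg (cedges cs)"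
  have disj_v: "set cs \<inter> vin cs = {}"
    by (rule cyc_vin_disjoint[OF cs])
  have zs_ce: "ledges ?zs \<inter> cedges cs = {}"
  proof (cases "ms = []")
    case True
    then show ?thesis using ch ein_props(1)[OF cs] by (auto simp: chord_def)
  next
    case False
    have "e \<notin> cedges cs" if "e \<in> ledges ?zs" for e
    proof
      assume "e \<in> cedges cs"
      then have "e \<subseteq> set cs" using cyc_edges(2)[OF cs] by auto
      then have "e \<subseteq> {x, y}" using ledges_subset[OF that] msv disj_v by auto
      moreover have "e \<in> edges E" using that vpath_edges[OF zs] by auto
      ultimately have "e = {x, y}" by (auto elim!: edgesE)
      then show False using ends_in_ledges[of x ms y] that zs False by (auto simp: vpath_def)
    qed
    then show ?thesis by auto
  qed
  let ?P = "ledges (x # us @ [y])" and ?Q = "ledges (y # vs @ [x])" and ?Z = "ledges ?zs"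
  have Qrev: "ledges (x # rev vs @ [y]) = ?Q" using ledges_rev[of "y # vs @ [x]"] by simp
  have Zrev: "ledges (y # rev ms @ [x]) = ?Z" using ledges_rev[of ?zs] by simp
  have vQ: "vpath (x # rev vs @ [y])" using vpath_rev[OF q(2)] by simp
  have vZ: "vpath (y # rev ms @ [x])" using vpath_rev[OF zs] by simp
  have ms_dj: "set us \<inter> set ms = {}" "set vs \<inter> set ms = {}" "x \<notin> set ms" "y \<notin> set ms"
    using r(3) disj_v msv by auto
  have dj: "set us \<inter> set vs = {}" using r(1) by (auto simp: cyc_def)
  have ce: "cedges cs = ?P \<union> ?Q" using q(3) r(2) by simp
  define c1s where "c1s = x # us @ y # rev ms"
  define c2s where "c2s = y # vs @ x # ms"
  have ce1: "cedges c1s = ?P \<union> ?Z"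
    using ledges_append[of "x # us" y "rev ms @ [x]"] Zrev by (simp add: cedges_def c1s_def)
  have ce2: "cedges c2s = ?Q \<union> ?Z"
    using ledges_append[of "y # vs" x "ms @ [y]"] by (simp add: cedges_def c2s_def)
  \<comment> \<open>An arc and the chord cannot both be the single edge between \<open>x\<close> and
    \<open>y\<close>, because they are edge disjoint; hence both new cycles have at least three
    vertices.\<close>
  have "us = [] \<Longrightarrow> ms = [] \<Longrightarrow> False" using zs_ce ce by auto
  then have l1: "length c1s \<ge> 3" by (cases us; cases ms) (auto simp: c1s_def)
  have "vs = [] \<Longrightarrow> ms = [] \<Longrightarrow> False" using zs_ce ce by (auto simp: insert_commute)
  then have l2: "length c2s \<ge> 3" by (cases vs; cases ms) (auto simp: c2s_def)
  have c1: "cyc c1s"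
    using l1 r(1) q(1) vZ ms_dj unfolding cyc_def c1s_def vpath_def
    by (auto simp: successively_append_iff successively_Cons hd_append split: if_splits)
  have c2: "cyc c2s"
    using l2 r(1) q(2) zs ms_dj unfolding cyc_def c2s_def vpath_def
    by (auto simp: successively_append_iff successively_Cons hd_append split: if_splits)
  obtain a1 where a1: "arc a1" "pathstart a1 = p x" "pathfinish a1 = p y" "path_image a1 = limg ?P"
    using vpath_arc[OF q(1)] by auto
  obtain a2 where a2: "arc a2" "pathstart a2 = p x" "pathfinish a2 = p y" "path_image a2 = limg ?Q"
    using vpath_arc[OF vQ] Qrev by auto
  obtain a3 where a3: "arc a3" "pathstart a3 = p x" "pathfinish a3 = p y" "path_image a3 = limg ?Z"
    using vpath_arc[OF zs] by auto
  have i12: "limg ?P \<inter> limg ?Q = {p x, p y}"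
    using limg_paths_Int[OF q(1) vQ] q(4) Qrev dj by auto
  have i13: "limg ?P \<inter> limg ?Z = {p x, p y}"
    using limg_paths_Int[OF q(1) zs] zs_ce ce ms_dj by auto
  have i23: "limg ?Q \<inter> limg ?Z = {p x, p y}"
    using limg_paths_Int[OF vQ zs] zs_ce ce ms_dj Qrev by auto
  have pxy: "p x \<noteq> p y" using arc_distinct_ends[OF a1(1)] a1 by auto
  \<comment> \<open>The theta-curve theorem splits the inside only if the third arc enters it. For a
    chord without inner vertices this is the last clause of \<open>chord\<close>.\<close>
  have meets: "limg ?Z \<inter> inside C \<noteq> {}"
  proof (cases ms)
    case Nil
    then have "{x, y} \<in> ein cs" using ch by (auto simp: chord_def)
    then show ?thesis using Nil by (auto simp: ein_def C_def open_img_def limg_def)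
  next
    case (Cons m ms')
    have "m \<in> V" "p m \<in> inside C" using msv Cons by (auto simp: vin_def C_def)
    moreover have "p m \<in> limg ?Z"
      using limg_vertex[OF vpath_edges[OF zs] \<open>m \<in> V\<close>] Union_ledges[of ?zs] Cons by auto
    ultimately show ?thesis by auto
  qed
  let ?I1 = "inside (limg (cedges c1s))" and ?I2 = "inside (limg (cedges c2s))"
  have L: "limg (cedges c1s) = limg ?P \<union> limg ?Z" "limg (cedges c2s) = limg ?Q \<union> limg ?Z"
    "C = limg ?P \<union> limg ?Q"
    by (simp_all only: ce1 ce2 ce C_def limg_Un)
  have spl: "?I1 \<inter> ?I2 = {}" "?I1 \<union> ?I2 \<union> (limg ?Z - {p x, p y}) = inside C"
    using split_inside_simple_closed_curve[OF arc_imp_simple_path[OF a1(1)] a1(2,3)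
        arc_imp_simple_path[OF a2(1)] a2(2,3) arc_imp_simple_path[OF a3(1)] a3(2,3) pxy]
      i12 i13 i23 meets
    unfolding a1(4) a2(4) a3(4) L by blast+
  have dZ: "limg ?Z \<inter> ?I1 = {}" "limg ?Z \<inter> ?I2 = {}"
    using inside_no_overlap[of "limg (cedges c1s)"] inside_no_overlap[of "limg (cedges c2s)"]
    unfolding L by blast+
  have xyV: "x \<in> V" "y \<in> V" using cyc_edges(4)[OF cs] xy by auto
  have vZms: "p v \<in> limg ?Z - {p x, p y} \<longleftrightarrow> v \<in> set ms" if "v \<in> V" for v
    using limg_vertex[OF vpath_edges[OF zs] that] Union_ledges[of ?zs] ms_dj
      inj_onD[OF inj _ that xyV(1)] inj_onD[OF inj _ that xyV(2)] by auto
  have "set ms \<subseteq> V" using vpath_V[OF zs] by auto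
  then have vin_eq: "vin cs = vin c1s \<union> vin c2s \<union> set ms"
    using spl(2) vZms by (auto simp: vin_def C_def)
  have "vin c1s \<inter> vin c2s = {}" "(vin c1s \<union> vin c2s) \<inter> set ms = {}"
    using spl(1) dZ vZms by (auto simp: vin_def)
  then have cv: "card (vin cs) = card (vin c1s) + card (vin c2s) + length ms"
    using vin_eq finite_vin zs by (simp add: card_Un_disjoint vpath_def distinct_card)
  have Zin: "?Z \<subseteq> ein cs"
  proof
    fix e assume e: "e \<in> ?Z"
    then have eE: "e \<in> edges E" using vpath_edges[OF zs] by auto
    have "open_img e \<subseteq> limg ?Z - {p x, p y}"
      using open_img_subset_limg[OF e] open_img_no_vertex[OF eE xyV(1)] open_img_no_vertex[OF eE xyV(2)]
      by auto
    then have "open_img e \<subseteq> inside C" using spl by auto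
    then show "e \<in> ein cs" using eE open_img_props(2)[OF eE] by (auto simp: ein_def C_def)
  qed
  have ein_eq: "ein cs = ein c1s \<union> ein c2s \<union> ?Z"
  proof
    show "ein cs \<subseteq> ein c1s \<union> ein c2s \<union> ?Z"
    proof
      fix e assume e: "e \<in> ein cs"
      show "e \<in> ein c1s \<union> ein c2s \<union> ?Z"
      proof (cases "e \<in> ?Z")
        case False
        have "open_img e \<inter> limg ?Z = {}"
          using e False by (intro open_img_limg_disjoint[OF vpath_edges[OF zs]]) (auto simp: ein_def)
        then show ?thesis using e spl(2) by (auto simp: ein_def C_def)
      qed auto
    qed
    show "ein c1s \<union> ein c2s \<union> ?Z \<subseteq> ein cs" using Zin spl(2) by (auto simp: ein_def C_def)
  qed
  have "ein c1s \<inter> ein c2s = {}"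
  proof -
    have False if "e \<in> ein c1s" "e \<in> ein c2s" for e
    proof -
      have "open_img e \<subseteq> ?I1 \<inter> ?I2"
        using ein_props(2)[OF c1 that(1)] ein_props(2)[OF c2 that(2)] by auto
      then show False using spl(1) that open_img_props(2)[of e] by (auto simp: ein_def)
    qed
    then show ?thesis by auto
  qed
  moreover have "(ein c1s \<union> ein c2s) \<inter> ?Z = {}"
    using ein_props(1)[OF c1] ein_props(1)[OF c2] ce1 ce2 by auto
  moreover have "card ?Z = length ms + 1" using card_ledges[of ?zs] zs by (simp add: vpath_def)
  ultimately have ce: "card (ein cs) = card (ein c1s) + card (ein c2s) + length ms + 1"
    using ein_eq finite_ein by (simp add: card_Un_disjoint)
  show ?thesis
    by (rule that[OF c1 c2 _ cv ce]) (use r(4) in \<open>simp add: c1s_def c2s_def\<close>)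
qed

text \<open>This is what Euler's formula would give for a disc all of whose faces have length at
  least 4. The difference of the two sides is additive under \<open>chord_split\<close>. Without a
  chord the inside is empty and the claim is \<open>4 \<le> length cs\<close>, that is,
  triangle-freeness.\<close>

lemma inside_bound:
  assumes conn: "\<And>Q. Q \<subseteq> V \<Longrightarrow> Q \<noteq> {} \<Longrightarrow> card (V - Q) \<ge> 2 \<Longrightarrow>
      \<exists>x\<in>V - Q. \<exists>y\<in>V - Q. x \<noteq> y \<and> (\<exists>q\<in>Q. E x q) \<and> (\<exists>q\<in>Q. E q y)"
    and tf: "triangle_free V E"
  shows "cyc cs \<Longrightarrow> 2 * card (ein cs) + 4 \<le> 4 * card (vin cs) + length cs"
proof (induction "card (ein cs)" arbitrary: cs rule: less_induct)
  case less
  show ?case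
  proof (cases "\<exists>x ms y. chord cs x ms y")
    case True
    then obtain x ms y where "chord cs x ms y" by auto
    from chord_split[OF less(2) this] obtain cs1 cs2 where c: "cyc cs1" "cyc cs2"
      "length cs1 + length cs2 = length cs + 2 * length ms + 2"
      "card (vin cs) = card (vin cs1) + card (vin cs2) + length ms"
      "card (ein cs) = card (ein cs1) + card (ein cs2) + length ms + 1" by metis
    then show ?thesis using less(1)[of cs1] less(1)[of cs2] by simp
  next
    case False
    then have "\<not> (vin cs \<noteq> {} \<or> ein cs \<noteq> {})" using chord_exists[OF conn less(2)] by blast
    then have "vin cs = {}" "ein cs = {}" by auto
    moreover have "length cs \<noteq> 3"
    proof
      assume "length cs = 3"
      then obtain a b c where "cs = [a, b, c]"
        by (auto simp: numeral_eq_Suc length_Suc_conv)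
      then have "E a b" "E b c" "E c a" using less(2) by (auto simp: cyc_def)
      then show False using tf E_V unfolding triangle_free_def by blast
    qed
    ultimately show ?thesis using less(2) by (auto simp: cyc_def)
  qed
qed

text \<open>Two neighbours \<open>y\<close> and \<open>z\<close> of a vertex \<open>x\<close> lie in
  one component of the graph without \<open>x\<close>: otherwise the component of \<open>y\<close>
  would be attached at \<open>x\<close> alone, against \<open>conn\<close>. A path from
  \<open>y\<close> to \<open>z\<close> in that component closes up through \<open>x\<close>.\<close>

lemma cycle_exists:
  assumes conn: "\<And>Q. Q \<subseteq> V \<Longrightarrow> Q \<noteq> {} \<Longrightarrow> card (V - Q) \<ge> 2 \<Longrightarrow>
      \<exists>x\<in>V - Q. \<exists>y\<in>V - Q. x \<noteq> y \<and> (\<exists>q\<in>Q. E x q) \<and> (\<exists>q\<in>Q. E q y)"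
    and n: "card V \<ge> 3"
  shows "\<exists>cs. cyc cs"
proof -
  obtain x where x: "x \<in> V" using n by fastforce
  have "card (V - {x}) \<ge> 2" using n x finite_V by simp
  then obtain y z where yz: "y \<in> V - {x}" "z \<in> V - {x}" "y \<noteq> z" "E y x" "E x z"
    using conn[of "{x}"] x by blast
  define r where "r = {(a, b). E a b \<and> a \<in> V - {x} \<and> b \<in> V - {x}}"
  define Q where "Q = {a. (y, a) \<in> r\<^sup>*}"
  have QV: "Q \<subseteq> V - {x}"
  proof
    fix a assume "a \<in> Q"
    then have "(y, a) \<in> r\<^sup>*" by (simp add: Q_def)
    then show "a \<in> V - {x}" by (induction rule: rtrancl_induct) (use yz in \<open>auto simp: r_def\<close>)
  qed
  have nb: "b = x" if "E a b" "a \<in> Q" "b \<notin> Q" for a b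
  proof (rule ccontr)
    assume "b \<noteq> x"
    then have "(a, b) \<in> r" using that QV E_V by (auto simp: r_def)
    then show False using that by (auto simp: Q_def intro: rtrancl_into_rtrancl)
  qed
  have "z \<in> Q"
  proof (rule ccontr)
    assume "z \<notin> Q"
    then have "{x, z} \<subseteq> V - Q" using QV x yz by auto
    then have "card (V - Q) \<ge> card {x, z}" using finite_V by (intro card_mono) auto
    then have "card (V - Q) \<ge> 2" using yz by auto
    moreover have "Q \<noteq> {}" "Q \<subseteq> V" using QV by (auto simp: Q_def)
    ultimately obtain u v q q' where "u \<in> V - Q" "v \<in> V - Q" "u \<noteq> v" "q \<in> Q" "E u q" "q' \<in> Q" "E q' v"
      using conn[of Q] by blast
    then have "u = x" "v = x" using nb E_sym by blast+
    then show False using \<open>u \<noteq> v\<close> by simp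
  qed
  then obtain xs where xs: "distinct xs" "xs \<noteq> []" "successively E xs" "hd xs = y" "last xs = z"
      "set xs \<subseteq> V - {x}"
    using path_of_rtrancl[of y z E "V - {x}"] yz unfolding r_def Q_def by blast
  then have "length xs \<ge> 2" using yz(3) by (cases xs; cases "tl xs") auto
  then have "cyc (x # xs)" using xs yz E_sym
    by (auto simp: cyc_def successively_append_iff successively_Cons hd_append)
  then show ?thesis by blast
qed

end

section \<open>Exchanging the two sides of a cycle\<close>

lemma interior_arc_image_empty:
  fixes \<gamma> :: "real \<Rightarrow> complex"
  assumes "arc \<gamma>"
  shows "interior (path_image \<gamma>) = {}"
proof (rule ccontr)
  assume "interior (path_image \<gamma>) \<noteq> {}"
  then obtain z where "z \<in> interior (path_image \<gamma>)" by auto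
  then obtain e where e: "e > 0" "ball z e \<subseteq> path_image \<gamma>"
    by (meson mem_interior)
  have inj: "inj_on \<gamma> {0..1}" and cont: "continuous_on {0..1} \<gamma>"
    using assms by (auto simp: arc_def path_def)
  define k where "k = the_inv_into {0..1} \<gamma>"
  have k: "k (\<gamma> t) = t" if "t \<in> {0..1}" for t using that inj by (simp add: k_def the_inv_into_f_f)
  have \<gamma>k: "\<gamma> (k w) = w" if "w \<in> ball z e" for w
    using that e(2) f_the_inv_into_f[OF inj] by (auto simp: k_def path_image_def)
  have ck: "continuous_on (path_image \<gamma>) k"
    unfolding k_def path_image_def using continuous_on_inv_into[OF cont _ inj] by simp
  have kinj: "inj_on k (ball z e)" using \<gamma>k by (metis inj_onI)
  define J where "J = k ` ball z e"
  have "connected J" unfolding J_def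
    using ck e(2) by (intro connected_continuous_image) (auto intro: continuous_on_subset)
  have "infinite (ball z e)" using uncountable_ball[OF e(1)] countable_finite by blast
  then have "infinite J" unfolding J_def using finite_image_iff[OF kinj] by simp
  then obtain F where F: "F \<subseteq> J" "card F = 3" "finite F" by (meson infinite_arbitrarily_large)
  have Fne: "F \<noteq> {}" using F by auto
  let ?a = "Min F" and ?b = "Max F"
  have "\<exists>t\<in>F. ?a < t \<and> t < ?b"
  proof (rule ccontr)
    assume "\<not> ?thesis"
    then have "F \<subseteq> {?a, ?b}" using F Fne by (auto simp: order_less_le)
    then have "card F \<le> card {?a, ?b}" by (intro card_mono) auto
    then show False using F card_insert_le_m1[of 2 "{?b}" ?a] by (auto simp: card_insert_if split: if_splits)
  qed
  then obtain t where t: "t \<in> J" "?a < t" "t < ?b" using F by auto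
  have ab: "?a \<in> J" "?b \<in> J" using F Fne Min_in Max_in by blast+
  obtain w where w: "w \<in> ball z e" "k w = t" using t(1) by (auto simp: J_def)
  \<comment> \<open>The inverse \<open>k\<close> maps the disc injectively and continuously onto a
    connected set \<open>J\<close> of reals. Deleting one point leaves the disc connected, but
    deleting \<open>t\<close>, which lies strictly between two elements of \<open>J\<close>,
    disconnects \<open>J\<close>.\<close>
  have "connected (ball z e - {w})"
    by (rule connected_open_delete) auto
  then have "connected (k ` (ball z e - {w}))"
    using ck e(2) by (intro connected_continuous_image) (auto intro: continuous_on_subset)
  moreover have "k ` (ball z e - {w}) = J - {t}"
    using kinj w by (auto simp: J_def inj_on_def)
  ultimately have "connected (J - {t})" by simp
  then have "{?a..?b} \<subseteq> J - {t}"
    using ab t by (intro connected_contains_Icc) auto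
  moreover have "t \<in> {?a..?b}" using t by auto
  ultimately show False by blast
qed

text \<open>Near the pole \<open>a\<close> the map is unbounded, so the image of the punctured
  inside is a connected unbounded set off the new curve and cannot meet the new inside. The new
  inside is nonempty, so it contains the image of some old outside point, and connectedness brings
  in the whole outside.\<close>

lemma inversion_swaps_inside:
  fixes c :: "real \<Rightarrow> complex"
  assumes c: "simple_path c" "pathfinish c = pathstart c" and a: "a \<in> inside (path_image c)"
    and h: "h = (\<lambda>z. 1 / (z - a))"
  shows "h ` (inside (path_image c) - {a}) \<inter> inside (h ` path_image c) = {}"
    and "h ` outside (path_image c) \<subseteq> inside (h ` path_image c)"
proof -
  let ?C = "path_image c"
  note J = Jordan_inside_outside[OF c]
  have hz: "h z = h w \<longleftrightarrow> z = w" if "z \<noteq> a" "w \<noteq> a" for z w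
    using that by (auto simp: h field_simps)
  have cont: "continuous_on S h" if "a \<notin> S" for S
    unfolding h using that by (intro continuous_intros) auto
  have aC: "a \<notin> ?C" "a \<notin> outside ?C" using a inside_no_overlap[of ?C] inside_Int_outside[of ?C] by blast+
  have injh: "inj_on h (- {a})" using hz by (auto simp: inj_on_def)
  have "simple_path (h \<circ> c)"
    using c(1) aC(1) injh by (intro simple_path_continuous_image cont) (auto intro: inj_on_subset)
  moreover have "pathfinish (h \<circ> c) = pathstart (h \<circ> c)"
    using c(2) by (simp add: pathfinish_def pathstart_def)
  ultimately have J': "inside (h ` ?C) \<noteq> {}" "open (inside (h ` ?C))"
    using Jordan_inside_outside[of "h \<circ> c"] by (auto simp: path_image_compose)
  have con1: "connected (h ` (inside ?C - {a}))"
    using J by (intro connected_continuous_image cont connected_open_delete) auto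
  have dj1: "h ` (inside ?C - {a}) \<inter> h ` ?C = {}"
    using aC inside_no_overlap[of ?C] hz by (fastforce)
  have unb: "\<not> bounded (h ` (inside ?C - {a}))"
  proof
    assume "bounded (h ` (inside ?C - {a}))"
    then obtain B where B: "B > 0" "\<And>z. z \<in> inside ?C - {a} \<Longrightarrow> norm (h z) \<le> B"
      by (auto simp: bounded_pos)
    obtain e where e: "e > 0" "ball a e \<subseteq> inside ?C" 
      using J a openE[of "inside ?C" a] by metis
    define d where "d = min (e / 2) (1 / (2 * B))"
    have "d > 0" "d \<le> e / 2" "d \<le> 1 / (2 * B)" using e(1) B(1) by (auto simp: d_def)
    moreover have "1 / (2 * B) < 1 / B" using B(1) by (simp add: field_simps)
    ultimately have d: "d > 0" "d < e" "d < 1 / B" using e(1) by linarith+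
    have "a + of_real d \<in> inside ?C - {a}" using e(2) d by (auto simp: dist_norm)
    from B(2)[OF this] have "1 / d \<le> B" using d by (simp add: h norm_divide)
    moreover have "B < 1 / d" using d(1,3) B(1) by (simp add: less_divide_eq mult.commute)
    ultimately show False by simp
  qed
  show 1: "h ` (inside ?C - {a}) \<inter> inside (h ` ?C) = {}"
  proof (rule ccontr)
    assume "\<not> ?thesis"
    then obtain x where x: "x \<in> h ` (inside ?C - {a})" "x \<in> inside (h ` ?C)" by auto
    have "h ` (inside ?C - {a}) \<subseteq> connected_component_set (- (h ` ?C)) x"
      using x con1 dj1 by (intro connected_component_maximal) auto
    then show False using x(2) unb bounded_subset by (auto simp: inside_def)
  qed
  have con2: "connected (h ` outside ?C)"
    using J aC by (intro connected_continuous_image cont) auto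
  have dj2: "h ` outside ?C \<inter> h ` ?C = {}"
    using aC outside_no_overlap[of ?C] hz by fastforce
  \<comment> \<open>The value 0 stands for infinity: no \<open>z \<noteq> a\<close> is mapped to it.
    Since the inside is open it contains a further point \<open>w\<close>, and this one has the
    preimage \<open>a + 1 / w\<close>.\<close>
  have "\<exists>w\<in>inside (h ` ?C). w \<noteq> 0"
  proof (rule ccontr)
    assume "\<not> ?thesis"
    then have "inside (h ` ?C) \<subseteq> {0}" by auto
    then have "inside (h ` ?C) = {0}" using J' by auto
    then show False using J'(2) not_open_singleton[of "0::complex"] by simp
  qed
  then obtain w where w: "w \<in> inside (h ` ?C)" "w \<noteq> 0" by auto
  define z where "z = a + 1 / w"
  have z: "h z = w" "z \<noteq> a" using w by (auto simp: z_def h)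
  have "z \<notin> ?C" using w(1) z(1) inside_no_overlap[of "h ` ?C"] by blast
  moreover have "z \<notin> inside ?C" using 1 z w by auto
  ultimately have "z \<in> outside ?C" using inside_Un_outside[of ?C] by blast
  then have "h ` outside ?C \<inter> inside (h ` ?C) \<noteq> {}" using z w by auto
  then show "h ` outside ?C \<subseteq> inside (h ` ?C)"
    by (rule connected_inside[OF con2 dj2])
qed

lemma planarE:
  assumes "planar V E"
  obtains p :: "nat \<Rightarrow> complex" and g :: "nat \<Rightarrow> nat \<Rightarrow> real \<Rightarrow> complex" where "inj_on p V"
    "\<And>u v. E u v \<Longrightarrow> arc (g u v) \<and> pathstart (g u v) = p u \<and> pathfinish (g u v) = p v"
    "\<And>u v. E u v \<Longrightarrow> path_image (g u v) \<inter> p ` V \<subseteq> {p u, p v}"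
    "\<And>u v x y. E u v \<Longrightarrow> E x y \<Longrightarrow> {u, v} \<noteq> {x, y} \<Longrightarrow>
        path_image (g u v) \<inter> path_image (g x y) \<subseteq> {p u, p v} \<inter> {p x, p y}"
  using assms unfolding planar_def
  apply (elim exE conjE)
  subgoal for p g by (rule that[of p g]; metis)
  done

lemma planar_plane_graph:
  assumes "simple_graph V E" "planar V E"
  shows "\<exists>p g. plane_graph V E p g"
proof -
  have sg: "\<And>u v. E u v \<Longrightarrow> u \<in> V \<and> v \<in> V" "\<And>u v. E u v \<Longrightarrow> E v u"  "\<And>v. \<not> E v v"
    using assms(1) by (auto simp: simple_graph_def)
  obtain p :: "nat \<Rightarrow> complex" and g :: "nat \<Rightarrow> nat \<Rightarrow> real \<Rightarrow> complex"
    where inj: "inj_on p V"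
    and arcs: "\<And>u v. E u v \<Longrightarrow> arc (g u v) \<and> pathstart (g u v) = p u \<and> pathfinish (g u v) = p v"
    and vert: "\<And>u v. E u v \<Longrightarrow> path_image (g u v) \<inter> p ` V \<subseteq> {p u, p v}"
    and cross: "\<And>u v x y. E u v \<Longrightarrow> E x y \<Longrightarrow> {u, v} \<noteq> {x, y} \<Longrightarrow>
        path_image (g u v) \<inter> path_image (g x y) \<subseteq> {p u, p v} \<inter> {p x, p y}"
    apply (rule planarE[OF assms(2)])
    subgoal for p g by (rule that[of p g])
    done
  \<comment> \<open>\<open>planar\<close> provides the curves of \<open>(u, v)\<close> and
    \<open>(v, u)\<close> independently, whereas \<open>image_sym\<close> asks for one image per
    edge. The curve from the smaller number to the larger one is kept and reversed for the other
    direction.\<close>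
  define g' where "g' = (\<lambda>u v. if u < v then g u v else reversepath (g v u))"
  have im: "path_image (g' u v) = (if u < v then path_image (g u v) else path_image (g v u))" for u v
    by (simp add: g'_def)
  have "plane_graph V E p g'"
  proof
    show "simple_graph V E" "inj_on p V" by fact+
    fix u v assume E: "E u v"
    then have E': "E v u" "u \<noteq> v" using sg by auto
    show "arc (g' u v) \<and> pathstart (g' u v) = p u \<and> pathfinish (g' u v) = p v"
      using arcs[OF E] arcs[OF E'(1)] by (auto simp: g'_def arc_reversepath)
    show "path_image (g' v u) = path_image (g' u v)" using E' by (auto simp: im)
    show "w \<in> {u, v}" if "w \<in> V" "p w \<in> path_image (g' u v)" for w
    proof -
      have "p w \<in> {p u, p v}" using that vert[OF E] vert[OF E'(1)] by (auto simp: im split: if_splits)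
      then show ?thesis using inj sg(1)[OF E] that by (auto dest: inj_onD)
    qed
    fix x y assume F: "E x y" and ne: "{u, v} \<noteq> {x, y}"
    then have F': "E y x" using sg by auto
    have "path_image (g' u v) \<inter> path_image (g' x y) \<subseteq> {p u, p v} \<inter> {p x, p y}"
      using cross[OF E F] cross[OF E F'] cross[OF E'(1) F] cross[OF E'(1) F'] ne
      by (auto simp: im insert_commute)
    also have "\<dots> = p ` ({u, v} \<inter> {x, y})"
      using inj sg(1)[OF E] sg(1)[OF F] by (auto dest: inj_onD)
    finally show "path_image (g' u v) \<inter> path_image (g' x y) \<subseteq> p ` ({u, v} \<inter> {x, y})" .
  qed
  then show ?thesis by blast
qed

lemma planar_subgraph:
  assumes "planar V E" "V' \<subseteq> V" "\<And>u v. E' u v \<Longrightarrow> E u v"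
  shows "planar V' E'"
proof -
  obtain p :: "nat \<Rightarrow> complex" and g :: "nat \<Rightarrow> nat \<Rightarrow> real \<Rightarrow> complex" where
    *: "inj_on p V" "\<And>u v. E u v \<Longrightarrow> arc (g u v) \<and> pathstart (g u v) = p u \<and> pathfinish (g u v) = p v"
    "\<And>u v. E u v \<Longrightarrow> path_image (g u v) \<inter> p ` V \<subseteq> {p u, p v}"
    "\<And>u v x y. E u v \<Longrightarrow> E x y \<Longrightarrow> {u, v} \<noteq> {x, y} \<Longrightarrow>
        path_image (g u v) \<inter> path_image (g x y) \<subseteq> {p u, p v} \<inter> {p x, p y}"
    apply (rule planarE[OF assms(1)])
    subgoal for p g by (rule that[of p g])
    done
  have "inj_on p V'" using *(1) assms(2) inj_on_subset by blast
  moreover have "path_image (g u v) \<inter> p ` V' \<subseteq> {p u, p v}" if "E' u v" for u v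
    using *(3)[of u v] assms(2,3) that by blast
  ultimately show ?thesis
    unfolding planar_def
    by (intro exI[of _ p] exI[of _ g] conjI allI impI *(4)) (simp_all add: assms(3) *(2))
qed

context plane_graph
begin

lemma inverted:
  assumes a: "\<forall>e\<in>edges E. a \<notin> img e" "a \<notin> p ` V" and h: "h = (\<lambda>z. 1 / (z - a))"
  shows "plane_graph V E (h \<circ> p) (\<lambda>u v. h \<circ> g u v)"
    and "e \<in> edges E \<Longrightarrow> plane_graph.img E (\<lambda>u v. h \<circ> g u v) e = h ` img e"
proof -
  have hz: "h z = h w \<longleftrightarrow> z = w" if "z \<noteq> a" "w \<noteq> a" for z w
    using that by (auto simp: h field_simps)
  have cont: "continuous_on S h" if "a \<notin> S" for S
    unfolding h using that by (intro continuous_intros) auto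
  have ag: "a \<notin> path_image (g u v)" if "E u v" for u v
    using bspec[OF a(1), of "{u, v}"] that by (auto simp: img_eq edges_def)
  have injh: "inj_on h (- {a})" using hz by (auto simp: inj_on_def)
  have "arc (h \<circ> g u v)" if "E u v" for u v
  proof -
    have "arc (g u v)" "a \<notin> path_image (g u v)" using arcs[OF that] ag[OF that] by auto
    then show ?thesis unfolding arc_def
      using injh cont[of "path_image (g u v)"]
      by (auto intro!: path_continuous_image comp_inj_on inj_on_subset[OF injh] simp: path_image_def)
  qed
  moreover have "inj_on (h \<circ> p) V"
    using inj a(2) by (intro comp_inj_on inj_on_subset[OF injh]) auto
  ultimately show P: "plane_graph V E (h \<circ> p) (\<lambda>u v. h \<circ> g u v)"
  proof unfold_locales
    fix u v assume "E u v"
    then show "arc (h \<circ> g u v) \<and> pathstart (h \<circ> g u v) = (h \<circ> p) u \<and> pathfinish (h \<circ> g u v) = (h \<circ> p) v"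
      using \<open>\<And>u v. E u v \<Longrightarrow> arc (h \<circ> g u v)\<close>[of u v] arcs[of u v]
      by (simp add: pathstart_def pathfinish_def)
  next
    fix u v w assume "E u v" "w \<in> V" "(h \<circ> p) w \<in> path_image (h \<circ> g u v)"
    then obtain z where z: "z \<in> path_image (g u v)" "h (p w) = h z" by (auto simp: path_image_compose)
    have "z \<noteq> a" "p w \<noteq> a" using z ag[OF \<open>E u v\<close>] a(2) \<open>w \<in> V\<close> by auto
    then have "p w \<in> path_image (g u v)" using z hz by auto
    then show "w \<in> {u, v}" using image_vertex \<open>E u v\<close> \<open>w \<in> V\<close> by blast
  next
    fix u v x y assume E: "E u v" "E x y" "{u, v} \<noteq> {x, y}"
    show "path_image (h \<circ> g u v) \<inter> path_image (h \<circ> g x y) \<subseteq> (h \<circ> p) ` ({u, v} \<inter> {x, y})"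
    proof
      fix z assume "z \<in> path_image (h \<circ> g u v) \<inter> path_image (h \<circ> g x y)"
      then obtain s t where st: "s \<in> path_image (g u v)" "t \<in> path_image (g x y)" "z = h s" "z = h t"
        by (auto simp: path_image_compose)
      have "s \<noteq> a" "t \<noteq> a" using st ag E by auto
      then have "s = t" using st hz by auto
      then have "s \<in> p ` ({u, v} \<inter> {x, y})" using image_cross[OF E] st by auto
      then show "z \<in> (h \<circ> p) ` ({u, v} \<inter> {x, y})" using st by auto
    qed
  qed (auto simp: simple image_sym path_image_compose)
  assume "e \<in> edges E"
  then obtain u v where "e = {u, v}" "E u v" by (auto elim: edgesE)
  then show "plane_graph.img E (\<lambda>u v. h \<circ> g u v) e = h ` img e"
    using plane_graph.img_eq[OF P, of u v] by (simp add: img_eq path_image_compose)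
qed

text \<open>\<open>inside_bound\<close> is applied to one cycle in the given drawing and again after
  an inversion about an inside point, which brings the outside in. If the cycle has length l and the
  two insides have v, v' vertices and e, e' edges, the sum is 2 * (l + e + e') + 8 \<le> 4 * (l + v
  + v').\<close>

lemma edge_bound_connected:
  assumes conn: "\<And>Q. Q \<subseteq> V \<Longrightarrow> Q \<noteq> {} \<Longrightarrow> card (V - Q) \<ge> 2 \<Longrightarrow>
      \<exists>x\<in>V - Q. \<exists>y\<in>V - Q. x \<noteq> y \<and> (\<exists>q\<in>Q. E x q) \<and> (\<exists>q\<in>Q. E q y)"
    and tf: "triangle_free V E" and n: "card V \<ge> 3"
  shows "card (edges E) + 4 \<le> 2 * card V"
proof -
  obtain cs where cs: "cyc cs" using cycle_exists[OF conn n] by blast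
  let ?C = "limg (cedges cs)"
  obtain c where c: "simple_path c" "pathfinish c = pathstart c" "path_image c = ?C"
    using cyc_loop[OF cs] .
  note J = Jordan_inside_outside[OF c(1,2), unfolded c(3)]
  have fE: "finite (edges E)" by (rule finite_edges[OF simple])
  \<comment> \<open>The centre of the inversion must avoid the drawing. Finitely many closed sets
    with empty interior cannot fill the inside, which is open and nonempty.\<close>
  have "\<exists>a\<in>inside ?C. a \<notin> \<Union> (img ` edges E) \<union> p ` V"
  proof (rule ccontr)
    assume "\<not> ?thesis"
    then have sub: "inside ?C \<subseteq> \<Union> (img ` edges E) \<union> p ` V" by auto
    have img: "closed (img e) \<and> interior (img e) = {}" if "e \<in> edges E" for e
      using that by (elim edgesE) (auto simp: img_eq arcs closed_arc_image interior_arc_image_empty)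
    have "finite F \<Longrightarrow> F \<subseteq> edges E \<Longrightarrow> closed (\<Union> (img ` F)) \<and> interior (\<Union> (img ` F)) = {}" for F
    proof (induction F rule: finite_induct)
      case (insert e F)
      then show ?case using img[of e] interior_closed_Un_empty_interior[of "img e" "\<Union> (img ` F)"] by auto
    qed auto
    from this[OF fE] have 1: "closed (\<Union> (img ` edges E))" "interior (\<Union> (img ` edges E)) = {}" by auto
    have "interior (\<Union> (img ` edges E) \<union> p ` V) = {}"
      using interior_closed_Un_empty_interior[OF 1(1), of "p ` V"] 1(2) finite_V
      by (simp add: empty_interior_finite)
    then show False using sub J interior_maximal[of "inside ?C"] by auto
  qed
  then obtain a where a: "a \<in> inside ?C" "\<forall>e\<in>edges E. a \<notin> img e" "a \<notin> p ` V" by auto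
  define h where "h = (\<lambda>z. 1 / (z - a))"
  note inv = inverted[OF a(2,3) h_def]
  interpret I: plane_graph V E "h \<circ> p" "\<lambda>u v. h \<circ> g u v" by (rule inv(1))
  have Ics: "I.cyc cs" using cs by (simp add: I.cyc_def cyc_def)
  have Ilimg: "I.limg (cedges cs) = h ` ?C"
  proof -
    have "I.img ` cedges cs = (\<lambda>e. h ` img e) ` cedges cs"
      using inv(2) cyc_edges(1)[OF cs] by (intro image_cong) auto
    then show ?thesis unfolding I.limg_def limg_def by (simp add: image_UN)
  qed
  note sw = inversion_swaps_inside[OF c(1,2) a(1)[folded c(3)] h_def, unfolded c(3)]
  have b1: "2 * card (ein cs) + 4 \<le> 4 * card (vin cs) + length cs"
    by (rule inside_bound[OF conn tf cs])
  have b2: "2 * card (I.ein cs) + 4 \<le> 4 * card (I.vin cs) + length cs"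
    by (rule I.inside_bound[OF conn tf Ics])
  have "vin cs \<inter> I.vin cs = {}"
  proof -
    have False if "v \<in> vin cs" "v \<in> I.vin cs" for v
    proof -
      have "v \<in> V" "p v \<in> inside ?C" "h (p v) \<in> inside (h ` ?C)"
        using that by (auto simp: vin_def I.vin_def Ilimg)
      moreover have "p v \<noteq> a" using a(3) \<open>v \<in> V\<close> by auto
      ultimately show False using sw(1) by blast
    qed
    then show ?thesis by blast
  qed
  moreover have "set cs \<inter> vin cs = {}"
    by (rule cyc_vin_disjoint[OF cs])
  moreover have "set cs \<inter> I.vin cs = {}"
    by (rule I.cyc_vin_disjoint[OF Ics])
  ultimately have "card (set cs \<union> vin cs \<union> I.vin cs) = card (set cs) + card (vin cs) + card (I.vin cs)"
    using finite_vin[of cs] I.finite_vin[of cs]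
    by (simp add: card_Un_disjoint Int_Un_distrib2)
  moreover have "card (set cs) = length cs" using cs distinct_card by (auto simp: cyc_def)
  moreover have "card (set cs \<union> vin cs \<union> I.vin cs) \<le> card V"
    using cyc_edges(4)[OF cs] finite_V by (intro card_mono) (auto simp: vin_def I.vin_def)
  ultimately have nv: "length cs + card (vin cs) + card (I.vin cs) \<le> card V" by simp
  have "edges E \<subseteq> cedges cs \<union> ein cs \<union> I.ein cs"
  proof
    fix e assume e: "e \<in> edges E"
    show "e \<in> cedges cs \<union> ein cs \<union> I.ein cs"
    proof (cases "e \<in> cedges cs \<union> ein cs")
      case False
      have "open_img e \<inter> ?C = {}"
        using False e by (intro open_img_limg_disjoint[OF cyc_edges(1)[OF cs]]) auto
      then have "open_img e \<subseteq> outside ?C"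
        using False e inside_Un_outside[of ?C] unfolding ein_def by blast
      then have "h ` open_img e \<subseteq> inside (h ` ?C)" using sw(2) by auto
      moreover have "h ` open_img e \<subseteq> I.open_img e"
      proof
        fix z assume "z \<in> h ` open_img e"
        then obtain y where y: "y \<in> img e" "y \<notin> p ` e" "z = h y" by (auto simp: open_img_def)
        have "h y \<noteq> h (p v)" if "v \<in> e" for v
        proof
          assume eq: "h y = h (p v)"
          have "v \<in> V" using that e edges_V by auto
          then have "y \<noteq> a" "p v \<noteq> a" using y a e by auto
          then have "y = p v" using eq by (auto simp: h_def field_simps)
          then show False using y that by auto
        qed
        then show "z \<in> I.open_img e" using y inv(2)[OF e] by (auto simp: I.open_img_def)
      qed
      ultimately have "I.open_img e \<inter> inside (h ` ?C) \<noteq> {}" using open_img_props(2)[OF e] by blast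
      then show ?thesis using e by (auto simp: I.ein_def Ilimg)
    qed auto
  qed
  then have "card (edges E) \<le> card (cedges cs \<union> ein cs \<union> I.ein cs)"
    using finite_ein I.finite_ein by (intro card_mono) (auto simp: cedges_def)
  also have "\<dots> \<le> card (cedges cs) + card (ein cs) + card (I.ein cs)"
    by (metis (no_types, lifting) add_le_mono1 card_Un_le le_trans)
  finally have "card (edges E) \<le> length cs + card (ein cs) + card (I.ein cs)"
    using cyc_edges(3)[OF cs] by simp
  then show ?thesis using b1 b2 nv by linarith
qed

end

text \<open>If some \<open>Q\<close> has at most one outer neighbour, the graph is glued from two
  smaller ones, on \<open>Q \<union> N\<close> and on \<open>V - Q\<close>, that share at most one
  vertex. The constant 2 survives gluing, since 2 * (n + 1) - 4 = 2 * n - 2, and is attained by a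
  single vertex; the constant 4 of the connected case fails there.\<close>

theorem triangle_free_planar_edge_bound:
  "simple_graph V E \<Longrightarrow> planar V E \<Longrightarrow> triangle_free V E \<Longrightarrow> V \<noteq> {} \<Longrightarrow> card (edges E) + 2 \<le> 2 * card V"
proof (induction "card V" arbitrary: V E rule: less_induct)
  case less
  note sg = less(2)[unfolded simple_graph_def]
  have fin: "finite V" using sg by auto
  have sub: "card (edges (\<lambda>u v. E u v \<and> u \<in> A \<and> v \<in> A)) + 2 \<le> 2 * card A"
    if "A \<subset> V" "A \<noteq> {}" for A
  proof (rule less(1))
    show "card A < card V" using that fin by (simp add: psubset_card_mono)
    show "simple_graph A (\<lambda>u v. E u v \<and> u \<in> A \<and> v \<in> A)"
      using sg that fin by (auto simp: simple_graph_def intro: finite_subset)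
    show "planar A (\<lambda>u v. E u v \<and> u \<in> A \<and> v \<in> A)"
      by (rule planar_subgraph[OF less(3)]) (use that in auto)
    show "triangle_free A (\<lambda>u v. E u v \<and> u \<in> A \<and> v \<in> A)"
      using less(4) that unfolding triangle_free_def by blast
  qed (use that in auto)
  show ?case
  proof (cases "\<forall>Q. Q \<subseteq> V \<longrightarrow> Q \<noteq> {} \<longrightarrow> card (V - Q) \<ge> 2 \<longrightarrow>
      (\<exists>x\<in>V - Q. \<exists>y\<in>V - Q. x \<noteq> y \<and> (\<exists>q\<in>Q. E x q) \<and> (\<exists>q\<in>Q. E q y))")
    case conn: True
    obtain p g where "plane_graph V E p g" using planar_plane_graph[OF less(2,3)] by blast
    then interpret plane_graph V E p g .
    show ?thesis
    proof (cases "card V \<ge> 3")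
      case True
      have "card (edges E) + 4 \<le> 2 * card V"
        by (rule edge_bound_connected[OF _ less(4) True]) (use conn in blast)
      then show ?thesis by simp
    next
      case False
      have "edges E \<subseteq> {A. A \<subseteq> V \<and> card A = 2}"
        by (auto simp: edges_def dest: E_V) (metis E_irrefl card_2_iff)
      then have "card (edges E) \<le> card {A. A \<subseteq> V \<and> card A = 2}" using fin by (intro card_mono) auto
      also have "\<dots> = card V choose 2" using n_subsets[OF fin] by simp
      finally have le: "card (edges E) \<le> card V choose 2" .
      have "card V = 1 \<or> card V = 2" using False less(5) fin
        by (metis card_0_eq le_SucE le_zero_eq less_Suc_eq_le not_le numeral_2_eq_2 numeral_3_eq_3 One_nat_def)
      then show ?thesis using le by (auto simp: numeral_2_eq_2)
    qed
  next
    case False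
    then obtain Q where Q: "Q \<subseteq> V" "Q \<noteq> {}" "card (V - Q) \<ge> 2"
      and nb: "\<And>x y. x \<in> V - Q \<Longrightarrow> y \<in> V - Q \<Longrightarrow> (\<exists>q\<in>Q. E x q) \<Longrightarrow> (\<exists>q\<in>Q. E q y) \<Longrightarrow> x = y"
      by blast
    define N where "N = {x \<in> V - Q. \<exists>q\<in>Q. E x q}"
    have "\<forall>x\<in>N. \<forall>y\<in>N. x = y" using nb sg unfolding N_def by blast
    then have N1: "card N \<le> 1" 
      using fin card_le_Suc0_iff_eq[of N] by (simp add: N_def)
    let ?A = "Q \<union> N" and ?B = "V - Q"
    have cA: "card ?A \<le> card Q + 1" using card_Un_le[of Q N] N1 by linarith
    have cV: "card V = card Q + card ?B" using Q fin
      by (metis card_Diff_subset card_mono finite_subset le_add_diff_inverse)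
    have "?A \<noteq> V" using cA cV Q(3) by auto
    then have A: "?A \<subset> V" "?A \<noteq> {}" using Q by (auto simp: N_def)
    have "?B \<noteq> {}" using Q(3) by (metis card.empty not_numeral_le_zero)
    then have B: "?B \<subset> V" "?B \<noteq> {}" using Q by auto
    have "edges E \<subseteq> edges (\<lambda>u v. E u v \<and> u \<in> ?A \<and> v \<in> ?A) \<union> edges (\<lambda>u v. E u v \<and> u \<in> ?B \<and> v \<in> ?B)"
    proof
      fix e assume "e \<in> edges E"
      then obtain u v where e: "e = {u, v}" "E u v" by (auto simp: edges_def)
      then have "u \<in> V" "v \<in> V" "E v u" using sg by auto
      then have "(u \<in> ?A \<and> v \<in> ?A) \<or> (u \<in> ?B \<and> v \<in> ?B)" using e unfolding N_def by blast
      then show "e \<in> edges (\<lambda>u v. E u v \<and> u \<in> ?A \<and> v \<in> ?A) \<union> edges (\<lambda>u v. E u v \<and> u \<in> ?B \<and> v \<in> ?B)"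
        using e unfolding edges_def by blast
    qed
    moreover have "finite (edges (\<lambda>u v. E u v \<and> u \<in> A \<and> v \<in> A))" for A
      by (rule finite_subset[OF _ finite_edges[OF less(2)]]) (auto simp: edges_def)
    ultimately have "card (edges E) \<le> card (edges (\<lambda>u v. E u v \<and> u \<in> ?A \<and> v \<in> ?A))
        + card (edges (\<lambda>u v. E u v \<and> u \<in> ?B \<and> v \<in> ?B))"
      by (meson card_Un_le card_mono finite_UnI le_trans)
    then show ?thesis using sub[OF A] sub[OF B] cA cV by linarith
  qed
qed

section \<open>Counting in triangle-free planar graphs\<close>

text \<open>Each new edge is drawn along a path of two old edges. Different new edges have different
  midpoints, all outside \<open>V'\<close>, so their curves meet at most in common ends. This gives
  edge bounds for graphs that are not subgraphs of the given one.\<close>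

lemma planar_subdivision:
  assumes G: "simple_graph V E" "planar V E"
    and V': "V' \<subseteq> V" "\<And>u v. E' u v \<Longrightarrow> u \<in> V' \<and> v \<in> V' \<and> u \<noteq> v"
    and w: "\<And>u v. E' u v \<Longrightarrow> w u v \<notin> V' \<and> E u (w u v) \<and> E (w u v) v"
    and w_inj: "\<And>u v x y. E' u v \<Longrightarrow> E' x y \<Longrightarrow> {u, v} \<noteq> {x, y} \<Longrightarrow> w u v \<noteq> w x y"
  shows "planar V' E'"
proof -
  obtain p g where "plane_graph V E p g" using planar_plane_graph[OF G] by blast
  then interpret plane_graph V E p g .
  define g' where "g' = (\<lambda>u v. g u (w u v) +++ g (w u v) v)"
  have im: "path_image (g' u v) = path_image (g u (w u v)) \<union> path_image (g (w u v) v)" if "E' u v" for u v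
    using arcs[of u "w u v"] arcs[of "w u v" v] w[OF that] by (simp add: g'_def path_image_join)
  have 1: "arc (g' u v) \<and> pathstart (g' u v) = p u \<and> pathfinish (g' u v) = p v" if E': "E' u v" for u v
  proof -
    note a = w[OF E'] V'(2)[OF E']
    have "{u, w u v} \<noteq> {w u v, v}" "{u, w u v} \<inter> {w u v, v} = {w u v}"
      using a by (auto simp: doubleton_eq_iff)
    then have "path_image (g u (w u v)) \<inter> path_image (g (w u v) v) \<subseteq> {p (w u v)}"
      using image_cross[of u "w u v" "w u v" v] a by auto
    then have "arc (g' u v)"
      unfolding g'_def using arcs[of u "w u v"] arcs[of "w u v" v] a by (intro arc_join) auto
    then show ?thesis using arcs[of u "w u v"] arcs[of "w u v" v] a by (simp add: g'_def)
  qed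
  have 2: "path_image (g' u v) \<inter> p ` V' \<subseteq> {p u, p v}" if E': "E' u v" for u v
    using image_vertex[of u "w u v"] image_vertex[of "w u v" v] w[OF E'] V' unfolding im[OF E'] by blast
  have 3: "path_image (g' u v) \<inter> path_image (g' x y) \<subseteq> {p u, p v} \<inter> {p x, p y}"
    if E': "E' u v" "E' x y" "{u, v} \<noteq> {x, y}" for u v x y
  proof -
    have ne: "w u v \<noteq> w x y" using w_inj E' by blast
    have *: "path_image (g s t) \<inter> path_image (g s' t') \<subseteq> {p u, p v} \<inter> {p x, p y}"
      if "E s t" "E s' t'" "{s, t} = {a, w u v}" "{s', t'} = {b, w x y}" "a \<in> {u, v}" "b \<in> {x, y}"
      for s t s' t' a b
    proof -
      have "a \<in> V'" "b \<in> V'" using that(5,6) V'(2)[OF E'(1)] V'(2)[OF E'(2)] by auto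
      then have ab: "a \<noteq> w x y" "b \<noteq> w u v" using w[OF E'(1)] w[OF E'(2)] by auto
      then have "{s, t} \<noteq> {s', t'}" using that ne by (auto simp: doubleton_eq_iff)
      then have "path_image (g s t) \<inter> path_image (g s' t') \<subseteq> p ` ({a, w u v} \<inter> {b, w x y})"
        using image_cross[of s t s' t'] that(1,2) unfolding that(3,4) by blast
      also have "\<dots> \<subseteq> {p u, p v} \<inter> {p x, p y}" using ab ne that(5,6) by auto
      finally show ?thesis .
    qed
    show ?thesis
      unfolding im[OF E'(1)] im[OF E'(2)]
      using *[of u "w u v" x "w x y" u x] *[of u "w u v" "w x y" y u y]
        *[of "w u v" v x "w x y" v x] *[of "w u v" v "w x y" y v y] w[OF E'(1)] w[OF E'(2)]
      by (auto simp: insert_commute)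
  qed
  have "inj_on p V'" using inj V'(1) inj_on_subset by blast
  then show ?thesis
    unfolding planar_def
    by (intro exI[of _ p] exI[of _ g'] conjI allI impI 3) (simp_all add: 1 2)
qed

text \<open>Replacing paths of length two by edges may create triangles; bipartiteness rules them
  out again.\<close>

lemma bipartite_planar_bound:
  assumes fin: "finite A" "finite B" and AB: "A \<inter> B = {}" and M: "M \<subseteq> A \<times> B"
    and pl: "planar (A \<union> B) (\<lambda>u v. (u, v) \<in> M \<or> (v, u) \<in> M)"
  shows "card M \<le> 2 * (card A + card B)"
proof (cases "A \<union> B = {}")
  case False
  let ?E = "\<lambda>u v. (u, v) \<in> M \<or> (v, u) \<in> M"
  have "simple_graph (A \<union> B) ?E" using fin AB M by (auto simp: simple_graph_def)
  moreover have "triangle_free (A \<union> B) ?E" using AB M unfolding triangle_free_def by blast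
  ultimately have "card (edges ?E) \<le> 2 * card (A \<union> B)"
    using triangle_free_planar_edge_bound[OF _ pl _ False] by simp
  moreover have "edges ?E = (\<lambda>(u, v). {u, v}) ` M"
  proof
    show "edges ?E \<subseteq> (\<lambda>(u, v). {u, v}) ` M"
      by (auto simp: edges_def image_iff)
    show "(\<lambda>(u, v). {u, v}) ` M \<subseteq> edges ?E"
    proof
      fix e assume "e \<in> (\<lambda>(u, v). {u, v}) ` M"
      then obtain u v where "e = {u, v}" "(u, v) \<in> M" by auto
      then show "e \<in> edges ?E" unfolding edges_def by (intro CollectI exI[of _ u] exI[of _ v]) simp
    qed
  qed
  moreover have "inj_on (\<lambda>(u, v). {u, v}) M"
    using AB M by (intro inj_onI) (auto simp: doubleton_eq_iff; blast)
  ultimately show ?thesis using fin AB by (simp add: card_image card_Un_disjoint)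
qed (use M in auto)

text \<open>Vertices are placed one at a time on the side holding fewer of their earlier neighbours,
  so at least half of the edges are cut. The left side counts ordered pairs, which doubles the
  factor to 4.\<close>

lemma max_cut:
  assumes "finite R" "\<And>u v. Q u v \<Longrightarrow> Q v u" "\<And>v. \<not> Q v v"
  shows "\<exists>A\<subseteq>R. card {(u, v). u \<in> R \<and> v \<in> R \<and> Q u v} \<le> 4 * card {(u, v). u \<in> A \<and> v \<in> R - A \<and> Q u v}"
  using assms(1)
proof (induction R rule: finite_induct)
  case empty
  then show ?case by auto
next
  case (insert x R)
  then obtain A where A: "A \<subseteq> R"
    "card {(u, v). u \<in> R \<and> v \<in> R \<and> Q u v} \<le> 4 * card {(u, v). u \<in> A \<and> v \<in> R - A \<and> Q u v}" by auto
  let ?a = "{v \<in> A. Q x v}" and ?b = "{v \<in> R - A. Q x v}"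
  have fA: "finite A" "finite (R - A)" using A insert finite_subset by auto
  have fRR: "finite {(u, v). u \<in> R \<and> v \<in> R \<and> Q u v}"
    by (rule finite_subset[of _ "R \<times> R"]) (use insert(1) in auto)
  have xR: "x \<notin> R" "x \<notin> A" using A insert by auto
  have "{(u, v). u \<in> insert x R \<and> v \<in> insert x R \<and> Q u v} \<subseteq>
      {(u, v). u \<in> R \<and> v \<in> R \<and> Q u v} \<union> ((\<lambda>v. (x, v)) ` (?a \<union> ?b) \<union> (\<lambda>v. (v, x)) ` (?a \<union> ?b))"
    (is "_ \<subseteq> ?T")
  proof
    fix z assume "z \<in> {(u, v). u \<in> insert x R \<and> v \<in> insert x R \<and> Q u v}"
    then obtain u v where *: "z = (u, v)" "u \<in> insert x R" "v \<in> insert x R" "Q u v" by blast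
    show "z \<in> ?T"
    proof (cases "u = x \<or> v = x")
      case True
      then show ?thesis using * assms(2)[of u v] assms(3)[of x] by blast
    qed (use * in blast)
  qed
  then have "card {(u, v). u \<in> insert x R \<and> v \<in> insert x R \<and> Q u v} \<le>
     card ({(u, v). u \<in> R \<and> v \<in> R \<and> Q u v} \<union> ((\<lambda>v. (x, v)) ` (?a \<union> ?b) \<union> (\<lambda>v. (v, x)) ` (?a \<union> ?b)))"
    using fA fRR by (intro card_mono) auto
  also have "\<dots> \<le> card {(u, v). u \<in> R \<and> v \<in> R \<and> Q u v} + (card (?a \<union> ?b) + card (?a \<union> ?b))"
    by (intro order_trans[OF card_Un_le] add_mono order.refl card_image_le) (use fA in auto)
  also have "\<dots> \<le> card {(u, v). u \<in> R \<and> v \<in> R \<and> Q u v} + 2 * (card ?a + card ?b)"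
    using card_Un_le[of ?a ?b] by simp
  finally have le: "card {(u, v). u \<in> insert x R \<and> v \<in> insert x R \<and> Q u v} \<le>
     4 * card {(u, v). u \<in> A \<and> v \<in> R - A \<and> Q u v} + 2 * (card ?a + card ?b)" using A(2) by simp
  let ?C = "{(u, v). u \<in> A \<and> v \<in> R - A \<and> Q u v}"
  have fC: "finite ?C" by (rule finite_subset[of _ "A \<times> (R - A)"]) (use fA in auto)
  show ?case
  proof (cases "card ?a \<le> card ?b")
    case True
    have "{(u, v). u \<in> insert x A \<and> v \<in> insert x R - insert x A \<and> Q u v} = ?C \<union> (\<lambda>v. (x, v)) ` ?b"
      using xR by auto
    moreover have "card (?C \<union> (\<lambda>v. (x, v)) ` ?b) = card ?C + card ?b"
      using xR fC fA by (subst card_Un_disjoint) (auto simp: card_image inj_on_def)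
    ultimately show ?thesis using le True A by (intro exI[of _ "insert x A"]) auto
  next
    case False
    have "{(u, v). u \<in> A \<and> v \<in> insert x R - A \<and> Q u v} = ?C \<union> (\<lambda>v. (v, x)) ` ?a"
      using xR assms(2) by blast
    moreover have "card (?C \<union> (\<lambda>v. (v, x)) ` ?a) = card ?C + card ?a"
      using xR fC fA by (subst card_Un_disjoint) (auto simp: card_image inj_on_def)
    ultimately show ?thesis using le False A by (intro exI[of _ A]) auto
  qed
qed

locale tf_planar =
  fixes V :: "nat set" and E :: "nat \<Rightarrow> nat \<Rightarrow> bool"
  assumes simple: "simple_graph V E" and planar: "planar V E" and triangle_free: "triangle_free V E"
begin

lemma finite_V: "finite V" and E_V: "E u v \<Longrightarrow> u \<in> V \<and> v \<in> V"
  and E_sym: "E u v \<Longrightarrow> E v u" and E_irrefl: "\<not> E v v"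
  using simple by (auto simp: simple_graph_def)

lemma finite_N: "finite {w. E v w}"
  using finite_subset[OF _ finite_V] E_V by blast

lemma pairs_bound:
  assumes "X \<subseteq> V"
  shows "card {(u, v). u \<in> X \<and> v \<in> X \<and> E u v} \<le> 4 * card X"
proof (cases "X = {}")
  case False
  let ?E = "\<lambda>u v. E u v \<and> u \<in> X \<and> v \<in> X"
  have fX: "finite X" using assms finite_V finite_subset by auto
  have sg: "simple_graph X ?E" using fX E_sym E_irrefl by (auto simp: simple_graph_def)
  have "planar X ?E" by (rule planar_subgraph[OF planar assms]) auto
  moreover have "triangle_free X ?E" using triangle_free assms unfolding triangle_free_def by blast
  ultimately have "card (edges ?E) \<le> 2 * card X"
    using triangle_free_planar_edge_bound[OF sg _ _ False] by simp
  moreover have "card {(u, v). u \<in> X \<and> v \<in> X \<and> E u v} \<le> 2 * card (edges ?E)"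
  proof -
    have "{(u, v). u \<in> X \<and> v \<in> X \<and> E u v} \<subseteq> (\<Union>e\<in>edges ?E. {(u, v). {u, v} = e})"
      by (auto simp: edges_def)
    moreover have two: "finite {(u, v). {u, v} = e} \<and> card {(u, v). {u, v} = e} \<le> 2" if eE: "e \<in> edges ?E" for e
    proof -
      obtain a b where e: "e = {a, b}" using eE unfolding edges_def by blast
      have sub: "{(u, v). {u, v} = e} \<subseteq> {(a, b), (b, a)}"
        unfolding e by (simp add: subset_iff doubleton_eq_iff)
      have "card {(a, b), (b, a)} \<le> 2" using card_length[of "[(a, b), (b, a)]"] by simp
      then show ?thesis
        using finite_subset[OF sub] order_trans[OF card_mono[OF _ sub]] by simp
    qed
    ultimately have "card {(u, v). u \<in> X \<and> v \<in> X \<and> E u v} \<le> card (\<Union>e\<in>edges ?E. {(u, v). {u, v} = e})"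
      using finite_edges[OF sg] by (intro card_mono) auto
    also have "\<dots> \<le> (\<Sum>e\<in>edges ?E. card {(u, v). {u, v} = e})" by (rule card_UN_le[OF finite_edges[OF sg]])
    also have "\<dots> \<le> (\<Sum>e\<in>edges ?E. 2)" using two by (intro sum_mono) auto
    finally show ?thesis by simp
  qed
  ultimately show ?thesis by simp
qed auto

lemma bip_bound:
  assumes "A \<subseteq> V" "B \<subseteq> V" "A \<inter> B = {}"
  shows "card {(a, b). a \<in> A \<and> b \<in> B \<and> E a b} \<le> 2 * (card A + card B)"
proof (rule bipartite_planar_bound)
  show "finite A" "finite B" using assms finite_V by (auto intro: finite_subset)
  show "planar (A \<union> B) (\<lambda>u v. (u, v) \<in> {(a, b). a \<in> A \<and> b \<in> B \<and> E a b} \<or> (v, u) \<in> {(a, b). a \<in> A \<and> b \<in> B \<and> E a b})"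
    by (rule planar_subgraph[OF planar]) (use assms E_sym in auto)
qed (use assms in auto)

lemma subdivided_bip_bound:
  assumes AB: "A \<subseteq> V" "B \<subseteq> V" "A \<inter> B = {}" and M: "M \<subseteq> A \<times> B" and inj: "inj_on w M"
    and w: "\<And>a b. (a, b) \<in> M \<Longrightarrow> w (a, b) \<notin> A \<union> B \<and> E a (w (a, b)) \<and> E (w (a, b)) b"
  shows "card M \<le> 2 * (card A + card B)"
proof (rule bipartite_planar_bound)
  show "finite A" "finite B" using assms finite_V by (auto intro: finite_subset)
  let ?w = "\<lambda>u v. if (u, v) \<in> M then w (u, v) else w (v, u)"
  show "planar (A \<union> B) (\<lambda>u v. (u, v) \<in> M \<or> (v, u) \<in> M)"
  proof (rule planar_subdivision[OF simple planar, of _ _ ?w])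
    fix u v x y assume *: "(u, v) \<in> M \<or> (v, u) \<in> M" "(x, y) \<in> M \<or> (y, x) \<in> M" "{u, v} \<noteq> {x, y}"
    then show "?w u v \<noteq> ?w x y" using inj by (auto simp: inj_on_def insert_commute)
  next
    fix u v assume *: "(u, v) \<in> M \<or> (v, u) \<in> M"
    then show "?w u v \<notin> A \<union> B \<and> E u (?w u v) \<and> E (?w u v) v"
      using w[of u v] w[of v u] E_sym by (auto split: if_splits)
    show "u \<in> A \<union> B \<and> v \<in> A \<union> B \<and> u \<noteq> v" using * M AB by auto
  qed (use AB in auto)
qed (use assms in auto)

text \<open>For n common neighbours the bipartite bound reads 3 * n \<le> 2 * (3 + n).\<close>

lemma no_K37:
  assumes "a \<in> V" "b \<in> V" "c \<in> V" "a \<noteq> b" "a \<noteq> c" "b \<noteq> c"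
  shows "card {w. E a w \<and> E b w \<and> E c w} \<le> 6"
proof -
  let ?Y = "{w. E a w \<and> E b w \<and> E c w}"
  have Y: "?Y \<subseteq> V" "finite ?Y" "{a, b, c} \<inter> ?Y = {}"
    using E_V E_irrefl finite_subset[OF _ finite_V, of ?Y] by auto
  have "card {(x, y). x \<in> {a, b, c} \<and> y \<in> ?Y \<and> E x y} \<le> 2 * (card {a, b, c} + card ?Y)"
    using assms Y by (intro bip_bound) auto
  moreover have "{(x, y). x \<in> {a, b, c} \<and> y \<in> ?Y \<and> E x y} = {a, b, c} \<times> ?Y" by auto
  ultimately show ?thesis using assms by (simp add: card_cartesian_product)
qed

text \<open>Neighbours of \<open>X\<close> are split by their place. Those in \<open>D\<close> and
  in \<open>X\<close> are counted by edges, at most 2 * (|X| + |D|) and 4 * |X|. For those in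
  \<open>W\<close>, each pair in \<open>P\<close> gets one midpoint. The midpoints of a fixed
  \<open>v\<close> are distinct, so |P| is at most the number of edges between \<open>X\<close> and
  the midpoints, and there are at most 2 * (|X| + |D|) midpoints. Hence |P| \<le> 6 * |X| + 4 *
  |D|.\<close>

lemma widely_dominated_bound:
  assumes D: "D \<subseteq> V" and dm: "\<And>v. v \<in> V \<Longrightarrow> dm v \<in> D \<and> (dm v = v \<or> E v (dm v))"
    and X: "X \<subseteq> V - D" and q: "\<And>v. v \<in> X \<Longrightarrow> q \<le> card (dm ` {w. E v w})"
  shows "q * card X \<le> 12 * card X + 6 * card D"
proof -
  define W where "W = V - (D \<union> X)"
  define P where "P = {(v, e). v \<in> X \<and> (\<exists>w\<in>W. E v w \<and> dm w = e)}"
  define wf where "wf = (\<lambda>(v, e). SOME w. w \<in> W \<and> E v w \<and> dm w = e)"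
  have fin: "finite X" "finite D" using X D finite_V finite_subset by blast+
  have PXD: "P \<subseteq> X \<times> D" using dm by (auto simp: P_def W_def)
  have finP: "finite P" using PXD fin finite_subset by blast
  have wf: "wf (v, e) \<in> W \<and> E v (wf (v, e)) \<and> dm (wf (v, e)) = e" if "(v, e) \<in> P" for v e
    using that someI_ex[of "\<lambda>w. w \<in> W \<and> E v w \<and> dm w = e"] unfolding P_def wf_def by auto
  let ?W = "wf ` P"
  have W': "?W \<subseteq> W" using wf by auto
  have "inj_on (\<lambda>(v, e). (v, wf (v, e))) P"
  proof (rule inj_onI)
    fix x y assume "x \<in> P" "y \<in> P" "(case x of (v, e) \<Rightarrow> (v, wf (v, e))) = (case y of (v, e) \<Rightarrow> (v, wf (v, e)))"
    then obtain v e e' where "x = (v, e)" "y = (v, e')" "(v, e) \<in> P" "(v, e') \<in> P" "wf (v, e) = wf (v, e')"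
      by (cases x; cases y) auto
    then show "x = y" using wf[of v e] wf[of v e'] by metis
  qed
  then have "card P = card ((\<lambda>(v, e). (v, wf (v, e))) ` P)" by (simp add: card_image)
  also have "\<dots> \<le> card {(a, b). a \<in> X \<and> b \<in> ?W \<and> E a b}"
    using wf PXD finP fin by (intro card_mono finite_subset[of "{(a, b). a \<in> X \<and> b \<in> ?W \<and> E a b}" "X \<times> ?W"]) auto
  also have "\<dots> \<le> 2 * (card X + card ?W)" using X W' by (intro bip_bound) (auto simp: W_def)
  finally have 1: "card P \<le> 2 * (card X + card ?W)" .
  \<comment> \<open>One pair is kept per midpoint, so that different kept pairs have different
    midpoints and \<open>subdivided_bip_bound\<close> applies. This bounds the midpoints; the pairs
    are then bounded through them.\<close>
  define sel where "sel = (\<lambda>w. SOME x. x \<in> P \<and> wf x = w)"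
  have sel: "sel w \<in> P \<and> wf (sel w) = w" if "w \<in> ?W" for w
    using that someI_ex[of "\<lambda>x. x \<in> P \<and> wf x = w"] unfolding sel_def by auto
  have "card (sel ` ?W) = card ?W" using sel by (intro card_image) (metis inj_onI)
  moreover have "card (sel ` ?W) \<le> 2 * (card X + card D)"
  proof (rule subdivided_bip_bound[where w = wf])
    show "X \<subseteq> V" "D \<subseteq> V" "X \<inter> D = {}" using X D by auto
    show "sel ` ?W \<subseteq> X \<times> D" using sel PXD by blast
    show "inj_on wf (sel ` ?W)" using sel by (auto simp: inj_on_def)
    fix a b assume "(a, b) \<in> sel ` ?W"
    then have "(a, b) \<in> P" using sel by auto
    from wf[OF this] have *: "wf (a, b) \<in> W" "E a (wf (a, b))" "dm (wf (a, b)) = b" by auto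
    moreover have "wf (a, b) \<in> V" "wf (a, b) \<notin> D" using * by (auto simp: W_def)
    ultimately show "wf (a, b) \<notin> X \<union> D \<and> E a (wf (a, b)) \<and> E (wf (a, b)) b"
      using dm[of "wf (a, b)"] by (auto simp: W_def)
  qed
  ultimately have 2: "card P \<le> 6 * card X + 4 * card D" using 1 by simp
  have 3: "card {(a, b). a \<in> X \<and> b \<in> D \<and> E a b} \<le> 2 * (card X + card D)"
    using X D by (intro bip_bound) auto
  have 4: "card {(a, b). a \<in> X \<and> b \<in> X \<and> E a b} \<le> 4 * card X"
    using X by (intro pairs_bound) auto
  have sums: "card {(a, b). a \<in> X \<and> S a b} = (\<Sum>a\<in>X. card {b. S a b})"
    if "\<And>a. a \<in> X \<Longrightarrow> finite {b. S a b}" for S :: "nat \<Rightarrow> nat \<Rightarrow> bool"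
  proof -
    have "{(a, b). a \<in> X \<and> S a b} = (SIGMA a:X. {b. S a b})" by auto
    then show ?thesis using that fin by simp
  qed
  have fN: "finite {w. E v w \<and> T w}" for v T by (rule finite_subset[OF _ finite_N[of v]]) auto
  have fP: "finite {e. \<exists>w\<in>W. E v w \<and> dm w = e}" for v
    by (rule finite_subset[of _ "dm ` {w. E v w}"]) (auto simp: finite_N)
  have "card (dm ` {w. E v w}) \<le> card {w. E v w \<and> w \<in> D} + card {w. E v w \<and> w \<in> X} + card {e. \<exists>w\<in>W. E v w \<and> dm w = e}" for v
  proof -
    have "dm ` {w. E v w} \<subseteq> dm ` {w. E v w \<and> w \<in> D} \<union> dm ` {w. E v w \<and> w \<in> X} \<union> {e. \<exists>w\<in>W. E v w \<and> dm w = e}"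
      using E_V by (auto simp: W_def)
    then have "card (dm ` {w. E v w}) \<le> card (dm ` {w. E v w \<and> w \<in> D} \<union> dm ` {w. E v w \<and> w \<in> X} \<union> {e. \<exists>w\<in>W. E v w \<and> dm w = e})"
      by (intro card_mono) (auto simp: fN fP)
    also have "\<dots> \<le> card (dm ` {w. E v w \<and> w \<in> D}) + card (dm ` {w. E v w \<and> w \<in> X}) + card {e. \<exists>w\<in>W. E v w \<and> dm w = e}"
      by (meson add_le_mono1 card_Un_le le_trans)
    also have "\<dots> \<le> card {w. E v w \<and> w \<in> D} + card {w. E v w \<and> w \<in> X} + card {e. \<exists>w\<in>W. E v w \<and> dm w = e}"
      by (intro add_mono card_image_le order.refl) (auto simp: fN)
    finally show ?thesis .
  qed
  then have "(\<Sum>v\<in>X. q) \<le> (\<Sum>v\<in>X. card {w. E v w \<and> w \<in> D} + card {w. E v w \<and> w \<in> X} + card {e. \<exists>w\<in>W. E v w \<and> dm w = e})"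
    by (intro sum_mono order_trans[OF q])
  also have "\<dots> = card {(a, b). a \<in> X \<and> E a b \<and> b \<in> D} + card {(a, b). a \<in> X \<and> E a b \<and> b \<in> X} + card P"
    unfolding P_def sum.distrib by (simp only: sums fN fP)
  also have "\<dots> \<le> 2 * (card X + card D) + 4 * card X + (6 * card X + 4 * card D)"
  proof -
    have "{(a, b). a \<in> X \<and> E a b \<and> b \<in> T} = {(a, b). a \<in> X \<and> b \<in> T \<and> E a b}" for T by auto
    then show ?thesis using 2 3 4 by simp
  qed
  finally show ?thesis by (simp add: mult.commute)
qed

end

section \<open>Covering programs: rounding and descent\<close>

text \<open>Layer cake: the minimum over a pair integrates, over all levels, the indicator that both
  ends exceed the level, and every level set obeys the sparsity bound. The induction peels off the
  lowest level \<open>m\<close>.\<close>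

lemma sum_min_over_sparse_pairs:
  fixes \<phi> :: "'a \<Rightarrow> real"
  assumes "finite W" "\<And>v. v \<in> W \<Longrightarrow> \<phi> v \<ge> 0"
    and "\<And>X. X \<subseteq> W \<Longrightarrow> card {(u, v). u \<in> X \<and> v \<in> X \<and> E u v} \<le> c * card X"
  shows "(\<Sum>(u, v)\<in>{(u, v). u \<in> W \<and> v \<in> W \<and> E u v}. min (\<phi> u) (\<phi> v)) \<le> c * (\<Sum>v\<in>W. \<phi> v)"
  using assms
proof (induction "card W" arbitrary: W \<phi> rule: less_induct)
  case less
  let ?P = "\<lambda>W. {(u, v). u \<in> W \<and> v \<in> W \<and> E u v}"
  have finP: "finite (?P X)" if "finite X" for X by (rule finite_subset[of _ "X \<times> X"]) (use that in auto)
  show ?case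
  proof (cases "W = {}")
    case False
    define m where "m = Min (\<phi> ` W)"
    define \<psi> where "\<psi> = (\<lambda>v. \<phi> v - m)"
    define W' where "W' = {v \<in> W. \<phi> v \<noteq> m}"
    have m: "m \<le> \<phi> v" if "v \<in> W" for v using that less(2) by (simp add: m_def)
    have "m \<in> \<phi> ` W" using False less(2) by (simp add: m_def)
    then obtain v0 where "v0 \<in> W" "\<phi> v0 = m" by auto
    then have "W' \<subset> W" "m \<ge> 0" using less(3) by (auto simp: W'_def)
    then have W': "card W' < card W" "finite W'" "W' \<subseteq> W" using less(2) psubset_card_mono
      by (auto intro: finite_subset)
    have IH: "(\<Sum>(u, v)\<in>?P W'. min (\<psi> u) (\<psi> v)) \<le> c * (\<Sum>v\<in>W'. \<psi> v)"
      by (rule less(1)[OF W'(1,2)]) (use m W' less(4) in \<open>auto simp: \<psi>_def\<close>)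
    have "(\<Sum>(u, v)\<in>?P W. min (\<phi> u) (\<phi> v)) = (\<Sum>(u, v)\<in>?P W. m + min (\<psi> u) (\<psi> v))"
      by (intro sum.cong) (auto simp: \<psi>_def min_def)
    also have "\<dots> = card (?P W) * m + (\<Sum>(u, v)\<in>?P W. min (\<psi> u) (\<psi> v))"
      by (simp add: sum.distrib case_prod_beta)
    also have "(\<Sum>(u, v)\<in>?P W. min (\<psi> u) (\<psi> v)) = (\<Sum>(u, v)\<in>?P W'. min (\<psi> u) (\<psi> v))"
    proof (intro sum.mono_neutral_right finP less(2) ballI)
      fix z assume "z \<in> ?P W - ?P W'"
      then obtain u v where z: "z = (u, v)" "u \<in> W" "v \<in> W" "\<phi> u = m \<or> \<phi> v = m" by (auto simp: W'_def)
      then show "(case z of (u, v) \<Rightarrow> min (\<psi> u) (\<psi> v)) = 0"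
        using m[of u] m[of v] by (auto simp: \<psi>_def)
    qed (use W' in auto)
    also have "card (?P W) * m \<le> real (c * card W) * m"
      using less(4)[of W] \<open>m \<ge> 0\<close> by (intro mult_right_mono) (auto simp del: of_nat_mult)
    also note IH
    also have "(\<Sum>v\<in>W'. \<psi> v) = (\<Sum>v\<in>W. \<psi> v)"
      by (intro sum.mono_neutral_left less(2)) (auto simp: W'_def \<psi>_def)
    also have "real (c * card W) * m + real c * (\<Sum>v\<in>W. \<psi> v) = c * (\<Sum>v\<in>W. \<phi> v)"
      by (simp add: \<psi>_def sum_subtractf algebra_simps)
    finally show ?thesis by simp
  qed auto
qed

text \<open>For a general threshold t the argument gives |U| \<le> t * |U| + 2 * (x(W) + t * |U|),
  where \<open>W\<close> is the set of light vertices. So an uncovered vertex costs 2 / (1 - 3 * t)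
  per unit of weight and a heavy one 1 / t; the two agree, with value 5, exactly at t = 1/5.\<close>

lemma threshold_rounding:
  fixes x :: "'a \<Rightarrow> real"
  assumes fin: "finite V" and E: "\<And>u v. E u v \<Longrightarrow> u \<in> V \<and> v \<in> V" "\<And>u v. E u v \<Longrightarrow> E v u"
    and sparse: "\<And>X. X \<subseteq> V \<Longrightarrow> card {(u, v). u \<in> X \<and> v \<in> X \<and> E u v} \<le> 4 * card X"
    and x: "\<And>v. v \<in> V \<Longrightarrow> x v \<ge> 0"
    and U: "U \<subseteq> V" "\<And>u. u \<in> U \<Longrightarrow> x u + (\<Sum>w\<in>{w. E u w}. x w) \<ge> 1"
      "\<And>u. u \<in> U \<Longrightarrow> x u < 1 / 5" "\<And>u w. u \<in> U \<Longrightarrow> E u w \<Longrightarrow> x w < 1 / 5"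
  shows "real (card {w \<in> V. x w \<ge> 1 / 5}) + real (card U) \<le> 5 * (\<Sum>w\<in>V. x w)"
proof -
  define W where "W = {w \<in> V. x w < 1 / 5}"
  let ?H = "{w \<in> V. x w \<ge> 1 / 5}"
  have fW: "finite W" "finite ?H" using fin by (auto simp: W_def)
  have UW: "U \<subseteq> W" using U by (auto simp: W_def)
  have NW: "{w. E u w} \<subseteq> W" if "u \<in> U" for u using that U E by (auto simp: W_def)
  have fU: "finite U" using UW fW finite_subset by auto
  define \<phi> where "\<phi> = (\<lambda>v. x v + (if v \<in> U then 1 / 5 else 0))"
  let ?P = "{(u, v). u \<in> W \<and> v \<in> W \<and> E u v}"
  have fP: "finite ?P" by (rule finite_subset[of _ "W \<times> W"]) (use fW in auto)
  let ?t = "\<lambda>(u, w). if u \<in> U then x w else 0"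
  have swap: "(\<Sum>(u, w)\<in>?P. if w \<in> U then x u else 0) = sum ?t ?P"
    by (rule sum.reindex_bij_witness[of _ prod.swap prod.swap]) (use E in auto)
  have "(\<Sum>u\<in>U. \<Sum>w\<in>{w. E u w}. x w) = (\<Sum>u\<in>W. \<Sum>w\<in>{w\<in>W. E u w}. if u \<in> U then x w else 0)"
  proof (rule sum.mono_neutral_cong_left[OF fW(1) UW])
    show "(\<Sum>w\<in>{w. E u w}. x w) = (\<Sum>w\<in>{w\<in>W. E u w}. if u \<in> U then x w else 0)" if "u \<in> U" for u
      using NW[OF that] that by (intro sum.cong) auto
  qed auto
  also have "\<dots> = sum ?t (SIGMA u:W. {w\<in>W. E u w})"
    using fW by (subst sum.Sigma) auto
  also have "(SIGMA u:W. {w\<in>W. E u w}) = ?P" by auto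
  finally have 1: "(\<Sum>u\<in>U. \<Sum>w\<in>{w. E u w}. x w) = sum ?t ?P" .
  have "2 * sum ?t ?P = (\<Sum>(u, w)\<in>?P. (if u \<in> U then x w else 0) + (if w \<in> U then x u else 0))"
    using swap by (simp add: sum.distrib case_prod_beta)
  also have "\<dots> \<le> (\<Sum>(u, w)\<in>?P. min (\<phi> u) (\<phi> w))"
  proof (rule sum_mono, clarify)
    fix u w assume "u \<in> W" "w \<in> W" "E u w"
    then have "0 \<le> x u" "x u < 1 / 5" "0 \<le> x w" "x w < 1 / 5" using x by (auto simp: W_def)
    then show "(if u \<in> U then x w else 0) + (if w \<in> U then x u else 0) \<le> min (\<phi> u) (\<phi> w)"
      by (auto simp: \<phi>_def)
  qed
  also have "\<dots> \<le> real 4 * (\<Sum>v\<in>W. \<phi> v)"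
    by (rule sum_min_over_sparse_pairs[OF fW(1)]) (use sparse x in \<open>auto simp: \<phi>_def W_def\<close>)
  also have "(\<Sum>v\<in>W. \<phi> v) = (\<Sum>v\<in>W. x v) + card U / 5"
  proof -
    have "(\<Sum>v\<in>W. if v \<in> U then 1 / 5 else (0::real)) = card U / 5"
      using UW fW by (simp add: sum.If_cases Int_absorb1)
    then show ?thesis by (simp add: \<phi>_def sum.distrib)
  qed
  finally have 2: "sum ?t ?P \<le> 2 * (\<Sum>v\<in>W. x v) + 2 * card U / 5" by simp
  have "real (card U) = (\<Sum>u\<in>U. 1)" by simp
  also have "\<dots> \<le> (\<Sum>u\<in>U. x u + (\<Sum>w\<in>{w. E u w}. x w))" using U by (intro sum_mono) auto
  also have "\<dots> = (\<Sum>u\<in>U. x u) + sum ?t ?P" using 1 by (simp add: sum.distrib)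
  also have "(\<Sum>u\<in>U. x u) \<le> (\<Sum>u\<in>U. 1 / 5)" using U(3) by (intro sum_mono) (auto simp: less_imp_le)
  finally have 3: "real (card U) \<le> 5 * (\<Sum>v\<in>W. x v)" using 2 by simp
  have "real (card ?H) = 5 * (\<Sum>w\<in>?H. 1 / 5)" by simp
  also have "\<dots> \<le> 5 * (\<Sum>w\<in>?H. x w)" by (intro mult_left_mono sum_mono) auto
  finally have 4: "real (card ?H) \<le> 5 * (\<Sum>w\<in>?H. x w)" .
  have "V = ?H \<union> W" "?H \<inter> W = {}" by (auto simp: W_def)
  then have "(\<Sum>w\<in>V. x w) = (\<Sum>w\<in>?H. x w) + (\<Sum>w\<in>W. x w)"
    using fW by (metis (no_types, lifting) sum.union_disjoint)
  then show ?thesis using 3 4 by simp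
qed

text \<open>Projected subgradient descent on the exact penalty function
  \<open>\<Sum>x + \<Sum>\<^sub>C max 0 (1 - x(C))\<close> of the covering problem.\<close>

lemma covering_descent:
  fixes x :: "nat \<Rightarrow> 'a \<Rightarrow> real" and y :: "'a \<Rightarrow> real"
  assumes fin: "finite S" "finite R" and R: "\<And>C. C \<in> R \<Longrightarrow> C \<subseteq> S"
    and x0: "\<And>w. w \<in> S \<Longrightarrow> x 0 w = 0"
    and xSuc: "\<And>i w. w \<in> S \<Longrightarrow>
      x (Suc i) w = max 0 (x i w - \<eta> * (1 - real (card {C \<in> R. w \<in> C \<and> sum (x i) C < 1})))"
    and deg: "\<And>w. w \<in> S \<Longrightarrow> card {C \<in> R. w \<in> C} \<le> \<Delta>"
    and y: "\<And>w. w \<in> S \<Longrightarrow> y w \<ge> 0" "\<And>C. C \<in> R \<Longrightarrow> sum y C \<ge> 1" and \<eta>: "\<eta> > 0"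
  shows "(\<Sum>i<T. sum (x i) S + (\<Sum>C\<in>R. max 0 (1 - sum (x i) C)))
    \<le> real T * sum y S + (\<Sum>w\<in>S. (y w)\<^sup>2) / (2 * \<eta>) + real T * \<eta> * (1 + real \<Delta>)\<^sup>2 * card S / 2"
proof -
  define f where "f = (\<lambda>i. sum (x i) S + (\<Sum>C\<in>R. max 0 (1 - sum (x i) C)))"
  define viol where "viol = (\<lambda>i. {C \<in> R. sum (x i) C < 1})"
  define g where "g = (\<lambda>i w. 1 - real (card {C \<in> R. w \<in> C \<and> sum (x i) C < 1}))"
  define d where "d = (\<lambda>i. \<Sum>w\<in>S. (x i w - y w)\<^sup>2)"
  have fv: "finite (viol i)" for i using fin by (simp add: viol_def)
  \<comment> \<open>The subgradient inequality at \<open>x i\<close>, compared with the feasible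
    point \<open>y\<close>, whose penalty vanishes. Only the rows violated by \<open>x i\<close>
    enter, each with at most \<open>sum (x i) C - 1\<close> because
    \<open>sum y C \<ge> 1\<close>.\<close>
  have lin: "f i - sum y S \<le> (\<Sum>w\<in>S. g i w * (x i w - y w))" for i
  proof -
    have "card {C \<in> R. w \<in> C \<and> sum (x i) C < 1} = (\<Sum>C\<in>viol i. if w \<in> C then 1 else (0::nat))" for w
      using fv[of i] by (simp add: sum.If_cases viol_def Int_def conj_commute conj_left_commute)
    then have cd: "real (card {C \<in> R. w \<in> C \<and> sum (x i) C < 1}) = (\<Sum>C\<in>viol i. if w \<in> C then 1 else 0)" for w
      by (simp add: if_distrib[of real] cong: if_cong)
    have "(\<Sum>w\<in>S. real (card {C \<in> R. w \<in> C \<and> sum (x i) C < 1}) * (x i w - y w))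
      = (\<Sum>w\<in>S. \<Sum>C\<in>viol i. if w \<in> C then x i w - y w else 0)"
      unfolding cd sum_distrib_right by (intro sum.cong) auto
    also have "\<dots> = (\<Sum>C\<in>viol i. \<Sum>w\<in>S. if w \<in> C then x i w - y w else 0)" by (rule sum.swap)
    also have "\<dots> = (\<Sum>C\<in>viol i. \<Sum>w\<in>C. x i w - y w)"
    proof (rule sum.cong[OF refl])
      fix C assume "C \<in> viol i"
      then have "S \<inter> C = C" using R by (auto simp: viol_def)
      then show "(\<Sum>w\<in>S. if w \<in> C then x i w - y w else 0) = (\<Sum>w\<in>C. x i w - y w)"
        using sum.inter_restrict[OF fin(1), of "\<lambda>w. x i w - y w" C] by simp
    qed
    also have "\<dots> \<le> (\<Sum>C\<in>viol i. sum (x i) C - 1)"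
      using y(2) by (intro sum_mono) (auto simp: viol_def sum_subtractf)
    also have "\<dots> = - (\<Sum>C\<in>viol i. 1 - sum (x i) C)" by (simp add: sum_subtractf)
    also have "(\<Sum>C\<in>viol i. 1 - sum (x i) C) = (\<Sum>C\<in>R. max 0 (1 - sum (x i) C))"
      using fin by (intro sum.mono_neutral_cong_left) (auto simp: viol_def)
    finally have "(\<Sum>w\<in>S. real (card {C \<in> R. w \<in> C \<and> sum (x i) C < 1}) * (x i w - y w))
      \<le> - (\<Sum>C\<in>R. max 0 (1 - sum (x i) C))" .
    moreover have "(\<Sum>w\<in>S. g i w * (x i w - y w)) = sum (x i) S - sum y S -
      (\<Sum>w\<in>S. real (card {C \<in> R. w \<in> C \<and> sum (x i) C < 1}) * (x i w - y w))"
      by (simp add: g_def algebra_simps sum_subtractf sum.distrib)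
    ultimately show ?thesis by (simp add: f_def)
  qed
  have gb: "(g i w)\<^sup>2 \<le> (1 + real \<Delta>)\<^sup>2" if "w \<in> S" for i w
  proof -
    have "card {C \<in> R. w \<in> C \<and> sum (x i) C < 1} \<le> card {C \<in> R. w \<in> C}"
      using fin by (intro card_mono) auto
    then have "real (card {C \<in> R. w \<in> C \<and> sum (x i) C < 1}) \<le> real \<Delta>" using deg[OF that] by simp
    then have "\<bar>g i w\<bar> \<le> 1 + real \<Delta>" by (auto simp: g_def)
    then show ?thesis using abs_le_square_iff[of "g i w" "1 + real \<Delta>"] by simp
  qed
  have step: "d (Suc i) \<le> d i - 2 * \<eta> * (f i - sum y S) + \<eta>\<^sup>2 * (1 + real \<Delta>)\<^sup>2 * card S" for i
  proof -
    have "d (Suc i) \<le> (\<Sum>w\<in>S. (x i w - y w)\<^sup>2 - 2 * \<eta> * (g i w * (x i w - y w)) + \<eta>\<^sup>2 * (1 + real \<Delta>)\<^sup>2)"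
      unfolding d_def
    proof (rule sum_mono)
      fix w assume w: "w \<in> S"
      \<comment> \<open>Truncation at 0 does not move the iterate away from the nonnegative
        \<open>y\<close>.\<close>
      have "x (Suc i) w = max 0 (x i w - \<eta> * g i w)" using xSuc[OF w] by (simp add: g_def)
      then have "\<bar>x (Suc i) w - y w\<bar> \<le> \<bar>x i w - \<eta> * g i w - y w\<bar>" using y(1)[OF w] by auto
      then have "(x (Suc i) w - y w)\<^sup>2 \<le> (x i w - \<eta> * g i w - y w)\<^sup>2"
        by (simp add: abs_le_square_iff)
      also have "\<dots> = (x i w - y w)\<^sup>2 - 2 * \<eta> * (g i w * (x i w - y w)) + \<eta>\<^sup>2 * (g i w)\<^sup>2"
        by (simp add: power2_eq_square algebra_simps)
      also have "\<dots> \<le> (x i w - y w)\<^sup>2 - 2 * \<eta> * (g i w * (x i w - y w)) + \<eta>\<^sup>2 * (1 + real \<Delta>)\<^sup>2"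
        using gb[OF w] by (intro add_left_mono mult_left_mono) auto
      finally show "(x (Suc i) w - y w)\<^sup>2 \<le> \<dots>" .
    qed
    also have "\<dots> = d i - 2 * \<eta> * (\<Sum>w\<in>S. g i w * (x i w - y w)) + \<eta>\<^sup>2 * (1 + real \<Delta>)\<^sup>2 * card S"
      by (simp add: d_def sum.distrib sum_subtractf sum_distrib_left)
    also have "\<dots> \<le> d i - 2 * \<eta> * (f i - sum y S) + \<eta>\<^sup>2 * (1 + real \<Delta>)\<^sup>2 * card S"
      using lin[of i] \<eta> by (simp add: mult_left_mono)
    finally show ?thesis .
  qed
  have tele: "d T + 2 * \<eta> * (\<Sum>i<T. f i - sum y S) \<le> d 0 + real T * (\<eta>\<^sup>2 * (1 + real \<Delta>)\<^sup>2 * card S)"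
  proof (induction T)
    case (Suc T)
    then show ?case using step[of T] by (simp add: algebra_simps)
  qed simp
  have "d T \<ge> 0" by (simp add: d_def sum_nonneg)
  moreover have "d 0 = (\<Sum>w\<in>S. (y w)\<^sup>2)" using x0 by (simp add: d_def)
  ultimately have "2 * \<eta> * (\<Sum>i<T. f i - sum y S) \<le> (\<Sum>w\<in>S. (y w)\<^sup>2) + real T * (\<eta>\<^sup>2 * (1 + real \<Delta>)\<^sup>2 * card S)"
    using tele by simp
  then have "(\<Sum>i<T. f i - sum y S) \<le> ((\<Sum>w\<in>S. (y w)\<^sup>2) + real T * (\<eta>\<^sup>2 * (1 + real \<Delta>)\<^sup>2 * card S)) / (2 * \<eta>)"
    using \<eta> by (simp add: field_simps)
  also have "\<dots> = (\<Sum>w\<in>S. (y w)\<^sup>2) / (2 * \<eta>) + real T * \<eta> * (1 + real \<Delta>)\<^sup>2 * card S / 2"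
    using \<eta> by (simp add: field_simps power2_eq_square)
  finally show ?thesis by (simp add: f_def sum_subtractf)
qed

section \<open>The algorithm and its locality\<close>

text \<open>
  The constants come from the analysis: \<open>widely_dominated_bound\<close> with \<open>q = 18\<close> bounds the hubs
  outside a dominating set \<open>D\<close> by \<open>card D\<close>; with \<open>q = 42\<close> it bounds the vertices of fat pairs
  missed by \<open>D\<close> by \<open>card D / 5\<close>, and \<open>294 = 7 * 42\<close>, where a vertex outside a fat pair dominates at
  most \<open>7\<close> common neighbours of the pair.  Isolated numbers outside the vertex set satisfy
  \<open>free\<close> and \<open>rest\<close>; they influence no vertex of the graph.
\<close>

definition hub :: "(nat \<Rightarrow> nat \<Rightarrow> bool) \<Rightarrow> nat \<Rightarrow> bool" where
  "hub E v \<longleftrightarrow> \<not> (\<exists>A. A \<subseteq> {a. \<exists>w. E v w \<and> (a = w \<or> E w a)} - {v} \<and> finite A \<and> card A \<le> 17 \<and>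
     (\<forall>w. E v w \<longrightarrow> w \<in> A \<or> (\<exists>a\<in>A. E w a)))"

text \<open>Hubs are always chosen, so a vertex of the graph that is not free is dominated without
  any further row.\<close>

definition free :: "(nat \<Rightarrow> nat \<Rightarrow> bool) \<Rightarrow> nat \<Rightarrow> bool" where
  "free E v \<longleftrightarrow> \<not> hub E v \<and> (\<forall>w. E v w \<longrightarrow> \<not> hub E w)"

text \<open>Counting only free common neighbours guarantees, in a simple graph, that neither end of
  a fat pair is a hub; this makes the degree bounds for non-hubs applicable to both.\<close>

definition fat :: "(nat \<Rightarrow> nat \<Rightarrow> bool) \<Rightarrow> nat \<Rightarrow> nat set" where
  "fat E u = {z. z \<noteq> u \<and> 294 \<le> card {w. E u w \<and> E w z \<and> free E w}}"

definition rest :: "(nat \<Rightarrow> nat \<Rightarrow> bool) \<Rightarrow> nat \<Rightarrow> bool" where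
  "rest E v \<longleftrightarrow> free E v \<and> \<not> (\<exists>u z. E v u \<and> E v z \<and> z \<in> fat E u)"

text \<open>The column of \<open>w\<close> in the closed-neighbourhood rows, encoded by the centres
  of these rows.\<close>

definition footprint :: "(nat \<Rightarrow> nat \<Rightarrow> bool) \<Rightarrow> nat \<Rightarrow> nat set" where
  "footprint E w = {u. (u = w \<or> E w u) \<and> rest E u}"

text \<open>
  The least vertex among those with the same footprint stands for the whole class of equal columns.  The
  candidates are reached through \<open>u\<close> so that the condition is visibly local.
\<close>

definition rep :: "(nat \<Rightarrow> nat \<Rightarrow> bool) \<Rightarrow> nat \<Rightarrow> bool" where
  "rep E w \<longleftrightarrow> footprint E w \<noteq> {} \<and>
     (\<forall>u\<in>footprint E w. \<forall>w'. (w' = u \<or> E u w') \<longrightarrow> footprint E w' = footprint E w \<longrightarrow> w \<le> w')"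

text \<open>A vertex of a fat pair remains a variable of its own, since its column also has entries
  in pair rows; all other vertices survive only as representatives.\<close>

definition var :: "(nat \<Rightarrow> nat \<Rightarrow> bool) \<Rightarrow> nat \<Rightarrow> bool" where
  "var E w \<longleftrightarrow> fat E w \<noteq> {} \<or> rep E w"

definition star :: "(nat \<Rightarrow> nat \<Rightarrow> bool) \<Rightarrow> nat \<Rightarrow> nat set" where
  "star E u = {w. (w = u \<or> E u w) \<and> var E w}"

definition constraints :: "(nat \<Rightarrow> nat \<Rightarrow> bool) \<Rightarrow> nat \<Rightarrow> nat set set" where
  "constraints E w = star E ` footprint E w \<union> (\<lambda>z. {w, z}) ` fat E w"

fun iter :: "real \<Rightarrow> (nat \<Rightarrow> nat \<Rightarrow> bool) \<Rightarrow> nat \<Rightarrow> nat \<Rightarrow> real" where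
  "iter \<eta> E 0 w = 0"
| "iter \<eta> E (Suc i) w = (if var E w then
     max 0 (iter \<eta> E i w - \<eta> * (1 - real (card {C \<in> constraints E w. sum (iter \<eta> E i) C < 1}))) else 0)"

text \<open>
  The average of the iterates, where each missing amount of a constraint is charged to its
  least variable.
\<close>

definition sol :: "real \<Rightarrow> nat \<Rightarrow> (nat \<Rightarrow> nat \<Rightarrow> bool) \<Rightarrow> nat \<Rightarrow> real" where
  "sol \<eta> T E w = (\<Sum>i<T. iter \<eta> E i w
     + (\<Sum>C\<in>{C \<in> constraints E w. Min C = w}. max 0 (1 - sum (iter \<eta> E i) C))) / real T"

definition chosen :: "real \<Rightarrow> nat \<Rightarrow> (nat \<Rightarrow> nat \<Rightarrow> bool) \<Rightarrow> nat \<Rightarrow> bool" where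
  "chosen \<eta> T E v \<longleftrightarrow> hub E v \<or> sol \<eta> T E v \<ge> 1 / 5 \<or>
     (rest E v \<and> \<not> (\<exists>w. E v w \<and> sol \<eta> T E w \<ge> 1 / 5))"

text \<open>
  The rule sees all edges at the vertices of the ball, which a view of radius \<open>r + 1\<close> provides.
\<close>

definition agree :: "nat \<Rightarrow> nat \<Rightarrow> (nat \<Rightarrow> nat \<Rightarrow> bool) \<Rightarrow> (nat \<Rightarrow> nat \<Rightarrow> bool) \<Rightarrow> bool" where
  "agree r v E E' \<longleftrightarrow> (\<forall>x\<in>nbhd E r v. \<forall>y. E x y = E' x y)"

definition local_rule :: "nat \<Rightarrow> ((nat \<Rightarrow> nat \<Rightarrow> bool) \<Rightarrow> nat \<Rightarrow> 'a) \<Rightarrow> bool" where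
  "local_rule r f \<longleftrightarrow> (\<forall>E E' v. agree r v E E' \<longrightarrow> f E v = f E' v)"

lemma local_ruleD: "local_rule r f \<Longrightarrow> agree r v E E' \<Longrightarrow> f E v = f E' v"
  unfolding local_rule_def by blast

lemma nbhd_trans: "y \<in> nbhd E r x \<Longrightarrow> x \<in> nbhd E s v \<Longrightarrow> y \<in> nbhd E (r + s) v"
  by (induction r arbitrary: y) auto

lemma nbhd_self: "v \<in> nbhd E r v"
  by (induction r) auto

text \<open>Every ingredient of the algorithm reads earlier ones at distance at most two, so a layer
  costs two rounds. The premise on \<open>h\<close> lists the data available: edges at
  \<open>v\<close> and at its neighbours, and values of \<open>f\<close> up to distance two.\<close>

lemma local_rule_step:
  assumes f: "local_rule r f"
    and h: "\<And>E E' v. (\<And>y. E v y = E' v y) \<Longrightarrow> (\<And>w y. E v w \<Longrightarrow> E w y = E' w y) \<Longrightarrow>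
      f E v = f E' v \<Longrightarrow> (\<And>w. E v w \<Longrightarrow> f E w = f E' w) \<Longrightarrow>
      (\<And>w z. E v w \<Longrightarrow> E w z \<Longrightarrow> f E z = f E' z) \<Longrightarrow> h E v = h E' v"
  shows "local_rule (r + 2) h"
  unfolding local_rule_def
proof (intro allI impI)
  fix E E' :: "nat \<Rightarrow> nat \<Rightarrow> bool" and v
  assume a: "agree (r + 2) v E E'"
  have ag: "agree r u E E'" if "u \<in> nbhd E 2 v" for u
    using a nbhd_trans[OF _ that] unfolding agree_def by blast
  have fe: "f E u = f E' u" if "u \<in> nbhd E 2 v" for u
    using ag[OF that] f unfolding local_rule_def by blast
  have ee: "E u y = E' u y" if "u \<in> nbhd E 2 v" for u y
    using ag[OF that] nbhd_self[of u E r] unfolding agree_def by blast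
  have "v \<in> nbhd E 2 v" "E v w \<Longrightarrow> w \<in> nbhd E 2 v" "E v w \<Longrightarrow> E w z \<Longrightarrow> z \<in> nbhd E 2 v" for w z
    by (auto simp: numeral_2_eq_2)
  note near = this
  show "h E v = h E' v" by (rule h) (blast intro: fe near | rule ee, blast intro: near)+
qed

lemma local_rule_mono: "local_rule r f \<Longrightarrow> r \<le> s \<Longrightarrow> local_rule s f"
proof -
  assume f: "local_rule r f" and "r \<le> s"
  have "agree r v E E'" if "agree s v E E'" for v E E'
  proof -
    have "nbhd E r v \<subseteq> nbhd E s v" using nbhd_trans[of _ E r v "s - r" v] nbhd_self[of v E "s - r"] \<open>r \<le> s\<close> by auto
    then show ?thesis using that by (auto simp: agree_def)
  qed
  then show ?thesis using f unfolding local_rule_def by blast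
qed

lemma local_rule_Pair:
  "local_rule r f \<Longrightarrow> local_rule s g \<Longrightarrow> local_rule (max r s) (\<lambda>E v. (f E v, g E v))"
  using local_rule_mono[of r f "max r s"] local_rule_mono[of s g "max r s"]
  by (simp add: local_rule_def)

section \<open>Radii of the successive ingredients\<close>

lemma local_hub: "local_rule 2 hub"
proof -
  have "local_rule (0 + 2) hub"
  proof (rule local_rule_step[of _ "\<lambda>E v. ()"])
    fix E E' :: "nat \<Rightarrow> nat \<Rightarrow> bool" and v
    assume e: "\<And>y. E v y = E' v y" "\<And>w y. E v w \<Longrightarrow> E w y = E' w y"
    have 1: "{a. \<exists>w. E v w \<and> (a = w \<or> E w a)} = {a. \<exists>w. E' v w \<and> (a = w \<or> E' w a)}"
      using e by blast
    have 2: "(\<forall>w. E v w \<longrightarrow> w \<in> A \<or> (\<exists>a\<in>A. E w a)) = (\<forall>w. E' v w \<longrightarrow> w \<in> A \<or> (\<exists>a\<in>A. E' w a))" for A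
      using e by blast
    show "hub E v = hub E' v" unfolding hub_def 1 2 by simp
  qed (simp add: local_rule_def)
  then show ?thesis by (simp add: numeral_2_eq_2)
qed

lemma local_free: "local_rule 4 free"
proof -
  have "local_rule (2 + 2) free"
    by (rule local_rule_step[OF local_hub]) (auto simp: free_def)
  then show ?thesis by simp
qed

lemma local_fat: "local_rule 6 fat"
proof -
  have "local_rule (4 + 2) fat"
  proof (rule local_rule_step[OF local_free])
    fix E E' :: "nat \<Rightarrow> nat \<Rightarrow> bool" and v
    assume e: "\<And>y. E v y = E' v y" "\<And>w y. E v w \<Longrightarrow> E w y = E' w y" "\<And>w. E v w \<Longrightarrow> free E w = free E' w"
    have "{w. E v w \<and> E w z \<and> free E w} = {w. E' v w \<and> E' w z \<and> free E' w}" for z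
      using e by blast
    then show "fat E v = fat E' v" by (simp add: fat_def)
  qed
  then show ?thesis by simp
qed

lemma local_rest: "local_rule 8 rest"
proof -
  have "local_rule (max 4 6 + 2) rest"
    by (rule local_rule_step[OF local_rule_Pair[OF local_free local_fat]]) (auto simp: rest_def)
  then show ?thesis by simp
qed

lemma local_footprint: "local_rule 10 footprint"
proof -
  have "local_rule (8 + 2) footprint"
    by (rule local_rule_step[OF local_rest]) (auto simp: footprint_def)
  then show ?thesis by simp
qed

lemma footprint_near: "u \<in> footprint E w \<Longrightarrow> u = w \<or> E w u"
  by (auto simp: footprint_def)

lemma local_rep: "local_rule 12 rep"
proof -
  have "local_rule (10 + 2) rep"
  proof (rule local_rule_step[OF local_footprint])
    fix E E' :: "nat \<Rightarrow> nat \<Rightarrow> bool" and v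
    assume e: "\<And>y. E v y = E' v y" "\<And>w y. E v w \<Longrightarrow> E w y = E' w y" "footprint E v = footprint E' v"
      "\<And>w. E v w \<Longrightarrow> footprint E w = footprint E' w" "\<And>w z. E v w \<Longrightarrow> E w z \<Longrightarrow> footprint E z = footprint E' z"
    have "(\<forall>w'. (w' = u \<or> E u w') \<longrightarrow> footprint E w' = footprint E v \<longrightarrow> v \<le> w') \<longleftrightarrow>
      (\<forall>w'. (w' = u \<or> E' u w') \<longrightarrow> footprint E' w' = footprint E v \<longrightarrow> v \<le> w')" if "u \<in> footprint E v" for u
    proof -
      have "(w' = u \<or> E u w') = (w' = u \<or> E' u w')" for w'
        using footprint_near[OF that] e(1,2) by blast
      moreover have "footprint E w' = footprint E' w'" if "w' = u \<or> E u w'" for w'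
        using that footprint_near[OF \<open>u \<in> footprint E v\<close>] e(3-5) by blast
      ultimately show ?thesis by metis
    qed
    then show "rep E v = rep E' v" unfolding rep_def e(3)[symmetric] by simp
  qed
  then show ?thesis by simp
qed

lemma local_var: "local_rule 14 var"
proof -
  have "local_rule (max 6 12 + 2) var"
    by (rule local_rule_step[OF local_rule_Pair[OF local_fat local_rep]]) (auto simp: var_def)
  then show ?thesis by simp
qed

lemma local_star: "local_rule 16 star"
proof -
  have "local_rule (14 + 2) star"
    by (rule local_rule_step[OF local_var]) (auto simp: star_def)
  then show ?thesis by simp
qed

lemma local_constraints: "local_rule 18 constraints"
proof -
  have "local_rule (max 16 (max 10 6) + 2) constraints"
  proof (rule local_rule_step[OF local_rule_Pair[OF local_star local_rule_Pair[OF local_footprint local_fat]]])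
    fix E E' :: "nat \<Rightarrow> nat \<Rightarrow> bool" and v
    assume "(star E v, footprint E v, fat E v) = (star E' v, footprint E' v, fat E' v)"
      "\<And>w. E v w \<Longrightarrow> (star E w, footprint E w, fat E w) = (star E' w, footprint E' w, fat E' w)"
    then have e: "star E v = star E' v" "footprint E v = footprint E' v" "fat E v = fat E' v"
      "\<And>w. E v w \<Longrightarrow> star E w = star E' w" by auto
    have "star E ` footprint E v = star E' ` footprint E v"
      by (rule image_cong[OF refl]) (use footprint_near[of _ E v] e in metis)
    then show "constraints E v = constraints E' v" using e by (simp add: constraints_def)
  qed
  then show ?thesis by simp
qed

lemma fat_common:
  assumes "z \<in> fat E u"
  shows "\<exists>w. E u w \<and> E w z \<and> free E w"
proof (rule ccontr)
  assume "\<not> ?thesis"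
  then have "{w. E u w \<and> E w z \<and> free E w} = {}" by auto
  then have "card {w. E u w \<and> E w z \<and> free E w} = 0" by (simp only: card.empty)
  then show False using assms unfolding fat_def mem_Collect_eq by linarith
qed

text \<open>A star row reaches \<open>v\<close> through its centre, and the partner in a fat pair
  shares a neighbour with \<open>v\<close>. Hence all weights of a row are within reach of one
  application of \<open>local_rule_step\<close>.\<close>

lemma constraints_near:
  assumes "C \<in> constraints E v" "x \<in> C"
  shows "x = v \<or> E v x \<or> (\<exists>w. E v w \<and> E w x)"
  using assms fat_common[of _ E v]
  by (auto simp: constraints_def star_def dest: footprint_near)

lemma local_iter: "local_rule (18 + 2 * i) (\<lambda>E. iter \<eta> E i)"
proof (induction i)
  case 0
  then show ?case by (simp add: local_rule_def)
next
  case (Suc i)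
  have "local_rule (max (max 14 18) (18 + 2 * i) + 2) (\<lambda>E. iter \<eta> E (Suc i))"
  proof (rule local_rule_step[OF local_rule_Pair[OF local_rule_Pair[OF local_var local_constraints] Suc]])
    fix E E' :: "nat \<Rightarrow> nat \<Rightarrow> bool" and v
    let ?f = "\<lambda>E v. ((var E v, constraints E v), iter \<eta> E i v)"
    assume "?f E v = ?f E' v" "\<And>w. E v w \<Longrightarrow> ?f E w = ?f E' w"
      "\<And>w z. E v w \<Longrightarrow> E w z \<Longrightarrow> ?f E z = ?f E' z"
    then have e: "var E v = var E' v" "constraints E v = constraints E' v" "iter \<eta> E i v = iter \<eta> E' i v"
      "\<And>w. E v w \<Longrightarrow> iter \<eta> E i w = iter \<eta> E' i w"
      "\<And>w z. E v w \<Longrightarrow> E w z \<Longrightarrow> iter \<eta> E i z = iter \<eta> E' i z" by auto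
    have "sum (iter \<eta> E i) C = sum (iter \<eta> E' i) C" if "C \<in> constraints E v" for C
      by (rule sum.cong[OF refl]) (use constraints_near[OF that] e in blast)
    then have "{C \<in> constraints E v. sum (iter \<eta> E i) C < 1} = {C \<in> constraints E' v. sum (iter \<eta> E' i) C < 1}"
      using e(2) by auto
    then show "iter \<eta> E (Suc i) v = iter \<eta> E' (Suc i) v" using e by simp
  qed
  then show ?case by (simp del: iter.simps)
qed

lemma local_sol: "local_rule (20 + 2 * T) (sol \<eta> T)"
proof -
  \<comment> \<open>All iterates are bundled into one function-valued rule. The default 0 from
    \<open>T\<close> on keeps its radius bounded; only the iterates below \<open>T\<close> are
    read.\<close>
  have it: "local_rule (18 + 2 * T) (\<lambda>E v i. if i < T then iter \<eta> E i v else 0)"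
    unfolding local_rule_def
  proof (intro allI impI ext)
    fix E E' :: "nat \<Rightarrow> nat \<Rightarrow> bool" and v i assume "agree (18 + 2 * T) v E E'"
    then show "(if i < T then iter \<eta> E i v else 0) = (if i < T then iter \<eta> E' i v else 0)"
      using local_rule_mono[OF local_iter[of i \<eta>], of "18 + 2 * T"] by (auto simp: local_rule_def)
  qed
  have "local_rule (max 18 (18 + 2 * T) + 2) (sol \<eta> T)"
  proof (rule local_rule_step[OF local_rule_Pair[OF local_constraints it]])
    fix E E' :: "nat \<Rightarrow> nat \<Rightarrow> bool" and v
    let ?f = "\<lambda>E v. (constraints E v, \<lambda>i. if i < T then iter \<eta> E i v else 0)"
    assume a: "?f E v = ?f E' v" "\<And>w. E v w \<Longrightarrow> ?f E w = ?f E' w"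
      "\<And>w z. E v w \<Longrightarrow> E w z \<Longrightarrow> ?f E z = ?f E' z"
    have eq: "iter \<eta> E i x = iter \<eta> E' i x" if "?f E x = ?f E' x" "i < T" for x i
      using that(1) fun_cong[of "\<lambda>i. if i < T then iter \<eta> E i x else 0" _ i] that(2) by simp
    have r: "constraints E v = constraints E' v" using a(1) by simp
    have near: "iter \<eta> E i x = iter \<eta> E' i x" if "x = v \<or> E v x \<or> (\<exists>w. E v w \<and> E w x)" "i < T" for x i
    proof -
      define F where "F = ?f"
      have "F E v = F E' v" "\<And>w. E v w \<Longrightarrow> F E w = F E' w" "\<And>w z. E v w \<Longrightarrow> E w z \<Longrightarrow> F E z = F E' z"
        unfolding F_def by (fact a)+
      then have "F E x = F E' x" using that(1) by blast
      then show ?thesis unfolding F_def by (rule eq[OF _ that(2)])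
    qed
    have s: "sum (iter \<eta> E i) C = sum (iter \<eta> E' i) C" if "C \<in> constraints E v" "i < T" for C i
      by (rule sum.cong[OF refl]) (use constraints_near[OF that(1)] near that(2) in blast)
    show "sol \<eta> T E v = sol \<eta> T E' v"
      unfolding sol_def r[symmetric] using near s
      by (intro arg_cong2[where f = "(/)"] sum.cong arg_cong2[where f = "(+)"]) auto
  qed
  then show ?thesis by simp
qed

lemma local_chosen: "local_rule (22 + 2 * T) (chosen \<eta> T)"
proof -
  have "local_rule (max (max 2 8) (20 + 2 * T) + 2) (chosen \<eta> T)"
    by (rule local_rule_step[OF local_rule_Pair[OF local_rule_Pair[OF local_hub local_rest] local_sol[of T \<eta>]]])
      (auto simp: chosen_def)
  then show ?thesis by simp
qed

lemma local_output_local_rule: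
  assumes "local_rule r f"
  shows "local_output (\<lambda>_. f) (Suc r) V E = {v \<in> V. f E v}"
proof -
  have "agree r v E (\<lambda>x y. x \<in> nbhd E (Suc r) v \<and> y \<in> nbhd E (Suc r) v \<and> E x y)" for v
    by (auto simp: agree_def)
  then have "f (\<lambda>x y. x \<in> nbhd E (Suc r) v \<and> y \<in> nbhd E (Suc r) v \<and> E x y) v = f E v" for v
    by (rule local_ruleD[OF assms, symmetric])
  then show ?thesis unfolding local_output_def by simp
qed

section \<open>Analysis of the algorithm\<close>

context tf_planar
begin

lemma not_hubE:
  assumes "\<not> hub E v"
  obtains A where "A \<subseteq> V" "finite A" "card A \<le> 17" "v \<notin> A" "\<And>w. E v w \<Longrightarrow> w \<in> A \<or> (\<exists>a\<in>A. E a w)"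
proof -
  obtain A where A: "A \<subseteq> {a. \<exists>w. E v w \<and> (a = w \<or> E w a)} - {v}" "finite A" "card A \<le> 17"
     "\<forall>w. E v w \<longrightarrow> w \<in> A \<or> (\<exists>a\<in>A. E w a)"
    using assms unfolding hub_def by blast
  show ?thesis by (rule that[of A]) (use A E_V E_sym in blast)+
qed

lemma fat_sym: "z \<in> fat E u \<Longrightarrow> u \<in> fat E z"
proof -
  assume z: "z \<in> fat E u"
  have "{w. E u w \<and> E w z \<and> free E w} = {w. E z w \<and> E w u \<and> free E w}" using E_sym by blast
  then show ?thesis using z by (simp add: fat_def)
qed

lemma fat_V: "z \<in> fat E u \<Longrightarrow> u \<in> V \<and> z \<in> V \<and> u \<noteq> z \<and> \<not> hub E u"
  using fat_common[of z E u] E_V E_sym by (fastforce simp: fat_def free_def)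

text \<open>Each \<open>a\<close> in \<open>A\<close> differs from \<open>u\<close> and
  \<open>z\<close>, so by \<open>no_K37\<close> it accounts for at most 6 vertices of
  \<open>Y\<close> besides possibly itself.\<close>

lemma common_neighbours_cover:
  assumes "u \<in> V" "z \<in> V" "u \<noteq> z" "A \<subseteq> V" "u \<notin> A" "z \<notin> A" "finite A"
    and Y: "Y \<subseteq> {w. E u w \<and> E w z}" "\<And>w. w \<in> Y \<Longrightarrow> w \<in> A \<or> (\<exists>a\<in>A. E a w)"
  shows "card Y \<le> 7 * card A"
proof -
  have fY: "finite {w. E u w \<and> E z w \<and> E a w}" for a
    by (rule finite_subset[OF _ finite_N[of u]]) auto
  have "Y \<subseteq> (\<Union>a\<in>A. insert a {w. E u w \<and> E z w \<and> E a w})"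
  proof
    fix w assume "w \<in> Y"
    then have "E u w" "E z w" "w \<in> A \<or> (\<exists>a\<in>A. E a w)" using Y E_sym[of w z] by auto
    then show "w \<in> (\<Union>a\<in>A. insert a {w. E u w \<and> E z w \<and> E a w})" by blast
  qed
  then have "card Y \<le> card (\<Union>a\<in>A. insert a {w. E u w \<and> E z w \<and> E a w})"
    using assms(7) fY by (intro card_mono) auto
  also have "\<dots> \<le> (\<Sum>a\<in>A. card (insert a {w. E u w \<and> E z w \<and> E a w}))"
    by (rule card_UN_le[OF assms(7)])
  also have "\<dots> \<le> (\<Sum>a\<in>A. 7)"
  proof (rule sum_mono)
    fix a assume "a \<in> A"
    then have "card {w. E u w \<and> E z w \<and> E a w} \<le> 6"
      using assms by (intro no_K37) auto
    then show "card (insert a {w. E u w \<and> E z w \<and> E a w}) \<le> 7"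
      using card_insert_le_m1[of 7 "{w. E u w \<and> E z w \<and> E a w}" a] by simp
  qed
  finally show ?thesis by simp
qed

text \<open>The witness \<open>A\<close> that \<open>u\<close> is no hub dominates all neighbours of
  \<open>u\<close>. For a fat partner outside \<open>A\<close> it would cover at least 294 common
  neighbours, but it can cover at most 7 * 17 = 119.\<close>

lemma fat_degree: "finite (fat E u) \<and> card (fat E u) \<le> 17"
proof (cases "fat E u = {}")
  case False
  then have u: "u \<in> V" "\<not> hub E u" using fat_V by auto
  obtain A where A: "A \<subseteq> V" "finite A" "card A \<le> 17" "u \<notin> A" "\<And>w. E u w \<Longrightarrow> w \<in> A \<or> (\<exists>a\<in>A. E a w)"
    using not_hubE[OF u(2)] by metis
  have "fat E u \<subseteq> A"
  proof
    fix z assume z: "z \<in> fat E u"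
    show "z \<in> A"
    proof (rule ccontr)
      assume "z \<notin> A"
      then have "card {w. E u w \<and> E w z \<and> free E w} \<le> 7 * card A"
        using fat_V[OF z] A by (intro common_neighbours_cover[of u z]) auto
      then show False using z A(3) by (simp add: fat_def)
    qed
  qed
  then show ?thesis using A card_mono finite_subset by (metis le_trans)
qed auto

text \<open>The residual neighbours are sorted by a dominator \<open>a\<close> among at most 17. If
  \<open>a\<close> is a fat partner of \<open>w\<close>, no common neighbour is residual; otherwise
  at most 293 are. With \<open>a\<close> itself this makes 17 * 294.\<close>

lemma rest_degree:
  assumes "\<not> hub E w"
  shows "card {u. E w u \<and> rest E u} \<le> 4998"
proof -
  obtain A where A: "A \<subseteq> V" "finite A" "card A \<le> 17" "w \<notin> A" "\<And>u. E w u \<Longrightarrow> u \<in> A \<or> (\<exists>a\<in>A. E a u)"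
    using not_hubE[OF assms] by metis
  let ?Y = "\<lambda>a. {u. E w u \<and> E u a \<and> rest E u}"
  have fY: "finite (?Y a)" for a by (rule finite_subset[OF _ finite_N[of w]]) auto
  have "{u. E w u \<and> rest E u} \<subseteq> (\<Union>a\<in>A. insert a (?Y a))"
  proof
    fix u assume "u \<in> {u. E w u \<and> rest E u}"
    then have "E w u" "rest E u" "u \<in> A \<or> (\<exists>a\<in>A. E u a)" using A(5)[of u] E_sym[of _ u] by auto
    then show "u \<in> (\<Union>a\<in>A. insert a (?Y a))" by blast
  qed
  then have "card {u. E w u \<and> rest E u} \<le> card (\<Union>a\<in>A. insert a (?Y a))"
    using A(2) fY by (intro card_mono) auto
  also have "\<dots> \<le> (\<Sum>a\<in>A. card (insert a (?Y a)))" by (rule card_UN_le[OF A(2)])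
  also have "\<dots> \<le> (\<Sum>a\<in>A. 294)"
  proof (rule sum_mono)
    fix a assume a: "a \<in> A"
    have "card (?Y a) \<le> 293"
    proof (cases "a \<in> fat E w")
      case True
      then have "?Y a = {}" using E_sym unfolding rest_def by blast
      then show ?thesis by (simp only: card.empty)
    next
      case False
      have "card (?Y a) \<le> card {u. E w u \<and> E u a \<and> free E u}"
        by (intro card_mono finite_subset[OF _ finite_N[of w]]) (auto simp: rest_def)
      moreover have "a \<noteq> w" using a A(4) by auto
      ultimately show ?thesis using False by (simp add: fat_def)
    qed
    then show "card (insert a (?Y a)) \<le> 294" using card_insert_le_m1[of 294 "?Y a" a] by simp
  qed
  also have "\<dots> \<le> 17 * 294" using A(3) by simp
  finally show ?thesis by simp
qed

lemma footprint_props: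
  shows "finite (footprint E w)" "card (footprint E w) \<le> 4999"
    "w \<in> V \<Longrightarrow> footprint E w \<subseteq> V"
    "u \<in> footprint E w \<Longrightarrow> \<not> hub E w" "u \<in> footprint E w \<Longrightarrow> u \<in> V \<Longrightarrow> w \<in> V"
proof -
  have sub: "footprint E w \<subseteq> insert w {u. E w u \<and> rest E u}" by (auto simp: footprint_def)
  have fin: "finite {u. E w u \<and> rest E u}" by (rule finite_subset[OF _ finite_N[of w]]) auto
  show "finite (footprint E w)" using sub fin finite_subset by blast
  show nh: "\<not> hub E w" if "u \<in> footprint E w" for u
    using that E_sym by (auto simp: footprint_def rest_def free_def)
  show "card (footprint E w) \<le> 4999"
  proof (cases "footprint E w = {}")
    case False
    then have "\<not> hub E w" using nh by auto
    have "card (footprint E w) \<le> card (insert w {u. E w u \<and> rest E u})"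
      using sub fin by (intro card_mono) auto
    also have "\<dots> \<le> 4999"
      using rest_degree[OF \<open>\<not> hub E w\<close>] card_insert_le_m1[of 4999 "{u. E w u \<and> rest E u}" w] by simp
    finally show ?thesis .
  qed auto
  show "w \<in> V \<Longrightarrow> footprint E w \<subseteq> V" "u \<in> footprint E w \<Longrightarrow> u \<in> V \<Longrightarrow> w \<in> V"
    using E_V by (auto simp: footprint_def)
qed

section \<open>The covering program and the number of its variables\<close>

definition S where "S = {w \<in> V. var E w}"
definition R1 where "R1 = {u \<in> V. rest E u}"
definition R where "R = star E ` R1 \<union> {{u, z} |u z. z \<in> fat E u}"

lemma finite_S: "finite S" and finite_R1: "finite R1"
  using finite_V by (auto simp: S_def R1_def)

lemma R_subset_S: "C \<in> R \<Longrightarrow> C \<subseteq> S"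
proof -
  have "{u, z} \<subseteq> S" if "z \<in> fat E u" for u z
    using that fat_sym[OF that] fat_V[OF that] by (auto simp: S_def var_def)
  moreover have "star E u \<subseteq> S" if "u \<in> R1" for u
    using that E_V by (auto simp: S_def R1_def star_def)
  ultimately show "C \<in> R \<Longrightarrow> C \<subseteq> S" unfolding R_def by blast
qed

lemma finite_R: "finite R"
  by (rule finite_subset[of _ "Pow S"]) (use R_subset_S finite_S in auto)

text \<open>A star row contains the variable \<open>w\<close> exactly when its centre lies in the
  footprint of \<open>w\<close>, and pair rows are symmetric by \<open>fat_sym\<close>. This
  identifies the local recursion \<open>iter\<close> with the global descent of
  \<open>covering_descent\<close>.\<close>

lemma constraints_eq: "w \<in> S \<Longrightarrow> constraints E w = {C \<in> R. w \<in> C}"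
proof
  assume w: "w \<in> S"
  then have wV: "w \<in> V" "var E w" by (auto simp: S_def)
  show "constraints E w \<subseteq> {C \<in> R. w \<in> C}"
  proof
    fix C assume "C \<in> constraints E w"
    then consider u where "u \<in> footprint E w" "C = star E u" | z where "z \<in> fat E w" "C = {w, z}"
      by (auto simp: constraints_def)
    then show "C \<in> {C \<in> R. w \<in> C}"
    proof cases
      case 1
      have "u \<in> R1" using 1 footprint_props(3)[OF wV(1)] by (auto simp: R1_def footprint_def)
      moreover have "w \<in> star E u" using 1 wV E_sym by (auto simp: star_def footprint_def)
      ultimately show ?thesis using 1 by (auto simp: R_def)
    next
      case 2
      then show ?thesis unfolding R_def by blast
    qed
  qed
  show "{C \<in> R. w \<in> C} \<subseteq> constraints E w"
  proof
    fix C assume "C \<in> {C \<in> R. w \<in> C}"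
    then have C: "C \<in> R" "w \<in> C" by auto
    then consider u where "u \<in> R1" "C = star E u" | u z where "z \<in> fat E u" "C = {u, z}"
      unfolding R_def by blast
    then show "C \<in> constraints E w"
    proof cases
      case 1
      have "u \<in> footprint E w" using 1 C(2) E_sym by (auto simp: R1_def footprint_def star_def)
      then show ?thesis using 1 by (auto simp: constraints_def)
    next
      case 2
      then have "w = u \<or> w = z" using C(2) by auto
      then show ?thesis using 2 fat_sym[OF 2(1)] unfolding constraints_def by (auto simp: insert_commute)
    qed
  qed
qed

lemma constraints_degree: "w \<in> S \<Longrightarrow> card {C \<in> R. w \<in> C} \<le> 5016"
proof -
  assume "w \<in> S"
  have "card (constraints E w) \<le> card (star E ` footprint E w) + card ((\<lambda>z. {w, z}) ` fat E w)"
    unfolding constraints_def by (rule card_Un_le)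
  also have "\<dots> \<le> card (footprint E w) + card (fat E w)"
    by (intro add_mono card_image_le) (use footprint_props fat_degree in auto)
  also have "\<dots> \<le> 4999 + 17" by (intro add_mono footprint_props) (use fat_degree in auto)
  finally show ?thesis using constraints_eq[OF \<open>w \<in> S\<close>] by simp
qed

lemma rep_exists:
  assumes "footprint E w \<noteq> {}"
  obtains r where "rep E r" "footprint E r = footprint E w"
proof -
  define r where "r = (LEAST w'. footprint E w' = footprint E w)"
  have r: "footprint E r = footprint E w" unfolding r_def by (rule LeastI[of _ w]) simp
  have "r \<le> w'" if "footprint E w' = footprint E r" for w'
    unfolding r_def by (rule Least_le) (use that r in simp)
  then have "rep E r" using assms r by (auto simp: rep_def)
  then show ?thesis using that r by blast
qed

lemma star_nonempty: "u \<in> R1 \<Longrightarrow> star E u \<noteq> {}"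
proof -
  assume "u \<in> R1"
  then have u: "u \<in> footprint E u" by (auto simp: R1_def footprint_def)
  then obtain r where r: "rep E r" "footprint E r = footprint E u" using rep_exists by blast
  then have "u \<in> footprint E r" using u by simp
  then have "r = u \<or> E u r" using E_sym by (auto simp: footprint_def)
  then show ?thesis using r by (auto simp: star_def var_def)
qed

lemma R_nonempty: "C \<in> R \<Longrightarrow> C \<noteq> {} \<and> finite C"
proof -
  assume C: "C \<in> R"
  then have "finite C" using R_subset_S finite_S finite_subset by blast
  moreover have "C \<noteq> {}" using C star_nonempty unfolding R_def by blast
  ultimately show ?thesis by blast
qed

definition Rep where "Rep = {w \<in> V. rep E w}"

text \<open>Equal nonempty footprints share a centre \<open>u\<close>, and both vertices lie in its
  closed neighbourhood; so each is among the candidates with which the other is compared.\<close>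

lemma inj_footprint: "inj_on (footprint E) Rep"
proof (rule inj_onI)
  fix w w' assume w: "w \<in> Rep" "w' \<in> Rep" "footprint E w = footprint E w'"
  then obtain u where u: "u \<in> footprint E w" by (auto simp: Rep_def rep_def)
  have 1: "w = u \<or> E u w" using u E_sym by (auto simp: footprint_def)
  have 2: "w' = u \<or> E u w'" using footprint_near[of u E w'] u w(3) E_sym by auto
  have "w \<le> w'" using w u 2 unfolding Rep_def rep_def by auto
  moreover have "w' \<le> w" using w u 1 unfolding Rep_def rep_def by auto
  ultimately show "w = w'" by simp
qed

text \<open>Representatives have different footprints and are sorted by footprint size. In units of
  \<open>card R1\<close>, those inside \<open>R1\<close> contribute 1, singletons 1, sizes at least
  three 2, by the bipartite bound 3 * q \<le> 2 * (q + r), and pairs 8.\<close>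

lemma Rep_bound: "card Rep \<le> 12 * card R1"
proof -
  have fRep: "finite Rep" using finite_V by (auto simp: Rep_def)
  define Q where "Q = Rep - R1"
  have fQ: "finite Q" using fRep by (auto simp: Q_def)
  have tr: "footprint E w = {u \<in> R1. E w u}" if "w \<in> Q" for w
    using that E_V by (auto simp: Q_def R1_def footprint_def Rep_def)
  have injQ: "inj_on (footprint E) T" if "T \<subseteq> Q" for T
    using inj_footprint that by (auto simp: Q_def intro: inj_on_subset)
  define Q1 where "Q1 = {w \<in> Q. card (footprint E w) = 1}"
  define Q2 where "Q2 = {w \<in> Q. card (footprint E w) = 2}"
  define Q3 where "Q3 = {w \<in> Q. card (footprint E w) \<ge> 3}"
  have fQs: "finite Q1" "finite Q2" "finite Q3" using fQ by (auto simp: Q1_def Q2_def Q3_def)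
  have "card (footprint E w) \<noteq> 0" if "w \<in> Q" for w
    using that footprint_props(1)[of w] by (auto simp: Q_def Rep_def rep_def)
  then have "Rep \<subseteq> R1 \<union> Q1 \<union> Q2 \<union> Q3"
    by (force simp: Q_def Q1_def Q2_def Q3_def)
  then have "card Rep \<le> card (R1 \<union> Q1 \<union> Q2 \<union> Q3)"
    using finite_R1 fQs by (intro card_mono) auto
  also have "\<dots> \<le> card R1 + card Q1 + card Q2 + card Q3"
    by (intro order_trans[OF card_Un_le] add_mono order.refl)
  finally have 0: "card Rep \<le> card R1 + card Q1 + card Q2 + card Q3" .
  have 1: "card Q1 \<le> card R1"
  proof -
    have "footprint E ` Q1 \<subseteq> (\<lambda>u. {u}) ` R1"
      using tr by (auto simp: Q1_def card_1_singleton_iff)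
    then have "card (footprint E ` Q1) \<le> card ((\<lambda>u. {u}) ` R1)"
      using finite_R1 by (intro card_mono) auto
    also have "\<dots> \<le> card R1" using finite_R1 by (rule card_image_le)
    finally show ?thesis using injQ[of Q1] by (simp add: card_image Q1_def)
  qed
  have 3: "card Q3 \<le> 2 * card R1"
  proof -
    have "3 * card Q3 = (\<Sum>w\<in>Q3. 3)" by simp
    also have "\<dots> \<le> (\<Sum>w\<in>Q3. card {u \<in> R1. E w u})"
      using tr by (intro sum_mono) (auto simp: Q3_def)
    also have "\<dots> = card (SIGMA w:Q3. {u \<in> R1. E w u})" using fQs finite_R1 by simp
    also have "(SIGMA w:Q3. {u \<in> R1. E w u}) = {(a, b). a \<in> Q3 \<and> b \<in> R1 \<and> E a b}" by auto
    also have "card \<dots> \<le> 2 * (card Q3 + card R1)"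
      by (rule bip_bound) (auto simp: Q3_def Q_def R1_def Rep_def)
    finally show ?thesis by simp
  qed
  have 2: "card Q2 \<le> 8 * card R1"
  proof -
    define P where "P = (\<lambda>u v. u \<noteq> v \<and> (\<exists>w\<in>Q2. footprint E w = {u, v}))"
    have Psym: "P u v \<Longrightarrow> P v u" "\<not> P v v" for u v by (auto simp: P_def insert_commute)
    \<comment> \<open>Replacing each representative of a pair by an edge gives a planar graph on
      \<open>R1\<close> that may contain triangles. A cut makes it bipartite, so the factor 2
      applies, at the price of a further 4.\<close>
    obtain A where A: "A \<subseteq> R1" "card {(u, v). u \<in> R1 \<and> v \<in> R1 \<and> P u v} \<le> 4 * card {(u, v). u \<in> A \<and> v \<in> R1 - A \<and> P u v}"
      using max_cut[OF finite_R1, of P] Psym by blast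
    define M where "M = {(u, v). u \<in> A \<and> v \<in> R1 - A \<and> P u v}"
    define wf where "wf = (\<lambda>(u, v). SOME w. w \<in> Q2 \<and> footprint E w = {u, v})"
    have wf: "wf (u, v) \<in> Q2 \<and> footprint E (wf (u, v)) = {u, v}" if "(u, v) \<in> M" for u v
      using that someI_ex[of "\<lambda>w. w \<in> Q2 \<and> footprint E w = {u, v}"] unfolding M_def P_def wf_def by auto
    have "card M \<le> 2 * (card A + card (R1 - A))"
    proof (rule subdivided_bip_bound[where w = wf])
      show "A \<subseteq> V" "R1 - A \<subseteq> V" "A \<inter> (R1 - A) = {}" using A by (auto simp: R1_def)
      show "M \<subseteq> A \<times> (R1 - A)" by (auto simp: M_def)
      show "inj_on wf M"
      proof (rule inj_onI)
        fix x y assume xy: "x \<in> M" "y \<in> M" "wf x = wf y"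
        obtain a b c d where ab: "x = (a, b)" "y = (c, d)" by fastforce
        then have "{a, b} = {c, d}" using xy wf[of a b] wf[of c d] by metis
        moreover have "a \<in> A" "c \<in> A" "b \<notin> A" "d \<notin> A" using xy ab by (auto simp: M_def)
        ultimately show "x = y" using ab by (auto simp: doubleton_eq_iff)
      qed
      fix a b assume "(a, b) \<in> M"
      from wf[OF this] have w: "wf (a, b) \<in> Q" "footprint E (wf (a, b)) = {a, b}" by (auto simp: Q2_def)
      then have "E (wf (a, b)) a" "E (wf (a, b)) b" using tr[OF w(1)] by auto
      then show "wf (a, b) \<notin> A \<union> (R1 - A) \<and> E a (wf (a, b)) \<and> E (wf (a, b)) b"
        using w(1) A(1) E_sym by (auto simp: Q_def)
    qed
    moreover have "card A + card (R1 - A) = card R1"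
      using A(1) finite_R1 card_mono[OF finite_R1 A(1)] finite_subset[OF A(1)] by (simp add: card_Diff_subset)
    ultimately have le: "card {(u, v). u \<in> R1 \<and> v \<in> R1 \<and> P u v} \<le> 8 * card R1"
      using A(2) by (simp add: M_def)
    have fin: "finite {(u, v). u \<in> R1 \<and> v \<in> R1 \<and> P u v}"
      by (rule finite_subset[of _ "R1 \<times> R1"]) (use finite_R1 in auto)
    have "footprint E ` Q2 \<subseteq> (\<lambda>(u, v). {u, v}) ` {(u, v). u \<in> R1 \<and> v \<in> R1 \<and> P u v}"
    proof
      fix X assume "X \<in> footprint E ` Q2"
      then obtain w where w: "w \<in> Q2" "X = footprint E w" by auto
      then have "card X = 2" by (auto simp: Q2_def)
      then obtain u v where uv: "X = {u, v}" "u \<noteq> v" by (auto simp: card_2_iff)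
      have "X \<subseteq> R1" using tr[of w] w by (auto simp: Q2_def)
      then have "(u, v) \<in> {(u, v). u \<in> R1 \<and> v \<in> R1 \<and> P u v}" using uv w by (auto simp: P_def)
      then show "X \<in> (\<lambda>(u, v). {u, v}) ` {(u, v). u \<in> R1 \<and> v \<in> R1 \<and> P u v}"
        using uv(1) by (intro image_eqI[where x = "(u, v)"]) auto
    qed
    then have "card (footprint E ` Q2) \<le> card ((\<lambda>(u, v). {u, v}) ` {(u, v). u \<in> R1 \<and> v \<in> R1 \<and> P u v})"
      using fin by (intro card_mono) auto
    also have "\<dots> \<le> card {(u, v). u \<in> R1 \<and> v \<in> R1 \<and> P u v}" by (rule card_image_le[OF fin])
    finally show ?thesis using le injQ[of Q2] by (simp add: card_image Q2_def)
  qed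
  show ?thesis using 0 1 2 3 by simp
qed

end

section \<open>Comparison with a dominating set\<close>

locale tf_planar_dominated = tf_planar V E for V E +
  fixes D :: "nat set" and dm :: "nat \<Rightarrow> nat"
  assumes D_V: "D \<subseteq> V" and dm: "v \<in> V \<Longrightarrow> dm v \<in> D \<and> (dm v = v \<or> E v (dm v))"
begin

lemma finite_D: "finite D"
  using D_V finite_V finite_subset by auto

text \<open>The dominators of the neighbours of \<open>v\<close> do not include \<open>v\<close>,
  which lies outside \<open>D\<close>; if there were at most 17 of them, they would witness that
  \<open>v\<close> is no hub. For h such hubs this yields 18 * h \<le> 12 * h + 6 * |D|.\<close>

lemma hub_outside_D: "card {v \<in> V - D. hub E v} \<le> card D"
proof -
  have "18 \<le> card (dm ` {w. E v w})" if v: "v \<in> {v \<in> V - D. hub E v}" for v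
  proof (rule ccontr)
    assume "\<not> ?thesis"
    then have le: "card (dm ` {w. E v w}) \<le> 17" by simp
    have dw: "dm w \<in> D \<and> (dm w = w \<or> E w (dm w))" if "E v w" for w
      using dm[of w] E_V[OF that] by auto
    have near: "dm ` {w. E v w} \<subseteq> {a. \<exists>w. E v w \<and> (a = w \<or> E w a)} - {v}"
      using dw v by blast
    have "w \<in> dm ` {w. E v w} \<or> (\<exists>a\<in>dm ` {w. E v w}. E w a)" if "E v w" for w
      using dw[OF that] that by force
    then have "\<not> hub E v"
      unfolding hub_def not_not using finite_N[of v] le near
      by (intro exI[of _ "dm ` {w. E v w}"] conjI allI impI finite_imageI)
    then show False using v by auto
  qed
  then have "18 * card {v \<in> V - D. hub E v} \<le> 12 * card {v \<in> V - D. hub E v} + 6 * card D"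
    using dm by (intro widely_dominated_bound[OF D_V, of dm]) auto
  then show ?thesis by simp
qed

definition X2 where "X2 = {v \<in> V - D. fat E v \<noteq> {} \<and> 42 \<le> card (dm ` {w. E v w})}"

lemma X2_bound: "5 * card X2 \<le> card D"
proof -
  have "42 * card X2 \<le> 12 * card X2 + 6 * card D"
    using dm by (intro widely_dominated_bound[OF D_V, of dm]) (auto simp: X2_def)
  then show ?thesis by simp
qed

text \<open>If \<open>D\<close> avoids both ends, so do the dominators of the common neighbours.
  Each accounts for at most 7 of at least 294, so there are at least 42 of them, which puts
  \<open>u\<close> into \<open>X2\<close>.\<close>

lemma fat_hit: assumes "z \<in> fat E u" shows "u \<in> D \<or> z \<in> D \<or> u \<in> X2"
proof (rule ccontr)
  assume *: "\<not> ?thesis"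
  let ?Y = "{w. E u w \<and> E w z \<and> free E w}"
  have "294 \<le> card ?Y" using assms by (simp add: fat_def)
  also have "card ?Y \<le> 7 * card (dm ` {w. E u w})"
  proof (rule common_neighbours_cover[of u z])
    have dw: "dm w \<in> D \<and> (dm w = w \<or> E w (dm w))" if "E u w" for w
      using dm[of w] E_V[OF that] by auto
    show "dm ` {w. E u w} \<subseteq> V" using dw D_V by blast
    show "u \<notin> dm ` {w. E u w}" "z \<notin> dm ` {w. E u w}" using dw * by blast+
    show "w \<in> dm ` {w. E u w} \<or> (\<exists>a\<in>dm ` {w. E u w}. E a w)" if "w \<in> ?Y" for w
      using that dw[of w] E_sym[of w "dm w"] by force
  qed (use fat_V[OF assms] finite_N in auto)
  finally have "42 \<le> card (dm ` {w. E u w})" by simp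
  then show False using * fat_V[OF assms] assms by (auto simp: X2_def)
qed

text \<open>By \<open>fat_hit\<close> such a vertex lies in \<open>D\<close>, or is one of the at
  most 17 fat partners of a vertex of \<open>D\<close>, or lies in \<open>X2\<close>; the last case
  adds at most \<open>card D / 5\<close> to \<open>18 * card D\<close>.\<close>

lemma fat_vertices_bound: "card {u \<in> V. fat E u \<noteq> {}} \<le> 19 * card D"
proof -
  have "{u \<in> V. fat E u \<noteq> {}} \<subseteq> (\<Union>d\<in>D. insert d (fat E d)) \<union> X2"
  proof
    fix u assume "u \<in> {u \<in> V. fat E u \<noteq> {}}"
    then obtain z where z: "z \<in> fat E u" by auto
    then show "u \<in> (\<Union>d\<in>D. insert d (fat E d)) \<union> X2" using fat_hit[OF z] fat_sym[OF z] by blast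
  qed
  moreover have fX2: "finite X2" using finite_V by (auto simp: X2_def)
  ultimately have "card {u \<in> V. fat E u \<noteq> {}} \<le> card ((\<Union>d\<in>D. insert d (fat E d)) \<union> X2)"
    using finite_D fat_degree by (intro card_mono) auto
  also have "\<dots> \<le> card (\<Union>d\<in>D. insert d (fat E d)) + card X2" by (rule card_Un_le)
  also have "card (\<Union>d\<in>D. insert d (fat E d)) \<le> (\<Sum>d\<in>D. card (insert d (fat E d)))"
    by (rule card_UN_le[OF finite_D])
  also have "\<dots> \<le> (\<Sum>d\<in>D. 18)"
  proof (rule sum_mono)
    show "card (insert d (fat E d)) \<le> 18" for d
      using fat_degree[of d] card_insert_le_m1[of 18 "fat E d" d] by simp
  qed
  finally show ?thesis using X2_bound by simp
qed

lemma R1_bound: "card R1 \<le> 4999 * card D"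
proof -
  have "R1 \<subseteq> (\<Union>d\<in>D. footprint E d)"
  proof
    fix u assume "u \<in> R1"
    then have u: "u \<in> V" "rest E u" by (auto simp: R1_def)
    then have "u \<in> footprint E (dm u)" using dm[OF u(1)] E_sym[of u "dm u"] by (auto simp: footprint_def)
    then show "u \<in> (\<Union>d\<in>D. footprint E d)" using dm[OF u(1)] by blast
  qed
  then have "card R1 \<le> card (\<Union>d\<in>D. footprint E d)"
    using finite_D footprint_props(1) by (intro card_mono) auto
  also have "\<dots> \<le> (\<Sum>d\<in>D. card (footprint E d))" by (rule card_UN_le[OF finite_D])
  also have "\<dots> \<le> (\<Sum>d\<in>D. 4999)" by (intro sum_mono footprint_props)
  finally show ?thesis by simp
qed

text \<open>19 for the vertices of fat pairs and 12 * 4999 for the representatives.\<close>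

lemma S_bound: "card S \<le> 60007 * card D"
proof -
  have "S \<subseteq> {u \<in> V. fat E u \<noteq> {}} \<union> Rep" by (auto simp: S_def var_def Rep_def)
  then have "card S \<le> card ({u \<in> V. fat E u \<noteq> {}} \<union> Rep)"
    using finite_V by (intro card_mono) (auto simp: Rep_def)
  also have "\<dots> \<le> card {u \<in> V. fat E u \<noteq> {}} + card Rep" by (rule card_Un_le)
  finally show ?thesis using fat_vertices_bound Rep_bound R1_bound by linarith
qed

text \<open>An integral solution built from \<open>D\<close>. Its hubs can be left out, because the
  dominator of a residual vertex and the ends of a fat pair are never hubs. A vertex in no fat pair
  passes its role to the representative of its column, and \<open>X2\<close> serves the pairs missed
  by \<open>D\<close>.\<close>

lemma cheap_cover:
  obtains Y where "Y \<subseteq> S" "\<And>C. C \<in> R \<Longrightarrow> C \<inter> Y \<noteq> {}"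
    "card Y \<le> card {d \<in> D. \<not> hub E d} + card X2"
proof -
  define repr where "repr = (\<lambda>w. SOME r. rep E r \<and> footprint E r = footprint E w)"
  have repr: "rep E (repr w) \<and> footprint E (repr w) = footprint E w" if "footprint E w \<noteq> {}" for w
    unfolding repr_def by (rule someI_ex) (use rep_exists[OF that] in blast)
  define \<rho> where "\<rho> = (\<lambda>d. if fat E d \<noteq> {} then d else repr d)"
  define D' where "D' = {d \<in> D. \<not> hub E d \<and> (fat E d \<noteq> {} \<or> footprint E d \<noteq> {})}"
  define Y where "Y = \<rho> ` D' \<union> X2"
  have fD': "finite D'" using finite_D by (auto simp: D'_def)
  show ?thesis
  proof (rule that[of Y])
    show "Y \<subseteq> S"
    proof
      fix y assume "y \<in> Y"
      then consider "y \<in> X2" | d where "d \<in> D'" "fat E d \<noteq> {}" "y = d"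
        | d where "d \<in> D'" "fat E d = {}" "y = repr d"
        by (auto simp: Y_def \<rho>_def split: if_splits)
      then show "y \<in> S"
      proof cases
        case 3
        then have ne: "footprint E d \<noteq> {}" by (auto simp: D'_def)
        then obtain u where u: "u \<in> footprint E d" by auto
        have "d \<in> V" using 3 D_V by (auto simp: D'_def)
        then have "u \<in> V" using footprint_props(3) u by blast
        moreover have "u \<in> footprint E (repr d)" using repr[OF ne] u by simp
        ultimately have "repr d \<in> V" using footprint_props(5) by blast
        then show ?thesis using repr[OF ne] 3 by (auto simp: S_def var_def)
      qed (use D_V in \<open>auto simp: X2_def S_def var_def D'_def\<close>)
    qed
    show "card Y \<le> card {d \<in> D. \<not> hub E d} + card X2"
    proof -
      have "card Y \<le> card (\<rho> ` D') + card X2" unfolding Y_def by (rule card_Un_le)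
      also have "card (\<rho> ` D') \<le> card D'" by (rule card_image_le[OF fD'])
      also have "card D' \<le> card {d \<in> D. \<not> hub E d}"
        using finite_D by (intro card_mono) (auto simp: D'_def)
      finally show ?thesis by simp
    qed
    fix C assume "C \<in> R"
    then consider u where "u \<in> R1" "C = star E u" | u z where "z \<in> fat E u" "C = {u, z}"
      unfolding R_def by blast
    then show "C \<inter> Y \<noteq> {}"
    proof cases
      case 1
      then have u: "u \<in> V" "rest E u" by (auto simp: R1_def)
      let ?d = "dm u"
      have d: "?d \<in> D" "?d = u \<or> E u ?d" using dm[OF u(1)] by auto
      have fp: "u \<in> footprint E ?d" using d u E_sym[of u ?d] by (auto simp: footprint_def)
      then have "\<not> hub E ?d" using footprint_props(4) by blast
      then have "?d \<in> D'" using d fp by (auto simp: D'_def)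
      then have "\<rho> ?d \<in> Y" by (auto simp: Y_def)
      moreover have "\<rho> ?d \<in> star E u"
      proof (cases "fat E ?d = {}")
        case True
        have "rep E (repr ?d)" "u \<in> footprint E (repr ?d)" using repr[of ?d] fp by auto
        then show ?thesis using True footprint_near[of u E "repr ?d"] E_sym[of "repr ?d" u]
          by (auto simp: \<rho>_def star_def var_def)
      qed (use d in \<open>auto simp: \<rho>_def star_def var_def\<close>)
      ultimately show ?thesis using 1 by blast
    next
      case 2
      have "x \<in> Y" if "x \<in> D" "fat E x \<noteq> {}" for x
      proof -
        have "\<not> hub E x" using that(2) fat_V by blast
        then have "x \<in> D'" using that by (auto simp: D'_def)
        then show ?thesis using that(2) by (auto simp: Y_def \<rho>_def intro!: rev_image_eqI)
      qed
      then show ?thesis using fat_hit[OF 2(1)] fat_sym[OF 2(1)] 2 by (auto simp: Y_def)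
    qed
  qed
qed

section \<open>The averaged iterates and the final count\<close>

context
  fixes \<eta> :: real and T :: nat
  assumes \<eta>: "\<eta> > 0" and T: "T > 0"
begin

abbreviation "x \<equiv> iter \<eta> E"
abbreviation "xs \<equiv> sol \<eta> T E"
abbreviation "deficit i C \<equiv> max 0 (1 - sum (x i) C)"

lemma x_nonneg: "x i w \<ge> 0"
  by (induction i) auto

lemma x_zero: "\<not> var E w \<Longrightarrow> x i w = 0"
  by (cases i) auto

text \<open>For a vertex that is not a variable, \<open>constraints\<close> may list star rows not
  containing it. Rows consist of variables only, so none of them has that vertex as its
  minimum.\<close>

lemma constraints_Min: "w \<in> V \<Longrightarrow> {C \<in> constraints E w. Min C = w} = {C \<in> R. Min C = w}"
proof (cases "w \<in> S")
  case True
  have "w \<in> C" if "C \<in> R" "Min C = w" for C using that R_nonempty[of C] Min_in by metis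
  then show ?thesis using constraints_eq[OF True] by auto
next
  case False
  assume wV: "w \<in> V"
  then have nv: "\<not> var E w" using False by (auto simp: S_def)
  have "Min C \<noteq> w" if "C \<in> R" for C using that R_nonempty[of C] R_subset_S[of C] False Min_in by blast
  moreover have "C \<in> R" if CE: "C \<in> constraints E w" for C
  proof -
    have "fat E w = {}" using nv by (auto simp: var_def)
    then obtain u where "u \<in> footprint E w" "C = star E u" using CE by (auto simp: constraints_def)
    then show ?thesis using footprint_props(3)[OF wV] by (auto simp: R_def R1_def footprint_def)
  qed
  ultimately show ?thesis by blast
qed

lemma xs_eq: "w \<in> V \<Longrightarrow> xs w = (\<Sum>i<T. x i w + (\<Sum>C\<in>{C \<in> R. Min C = w}. deficit i C)) / real T"
  by (simp only: sol_def constraints_Min)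

lemma xs_nonneg: "w \<in> V \<Longrightarrow> xs w \<ge> 0"
  using x_nonneg by (auto simp: xs_eq intro!: divide_nonneg_nonneg sum_nonneg add_nonneg_nonneg)

text \<open>Each deficit is charged to exactly one vertex, so the repaired average costs precisely
  the averaged penalty function that \<open>covering_descent\<close> bounds.\<close>

lemma sum_xs: "(\<Sum>w\<in>V. xs w) = (\<Sum>i<T. sum (x i) S + (\<Sum>C\<in>R. deficit i C)) / real T"
proof -
  have "(\<Sum>w\<in>V. xs w) = (\<Sum>w\<in>V. \<Sum>i<T. x i w + (\<Sum>C\<in>{C \<in> R. Min C = w}. deficit i C)) / real T"
    using xs_eq by (simp add: sum_divide_distrib)
  also have "(\<Sum>w\<in>V. \<Sum>i<T. x i w + (\<Sum>C\<in>{C \<in> R. Min C = w}. deficit i C))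
     = (\<Sum>i<T. \<Sum>w\<in>V. x i w + (\<Sum>C\<in>{C \<in> R. Min C = w}. deficit i C))" by (rule sum.swap)
  also have "\<dots> = (\<Sum>i<T. sum (x i) S + (\<Sum>C\<in>R. deficit i C))"
  proof (rule sum.cong[OF refl])
    fix i
    have "(\<Sum>w\<in>V. \<Sum>C\<in>{C \<in> R. Min C = w}. deficit i C) = (\<Sum>C\<in>R. deficit i C)"
    proof (rule sum.group[OF finite_R finite_V])
      show "Min ` R \<subseteq> V"
      proof
        fix m assume "m \<in> Min ` R"
        then obtain C where C: "C \<in> R" "m = Min C" by auto
        then have "m \<in> C" using R_nonempty[OF C(1)] Min_in by metis
        then show "m \<in> V" using R_subset_S[OF C(1)] by (auto simp: S_def)
      qed
    qed
    moreover have "sum (x i) V = sum (x i) S"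
      using finite_V x_zero by (intro sum.mono_neutral_right) (auto simp: S_def)
    ultimately show "(\<Sum>w\<in>V. x i w + (\<Sum>C\<in>{C \<in> R. Min C = w}. deficit i C)) = sum (x i) S + (\<Sum>C\<in>R. deficit i C)"
      by (simp add: sum.distrib)
  qed
  finally show ?thesis .
qed

text \<open>The deficit of an iterate on \<open>C\<close> is charged to \<open>Min C\<close>, which
  belongs to \<open>C\<close>; so every iterate satisfies the row once its charges are added, and
  the average inherits this.\<close>

lemma xs_feasible: assumes "C \<in> R" shows "sum xs C \<ge> 1"
proof -
  have C: "C \<noteq> {}" "finite C" "C \<subseteq> V" using R_nonempty[OF assms] R_subset_S[OF assms] by (auto simp: S_def)
  have one: "1 \<le> (\<Sum>w\<in>C. x i w + (\<Sum>C'\<in>{C' \<in> R. Min C' = w}. deficit i C'))" for i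
  proof -
    have nn: "0 \<le> (\<Sum>C'\<in>{C' \<in> R. Min C' = w}. deficit i C')" for w by (simp add: sum_nonneg)
    have "deficit i C \<le> (\<Sum>C'\<in>{C' \<in> R. Min C' = Min C}. deficit i C')"
      using assms finite_R by (intro member_le_sum) auto
    also have "\<dots> \<le> (\<Sum>w\<in>C. \<Sum>C'\<in>{C' \<in> R. Min C' = w}. deficit i C')"
      using C nn by (intro member_le_sum[of "Min C" C "\<lambda>w. \<Sum>C'\<in>{C' \<in> R. Min C' = w}. deficit i C'"]) auto
    finally show ?thesis by (simp add: sum.distrib)
  qed
  have "real T = (\<Sum>i<T. 1)" by simp
  also have "\<dots> \<le> (\<Sum>i<T. \<Sum>w\<in>C. x i w + (\<Sum>C'\<in>{C' \<in> R. Min C' = w}. deficit i C'))"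
    by (intro sum_mono one)
  also have "\<dots> = (\<Sum>w\<in>C. \<Sum>i<T. x i w + (\<Sum>C'\<in>{C' \<in> R. Min C' = w}. deficit i C'))" by (rule sum.swap)
  finally have "1 \<le> (\<Sum>w\<in>C. \<Sum>i<T. x i w + (\<Sum>C'\<in>{C' \<in> R. Min C' = w}. deficit i C')) / real T"
    using T by simp
  also have "\<dots> = sum xs C" using xs_eq C(3) by (simp add: sum_divide_distrib subset_iff)
  finally show ?thesis .
qed

text \<open>A vertex neither chosen nor next to a chosen one would be free, as all hubs are chosen,
  but not residual. It would thus see both ends of a fat pair, whose weights add up to at least 1
  and cannot both lie below 1/5.\<close>

lemma chosen_dominating: "dominating_set V E {v \<in> V. chosen \<eta> T E v}"
  unfolding dominating_set_def
proof (intro conjI ballI)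
  fix v assume v: "v \<in> V"
  show "v \<in> {v \<in> V. chosen \<eta> T E v} \<or> (\<exists>u\<in>{v \<in> V. chosen \<eta> T E v}. E v u)"
  proof (cases "chosen \<eta> T E v \<or> (\<exists>u. E v u \<and> chosen \<eta> T E u)")
    case True
    then show ?thesis using v E_V by blast
  next
    case False
    then have nc: "\<not> chosen \<eta> T E v" "\<And>u. E v u \<Longrightarrow> \<not> chosen \<eta> T E u" by auto
    have "free E v" using nc by (auto simp: chosen_def free_def)
    moreover have "\<not> rest E v" using nc by (auto simp: chosen_def)
    ultimately obtain u z where uz: "E v u" "E v z" "z \<in> fat E u" by (auto simp: rest_def)
    then have "{u, z} \<in> R" unfolding R_def by blast
    from xs_feasible[OF this] have "xs u + xs z \<ge> 1" using fat_V[OF uz(3)] by simp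
    moreover have "xs u < 1 / 5" "xs z < 1 / 5" using nc(2) uz by (auto simp: chosen_def not_le)
    ultimately show ?thesis by simp
  qed
qed auto

lemma chosen_bound:
  assumes small: "\<eta> * 5017\<^sup>2 * 60007 \<le> 1 / 5" "6 \<le> \<eta> * T"
  shows "card {v \<in> V. chosen \<eta> T E v} \<le> 8 * card D"
proof -
  obtain Y where Y: "Y \<subseteq> S" "\<And>C. C \<in> R \<Longrightarrow> C \<inter> Y \<noteq> {}"
    "card Y \<le> card {d \<in> D. \<not> hub E d} + card X2" using cheap_cover by blast
  define y :: "nat \<Rightarrow> real" where "y = (\<lambda>w. if w \<in> Y then 1 else 0)"
  have fY: "finite Y" using Y(1) finite_S finite_subset by auto
  have sy: "sum y S = card Y" "(\<Sum>w\<in>S. (y w)\<^sup>2) = card Y"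
    using Y(1) finite_S by (simp_all add: y_def sum.If_cases Int_absorb1 if_distrib[of "\<lambda>t. t\<^sup>2"] cong: if_cong)
  have "(\<Sum>i<T. sum (x i) S + (\<Sum>C\<in>R. deficit i C))
    \<le> real T * sum y S + (\<Sum>w\<in>S. (y w)\<^sup>2) / (2 * \<eta>) + real T * \<eta> * (1 + real 5016)\<^sup>2 * card S / 2"
  proof (rule covering_descent[OF finite_S finite_R R_subset_S])
    show "x (Suc i) w = max 0 (x i w - \<eta> * (1 - real (card {C \<in> R. w \<in> C \<and> sum (x i) C < 1})))"
      if "w \<in> S" for i w
    proof -
      have "{C \<in> constraints E w. sum (x i) C < 1} = {C \<in> R. w \<in> C \<and> sum (x i) C < 1}"
        using constraints_eq[OF that] by auto
      then show ?thesis using that by (simp add: S_def)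
    qed
    show "1 \<le> sum y C" if C: "C \<in> R" for C
    proof -
      obtain w where w: "w \<in> C" "w \<in> Y" using Y(2)[OF C] by blast
      then have "y w \<le> sum y C"
        using R_nonempty[OF C] by (intro member_le_sum) (auto simp: y_def)
      then show ?thesis using w by (simp add: y_def)
    qed
  qed (use constraints_degree \<eta> in \<open>auto simp: y_def\<close>)
  then have "(\<Sum>w\<in>V. xs w) \<le> (real T * card Y + card Y / (2 * \<eta>) + real T * \<eta> * 5017\<^sup>2 * card S / 2) / T"
    unfolding sum_xs sy using T by (simp add: divide_right_mono)
  also have "\<dots> = card Y + card Y / (2 * (\<eta> * T)) + (\<eta> * 5017\<^sup>2 * card S) / 2"
    using T \<eta> by (simp add: field_simps)
  \<comment> \<open>The first error comes from the squared distance between the zero start and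
    \<open>y\<close>, and \<open>6 \<le> \<eta> * T\<close> makes it at most |Y| / 12. The second is
    the accumulated step error, with 5017 = 1 + 5016; by \<open>S_bound\<close> and the choice of
    step size it is at most |D| / 10.\<close>
  also have "\<dots> \<le> card Y + card Y / 12 + card D / 10"
  proof -
    have "real (card Y) / (2 * (\<eta> * T)) \<le> card Y / 12"
      using small(2) by (intro divide_left_mono) auto
    moreover have "\<eta> * 5017\<^sup>2 * card S \<le> \<eta> * 5017\<^sup>2 * (60007 * card D)"
      using S_bound \<eta> by (intro mult_left_mono) (auto simp flip: of_nat_mult)
    moreover have "(\<eta> * 5017\<^sup>2 * 60007) * card D \<le> 1 / 5 * card D"
      using small(1) by (intro mult_right_mono) auto
    ultimately show ?thesis by simp
  qed
  finally have sumxs: "(\<Sum>w\<in>V. xs w) \<le> card Y + card Y / 12 + card D / 10" .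
  let ?H = "{w \<in> V. xs w \<ge> 1 / 5}"
  define U where "U = {u \<in> V. rest E u \<and> xs u < 1 / 5 \<and> (\<forall>w. E u w \<longrightarrow> xs w < 1 / 5)}"
  have HU: "real (card ?H) + real (card U) \<le> 5 * (\<Sum>w\<in>V. xs w)"
  proof (rule threshold_rounding[OF finite_V E_V E_sym pairs_bound xs_nonneg])
    show "1 \<le> xs u + (\<Sum>w\<in>{w. E u w}. xs w)" if "u \<in> U" for u
    proof -
      have u: "u \<in> V" "rest E u" using that by (auto simp: U_def)
      then have "star E u \<in> R" by (auto simp: R_def R1_def)
      then have "1 \<le> sum xs (star E u)" by (rule xs_feasible)
      also have "\<dots> \<le> sum xs (insert u {w. E u w})"
        using u E_V xs_nonneg finite_N by (intro sum_mono2) (auto simp: star_def)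
      also have "\<dots> = xs u + (\<Sum>w\<in>{w. E u w}. xs w)" using finite_N E_irrefl by simp
      finally show ?thesis .
    qed
  qed (auto simp: U_def)
  have "{v \<in> V. chosen \<eta> T E v} \<subseteq> {d \<in> D. hub E d} \<union> {v \<in> V - D. hub E v} \<union> (?H \<union> U)"
    by (auto simp: chosen_def U_def not_le)
  then have "card {v \<in> V. chosen \<eta> T E v} \<le> card ({d \<in> D. hub E d} \<union> {v \<in> V - D. hub E v} \<union> (?H \<union> U))"
    using finite_V finite_D by (intro card_mono) (auto simp: U_def)
  also have "\<dots> \<le> card {d \<in> D. hub E d} + card {v \<in> V - D. hub E v} + (card ?H + card U)"
    by (intro order_trans[OF card_Un_le] add_mono card_Un_le)
  finally have "real (card {v \<in> V. chosen \<eta> T E v})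
     \<le> card {d \<in> D. hub E d} + card {v \<in> V - D. hub E v} + (real (card ?H) + real (card U))"
    by linarith
  moreover have "card {d \<in> D. hub E d} + card {d \<in> D. \<not> hub E d} = card D"
    using finite_D by (subst card_Un_disjoint[symmetric]) (auto intro: arg_cong[of _ _ card])
  \<comment> \<open>With h hubs in \<open>D\<close> the total is at most h + |D| + 5 * (13/12 * (|D|
    - h + |D| / 5) + |D| / 10). This is largest for h = 0, where the coefficient of |D| is 1 + 65/12
    + 13/12 + 1/2 = 8.\<close>
  ultimately show ?thesis using hub_outside_D X2_bound Y(3) HU sumxs by linarith
qed

end

end

lemma eight_approximation:
  assumes G: "simple_graph V E" "planar V E" "triangle_free V E"
    and \<eta>: "\<eta> > 0" "\<eta> * 5017\<^sup>2 * 60007 \<le> 1 / 5" and T: "T > 0" "6 \<le> \<eta> * real T"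
  shows "dominating_set V E {v \<in> V. chosen \<eta> T E v}"
    "card {v \<in> V. chosen \<eta> T E v} \<le> 8 * domination_number V E"
proof -
  interpret tf_planar V E by unfold_locales (fact G)+
  have "{card D |D. dominating_set V E D} \<subseteq> {..card V}"
    using finite_V by (auto simp: dominating_set_def intro: card_mono)
  then have "finite {card D |D. dominating_set V E D}" using finite_subset by blast
  moreover have "dominating_set V E V" by (auto simp: dominating_set_def)
  then have "{card D |D. dominating_set V E D} \<noteq> {}" by blast
  ultimately have "domination_number V E \<in> {card D |D. dominating_set V E D}"
    unfolding domination_number_def by (rule Min_in)
  then obtain D where D: "dominating_set V E D" "card D = domination_number V E" by auto
  define dm where "dm = (\<lambda>v. SOME d. d \<in> D \<and> (d = v \<or> E v d))"
  have dm: "dm v \<in> D \<and> (dm v = v \<or> E v (dm v))" if "v \<in> V" for v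
    unfolding dm_def by (rule someI_ex) (use D(1) that in \<open>auto simp: dominating_set_def\<close>)
  interpret tf_planar_dominated V E D dm
    by unfold_locales (use D(1) dm in \<open>auto simp: dominating_set_def\<close>)
  show "dominating_set V E {v \<in> V. chosen \<eta> T E v}" by (rule chosen_dominating[OF \<eta>(1) T(1)])
  show "card {v \<in> V. chosen \<eta> T E v} \<le> 8 * domination_number V E"
    using chosen_bound[OF \<eta>(1) T(1) \<eta>(2) T(2)] D(2) by simp
qed

theorem theorem4:
  fixes \<epsilon> :: real
  assumes "\<epsilon> > 0"
  shows "\<exists>(r :: nat) (A :: nat set \<Rightarrow> (nat \<Rightarrow> nat \<Rightarrow> bool) \<Rightarrow> nat \<Rightarrow> bool).
    \<forall>V E. simple_graph V E \<and> planar V E \<and> triangle_free V E \<longrightarrow>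
      dominating_set V E (local_output A r V E) \<and>
      real (card (local_output A r V E)) \<le> (8 + \<epsilon>) * real (domination_number V E)"
proof -
  \<comment> \<open>The step size meets its upper bound with equality, and \<open>T\<close> is then
    the least admissible number of steps, 6 / \<open>\<eta>\<close>.\<close>
  define \<eta> :: real where "\<eta> = 1 / (5 * 5017\<^sup>2 * 60007)"
  define T :: nat where "T = 30 * 5017\<^sup>2 * 60007"
  have *: "\<eta> > 0" "\<eta> * 5017\<^sup>2 * 60007 \<le> 1 / 5" "T > 0" "6 \<le> \<eta> * real T"
    by (simp_all add: \<eta>_def T_def)
  have out: "local_output (\<lambda>_. chosen \<eta> T) (Suc (22 + 2 * T)) V E = {v \<in> V. chosen \<eta> T E v}" for V E
    by (rule local_output_local_rule[OF local_chosen])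
  show ?thesis
  proof (intro exI allI impI)
    fix V E assume "simple_graph V E \<and> planar V E \<and> triangle_free V E"
    then have G: "simple_graph V E" "planar V E" "triangle_free V E" by auto
    note ea = eight_approximation[OF G *]
    have "real (card {v \<in> V. chosen \<eta> T E v}) \<le> 8 * real (domination_number V E)"
      using ea(2) by linarith
    also have "\<dots> \<le> (8 + \<epsilon>) * real (domination_number V E)"
      using assms by (intro mult_right_mono) auto
    finally show "dominating_set V E (local_output (\<lambda>_. chosen \<eta> T) (Suc (22 + 2 * T)) V E) \<and>
      real (card (local_output (\<lambda>_. chosen \<eta> T) (Suc (22 + 2 * T)) V E)) \<le> (8 + \<epsilon>) * real (domination_number V E)"
      unfolding out using ea(1) by simp
  qed
qed

end
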